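(* Let $(\xi_k^x)_{k\ge1}$ and $(\xi_k^y)_{k\ge1}$ be independent sequences of i.i.d. non-negative integer-valued random variables with $\xi_1^x\stackrel{d}{=}\xi_1^y$. If $\mathbb{E}[(\xi_1^x)^\alpha]=\infty$ for some $\alpha\in(0,1)$, then for all $\varepsilon\in(0,1-p_c]$, $$\mathbb{P}^{\Xi}_{p_c+\varepsilon,\,p_c}(o\longleftrightarrow\infty)=0\quad\text{for }\mu_\xi\text{-almost every }\Xi.$$
   Context: $\mathbb{Z}_+=\{0,1,2,\dots\}$, and $\mathbb{L}^2_+$ is the nearest-neighbour square lattice restricted to the first quadrant, with vertex set $\mathbb{Z}_+^2$ and origin $o=(0,0)$. Random environment: the spacings define the selected columns $\mathcal{C}=\{0\}\cup\{\sum_{k=1}^m\xi_k^x: m\ge1\}$, the selected rows $\mathcal{R}=\{0\}\cup\{\sum_{k=1}^m\xi_k^y: m\ge1\}$, and the environment $\Xi=\mathcal{C}\times\mathcal{R}\subset\mathbb{Z}_+^2$. $\mu_\xi$ denotes the law of the environment, i.e. the product of the law of $\mathcal{C}$ and the law of $\mathcal{R}$. Percolation: for fixed $\Xi$ and $p,q\in[0,1]$, $\mathbb{P}^{\Xi}_{p,q}$ is the product measure on $\{0,1\}^{\mathbb{Z}_+^2}$ under which the $\omega(v)$, $v\in\mathbb{Z}_+^2$, are independent, with $\omega(v)=1$ ($v$ open) with probability $p$ if $v\in\Xi$ and with probability $q$ if $v\notin\Xi$. A path (sequence of distinct successively adjacent vertices) is open if all its vertices are open. $\{o\longleftrightarrow\infty\}$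 is the event that there is an unbounded sequence of vertices of $\mathbb{Z}_+^2$ each connected to $o$ by an open path. $p_c$ is the critical threshold of homogeneous Bernoulli site percolation on $\mathbb{L}^2_+$. *)

theory Defs
  imports "HOL-Probability.Probability"
begin

section \<open>The quadrant lattice and connectivity to infinity\<close>

type_synonym vertex = "nat \<times> nat"

definition adjacent :: "vertex \<Rightarrow> vertex \<Rightarrow> bool" where
  "adjacent u v \<longleftrightarrow>
     \<bar>int (fst u) - int (fst v)\<bar> + \<bar>int (snd u) - int (snd v)\<bar> = 1"

definition open_path :: "(vertex \<Rightarrow> bool) \<Rightarrow> vertex list \<Rightarrow> bool" where
  "open_path \<omega> vs \<longleftrightarrow>
     vs \<noteq> [] \<and> distinct vs \<and> successively adjacent vs \<and> (\<forall>v\<in>set vs. \<omega> v)"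

definition connected_in :: "(vertex \<Rightarrow> bool) \<Rightarrow> vertex \<Rightarrow> vertex \<Rightarrow> bool" where
  "connected_in \<omega> u v \<longleftrightarrow> (\<exists>vs. open_path \<omega> vs \<and> hd vs = u \<and> last vs = v)"

definition origin_to_infinity :: "(vertex \<Rightarrow> bool) set" where
  "origin_to_infinity =
     {\<omega>. \<exists>s :: nat \<Rightarrow> vertex. (\<forall>N. \<exists>n. N < fst (s n) + snd (s n)) \<and>
        (\<forall>n. connected_in \<omega> (0, 0) (s n))}"

section \<open>Site percolation\<close>

definition site_measure :: "(vertex \<Rightarrow> real) \<Rightarrow> (vertex \<Rightarrow> bool) measure" where
  "site_measure r = Pi\<^sub>M UNIV (\<lambda>v. measure_pmf (bernoulli_pmf (r v)))"

definition env_measure :: "vertex set \<Rightarrow> real \<Rightarrow> real \<Rightarrow> (vertex \<Rightarrow> bool) measure" where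
  "env_measure \<Xi> p q = site_measure (\<lambda>v. if v \<in> \<Xi> then p else q)"

definition p_crit :: real where
  "p_crit = Sup {p \<in> {0..1}. measure (site_measure (\<lambda>_. p)) origin_to_infinity = 0}"

section \<open>The random environment\<close>

definition selected :: "(nat \<Rightarrow> nat) \<Rightarrow> nat set" where
  "selected \<xi> = {0} \<union> {(\<Sum>k=1..m. \<xi> k) | m. 1 \<le> m}"

text \<open>Subsets of \<open>\<nat>\<close> carry the product \<open>\<sigma>\<close>-algebra of \<open>{0,1}\<close>-valued sequences,
  generated by the events that a given number is selected.\<close>

definition nat_subsets :: "nat set measure" where
  "nat_subsets = sigma UNIV (range (\<lambda>n. {C. n \<in> C}))"

definition selected_law :: "'a measure \<Rightarrow> (nat \<Rightarrow> 'a \<Rightarrow> nat) \<Rightarrow> nat set measure" where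
  "selected_law M \<xi> = distr M nat_subsets (\<lambda>x. selected (\<lambda>k. \<xi> k x))"

text \<open>A sample of the environment law is the pair of selected columns and selected rows;
  the environment itself is their Cartesian product.\<close>

definition env_law ::
  "'a measure \<Rightarrow> (nat \<Rightarrow> 'a \<Rightarrow> nat) \<Rightarrow> (nat \<Rightarrow> 'a \<Rightarrow> nat) \<Rightarrow> (nat set \<times> nat set) measure" where
  "env_law M X Y = selected_law M X \<Otimes>\<^sub>M selected_law M Y"

section \<open>Measurability\<close>

text \<open>\<^const>\<open>measure\<close> and \<^const>\<open>distr\<close> take default values on non-measurable arguments;
  the following facts show that this does not happen above.\<close>

lemma origin_to_infinity_iff:
  "\<omega> \<in> origin_to_infinity \<longleftrightarrow>
     (\<forall>N. \<exists>vs. (N < fst (last vs) + snd (last vs) \<and> vs \<noteq> [] \<and> distinct vs \<and>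
        successively adjacent vs \<and> hd vs = (0, 0)) \<and> (\<forall>v\<in>set vs. \<omega> v))"
    (is "_ \<longleftrightarrow> ?R")
proof -
  have R: "?R \<longleftrightarrow> (\<forall>N. \<exists>v. N < fst v + snd v \<and> connected_in \<omega> (0, 0) v)"
    unfolding connected_in_def open_path_def by blast
  show ?thesis
  proof
    assume "\<omega> \<in> origin_to_infinity"
    then show ?R
      unfolding R origin_to_infinity_def by blast
  next
    assume ?R
    then obtain s where "\<And>N. N < fst (s N) + snd (s N) \<and> connected_in \<omega> (0, 0) (s N)"
      unfolding R by metis
    then show "\<omega> \<in> origin_to_infinity"
      unfolding origin_to_infinity_def by blast
  qed
qed

lemma space_site_measure [simp]: "space (site_measure r) = UNIV"
  by (simp add: site_measure_def space_PiM)

lemma origin_to_infinity_sets [measurable]: "origin_to_infinity \<in> sets (site_measure r)"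
proof -
  have [measurable]: "Measurable.pred (site_measure r) (\<lambda>\<omega>. \<omega> v)" for v
    unfolding site_measure_def by (rule measurable_compose[OF measurable_component_singleton]) auto
  have "{\<omega> \<in> space (site_measure r). \<omega> \<in> origin_to_infinity} \<in> sets (site_measure r)"
    unfolding origin_to_infinity_iff by measurable
  then show ?thesis by simp
qed

lemma space_nat_subsets [simp]: "space nat_subsets = UNIV"
  by (simp add: nat_subsets_def space_measure_of_conv)

lemma measurable_selected:
  assumes X: "\<And>k. 1 \<le> k \<Longrightarrow> \<xi> k \<in> measurable M (count_space UNIV)"
  shows "(\<lambda>x. selected (\<lambda>k. \<xi> k x)) \<in> measurable M nat_subsets"
  unfolding nat_subsets_def
proof (rule measurable_measure_of)
  fix A :: "nat set set"
  assume "A \<in> range (\<lambda>n. {C. n \<in> C})"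
  then obtain n where A: "A = {C. n \<in> C}" by auto
  have [measurable]: "(\<lambda>x. \<Sum>k=1..m. \<xi> k x) \<in> measurable M (count_space UNIV)" for m
    by (rule measurable_sum_nat) (use X in auto)
  have "(\<lambda>x. selected (\<lambda>k. \<xi> k x)) -` A \<inter> space M =
      {x \<in> space M. n = 0 \<or> (\<exists>m. 1 \<le> m \<and> n = (\<Sum>k=1..m. \<xi> k x))}"
    unfolding A selected_def by auto
  also have "\<dots> \<in> sets M" by measurable
  finally show "(\<lambda>x. selected (\<lambda>k. \<xi> k x)) -` A \<inter> space M \<in> sets M" .
qed auto

end

theory Submission
  imports Defs
begin

text \<open>
  The proof combines an estimate for critical homogeneous percolation, uniform over scales, with
  the observation that a heavy-tailed environment has large empty regions at infinitely many scales.

  \<^bold>\<open>Environment.\<close>  A site lies in \<open>C \<times> R\<close> only if both of its coordinates are selected.  If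
  neither a column nor a row with index in \<open>{m<..20*m}\<close> is selected, then the quadrant annulus
  between the boxes \<open>{..m} \<times> {..m}\<close> and \<open>{..20*m} \<times> {..20*m}\<close> contains no site of \<open>C \<times> R\<close>,
  and percolation in it is homogeneous at \<open>p_crit\<close>.  As \<open>\<xi>\<close> has an infinite moment of order
  less than one, there are infinitely many scales \<open>n\<close> at which \<open>(n + 1) * P (\<xi> > n)\<close> is at
  least a fixed multiple of the mean of \<open>\<xi>\<close> truncated at \<open>n + 1\<close>
  (\<open>infinite_heavy_scales\<close>).  At such a scale a jump over \<open>n\<close> comes with probability bounded below before the partial sums reach \<open>n div 40\<close>
  (\<open>prob_big_jump\<close>), and Kolmogorov's zero-one law turns this into infinitely many gaps
  (\<open>infinitely_many_gaps\<close>).  The set of good scales depends only on the law of \<open>\<xi>\<close>, and the gaps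
  occur along every infinite set of good scales; so the gaps of the rows can be sought among the
  scales at which the columns have one, and Fubini's theorem provides common gaps.

  \<^bold>\<open>Percolation.\<close>  There is \<open>\<eta> > 0\<close> such that, at \<open>p_crit\<close>, for every \<open>m \<ge> 1\<close> the
  annulus above is crossed with probability at most \<open>1 - \<eta>\<close> (\<open>arm_at_criticality\<close>).  Infinitely many
  disjoint homogeneous annuli must be crossed by an infinite path from the origin, and the crossings
  are independent, so percolation has probability zero (\<open>no_percolation_with_gaps\<close>).

  The bound \<open>\<eta>\<close> comes from a finite-size criterion.  Suppose that some annulus is crossed with
  probability close to one.  Since correlations are positive (\<open>harris\<close>), one of finitely many
  increasing events whose union is likely is itself likely (\<open>square_root_trick\<close>).  Hence rectangles
  slightly narrower than tall are likely to be crossed horizontally, and there is a short segment \<open>J\<close>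
  of the top side of a rectangle \<open>\<Lambda>\<close> that is likely to be joined to the rest of the boundary.  The
  lowest crossing of the left half of \<open>\<Lambda>\<close> and its mirror image form a barrier below \<open>J\<close>; by symmetry
  \<open>J\<close> is likely to be joined to the left part of the barrier, and so to the left side of \<open>\<Lambda>\<close>
  (\<open>gluing_by_reflection\<close>).  In the same way the neighbouring segment is likely to be joined to
  the right side, the two paths have to meet, and they form a crossing of a rectangle almost twice as
  long as tall (\<open>long_crossing_from_arm\<close>).  Long crossings with probability close to one
  propagate to all larger scales with rapidly decreasing error and make the origin percolate
  (\<open>percolation_from_long_crossings\<close>).  As crossing probabilities are continuous in \<open>p\<close>, this would
  happen in a neighbourhood of \<open>p_crit\<close>, against the definition of \<open>p_crit\<close> as a supremum.

  The only topology needed is that of crossings of rectangles: a left-right path and a bottom-top path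
  meet (\<open>crossings_meet\<close>), and one of the two exists when bottom-top paths may also use diagonal
  steps and only the sites that left-right paths avoid (\<open>primal_or_dual_crossing\<close>).
\<close>

section \<open>Lattice paths and planar duality\<close>

type_synonym site = "int \<times> int"

definition adj4 :: "site \<Rightarrow> site \<Rightarrow> bool" where
  "adj4 u v \<longleftrightarrow> \<bar>fst u - fst v\<bar> + \<bar>snd u - snd v\<bar> = 1"

definition adj8 :: "site \<Rightarrow> site \<Rightarrow> bool" where
  "adj8 u v \<longleftrightarrow> u \<noteq> v \<and> \<bar>fst u - fst v\<bar> \<le> 1 \<and> \<bar>snd u - snd v\<bar> \<le> 1"

definition reach :: "('v \<Rightarrow> 'v \<Rightarrow> bool) \<Rightarrow> 'v set \<Rightarrow> 'v \<Rightarrow> 'v \<Rightarrow> bool" where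
  "reach E S u v \<longleftrightarrow> u \<in> S \<and> (\<lambda>a b. E a b \<and> b \<in> S)\<^sup>*\<^sup>* u v"

lemma adj4_sym: "adj4 u v \<Longrightarrow> adj4 v u"
  by (auto simp: adj4_def)

lemma adj8_sym: "adj8 u v \<Longrightarrow> adj8 v u"
  by (auto simp: adj8_def)

lemma adj4_imp_adj8: "adj4 u v \<Longrightarrow> adj8 u v"
  by (auto simp: adj4_def adj8_def)

lemma reach_refl: "u \<in> S \<Longrightarrow> reach E S u u"
  by (simp add: reach_def)

lemma reach_step: "reach E S u v \<Longrightarrow> E v w \<Longrightarrow> w \<in> S \<Longrightarrow> reach E S u w"
  by (auto simp: reach_def intro: rtranclp.rtrancl_into_rtrancl)

lemma reach_induct [consumes 1, case_names refl step]:
  assumes "reach E S u v"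
    and "u \<in> S \<Longrightarrow> P u"
    and "\<And>v w. reach E S u v \<Longrightarrow> E v w \<Longrightarrow> w \<in> S \<Longrightarrow> v \<in> S \<Longrightarrow> P v \<Longrightarrow> P w"
  shows "P v"
proof -
  have u: "u \<in> S" and r: "(\<lambda>a b. E a b \<and> b \<in> S)\<^sup>*\<^sup>* u v" using assms(1) by (auto simp: reach_def)
  from r have "P v \<and> v \<in> S"
  proof (induction rule: rtranclp_induct)
    case base then show ?case using assms(2) u by simp
  next
    case (step y z)
    then show ?case using assms(3)[of y z] u by (auto simp: reach_def)
  qed
  then show ?thesis by simp
qed

lemma reach_in: "reach E S u v \<Longrightarrow> u \<in> S \<and> v \<in> S"
  by (induction rule: reach_induct) (auto simp: reach_def)

lemma reach_trans: "reach E S u v \<Longrightarrow> reach E S v w \<Longrightarrow> reach E S u w"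
  by (auto simp: reach_def)

lemma reach_sym:
  assumes "\<And>a b. E a b \<Longrightarrow> E b a" and "reach E S u v"
  shows "reach E S v u"
  using assms(2)
proof (induction rule: reach_induct)
  case refl then show ?case by (rule reach_refl)
next
  case (step v w)
  have "reach E S w v" using reach_step[OF reach_refl[OF step(3)]] assms(1) step by blast
  then show ?case using step reach_trans by metis
qed

lemma reach_mono:
  assumes "reach E S u v" "S \<subseteq> T" shows "reach E T u v"
  using assms(1) by (induction rule: reach_induct) (use assms(2) in \<open>auto intro: reach_refl reach_step\<close>)

lemma reach_map:
  assumes "reach E S u v" and "\<And>a b. a \<in> S \<Longrightarrow> b \<in> S \<Longrightarrow> E a b \<Longrightarrow> E' (f a) (f b) \<or> f a = f b"
  shows "reach E' (f ` S) (f u) (f v)"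
  using assms(1)
proof (induction rule: reach_induct)
  case refl then show ?case by (auto intro: reach_refl)
next
  case (step v w)
  then show ?case using assms(2)[of v w] by (metis imageI reach_step)
qed

lemma reach_component:
  assumes "reach E S u v"
  shows "reach E {x. reach E S u x} u v"
  using assms
proof (induction rule: reach_induct)
  case refl then show ?case by (auto intro: reach_refl)
next
  case (step v w)
  then show ?case by (auto intro: reach_step)
qed

text \<open>The main tool for cutting a path down to a smaller region: up to its first exit it stays inside.\<close>

lemma reach_exit:
  assumes "reach E S u v" "u \<in> T"
  shows "reach E (S \<inter> T) u v \<or> (\<exists>w w'. reach E (S \<inter> T) u w \<and> E w w' \<and> w' \<in> S - T)"
  using assms
proof (induction rule: reach_induct)
  case refl then show ?case by (auto intro: reach_refl)
next
  case (step v w)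
  then show ?case by (metis DiffI IntI reach_step)
qed

definition pt :: "site \<Rightarrow> real^2" where
  "pt u = vector [real_of_int (fst u), real_of_int (snd u)]"

lemma pt_nth [simp]: "pt u $ 1 = real_of_int (fst u)" "pt u $ 2 = real_of_int (snd u)"
  by (simp_all add: pt_def)

text \<open>Discrete paths become polygonal curves, so that the Fashoda meet theorem applies to them.\<close>

lemma reach_polyline:
  assumes "reach E S u v"
  obtains g where "path g" "pathstart g = pt u" "pathfinish g = pt v"
    "path_image g \<subseteq> {z. \<exists>a b. a \<in> S \<and> b \<in> S \<and> (a = b \<or> E a b) \<and> z \<in> closed_segment (pt a) (pt b)}"
proof -
  let ?U = "{z. \<exists>a b. a \<in> S \<and> b \<in> S \<and> (a = b \<or> E a b) \<and> z \<in> closed_segment (pt a) (pt b)}"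
  have U: "closed_segment (pt a) (pt b) \<subseteq> ?U" if "a \<in> S" "b \<in> S" "a = b \<or> E a b" for a b
    using that by blast
  have "\<exists>g. path g \<and> pathstart g = pt u \<and> pathfinish g = pt v \<and> path_image g \<subseteq> ?U"
    using assms
  proof (induction rule: reach_induct)
    case refl
    then have "pt u \<in> ?U" using ends_in_segment(1) by blast
    then show ?case
      by (intro exI[of _ "linepath (pt u) (pt u)"]) (simp only: path_linepath pathstart_linepath
        pathfinish_linepath path_image_linepath closed_segment_idem, blast)
  next
    case (step v w)
    then obtain g where g: "path g" "pathstart g = pt u" "pathfinish g = pt v" "path_image g \<subseteq> ?U"
      by blast
    have "path_image (linepath (pt v) (pt w)) \<subseteq> ?U"
      unfolding path_image_linepath using U[of v w] step by blast
    then show ?case using g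
      by (intro exI[of _ "g +++ linepath (pt v) (pt w)"])
        (simp add: path_image_join)
  qed
  then show ?thesis using that by blast
qed

text \<open>The situation where the first of two segments is horizontal (or a point): seen from the
  start of the first segment, its step is \<open>(A, 0)\<close>, the second segment starts at \<open>(X, Y)\<close> and its step is
  \<open>(C, D)\<close>.  If \<open>D \<noteq> 0\<close>, the second segment is on the row of the first one only at an endpoint;
  if \<open>D = 0\<close>, both are integer intervals of length at most one.\<close>

lemma unit_steps_meet_on_line:
  fixes s t :: real and A C D X Y :: int
  assumes s: "0 \<le> s" "s \<le> 1" and t: "0 \<le> t" "t \<le> 1"
    and A: "A \<in> {-1,0,1}" and C: "C \<in> {-1,0,1}" and D: "D \<in> {-1,0,1}"
    and 1: "s * A = X + t * C" and 2: "0 = Y + t * D"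
  shows "(X = 0 \<and> Y = 0) \<or> (X + C = 0 \<and> Y + D = 0) \<or> (X = A \<and> Y = 0) \<or> (X + C = A \<and> Y + D = 0)"
proof -
  have integral: "r = 0 \<or> r = 1" if "r = real_of_int k" "0 \<le> r" "r \<le> 1" for r k
  proof -
    have "0 \<le> k" "k \<le> 1" using that by auto
    then have "k = 0 \<or> k = 1" by auto
    then show ?thesis using that by auto
  qed
  have step: "Z = 0 \<or> Z = A" if "s * A = real_of_int Z" for Z
    using A that integral[of s Z] integral[of s "- Z"] s by auto
  show ?thesis
  proof (cases "D = 0")
    case True
    then have "Y = 0" using 2 by simp
    have "-2 \<le> X" "X \<le> 2" using A C s t 1 by auto
    then have "X = -2 \<or> X = -1 \<or> X = 0 \<or> X = 1 \<or> X = 2" by linarith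
    then show ?thesis using A C s t 1 True \<open>Y = 0\<close> by auto
  next
    case False
    then have "t = real_of_int Y \<or> t = real_of_int (- Y)" using D 2 by auto
    then have "t = 0 \<or> t = 1" using integral t by blast
    then show ?thesis
    proof
      assume "t = 0"
      then show ?thesis using 1 2 step[of X] by auto
    next
      assume "t = 1"
      then have "s * A = real_of_int (X + C)" "Y + D = 0" using 1 2 by simp_all
      then show ?thesis using step[of "X + C"] by argo
    qed
  qed
qed

text \<open>Two lattice segments of which at most one is diagonal cross in a common lattice site only.  For two
  diagonal segments this fails, which is why one of the two paths uses nearest-neighbour steps.\<close>

lemma lattice_segments_meet:
  assumes ab: "a = b \<or> adj4 a b" and cd: "c = d \<or> adj8 c d"
    and z: "z \<in> closed_segment (pt a) (pt b)" "z \<in> closed_segment (pt c) (pt d)"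
  shows "{a, b} \<inter> {c, d} \<noteq> {}"
proof -
  obtain a1 a2 b1 b2 c1 c2 d1 d2 where e: "a = (a1,a2)" "b = (b1,b2)" "c = (c1,c2)" "d = (d1,d2)"
    by (metis surj_pair)
  obtain s where s: "0 \<le> s" "s \<le> 1" "z = (1 - s) *\<^sub>R pt a + s *\<^sub>R pt b"
    using z(1) by (auto simp: in_segment)
  obtain t where t: "0 \<le> t" "t \<le> 1" "z = (1 - t) *\<^sub>R pt c + t *\<^sub>R pt d"
    using z(2) by (auto simp: in_segment)
  have "z $ 1 = (1-s) * a1 + s * b1" "z $ 2 = (1-s) * a2 + s * b2"
    unfolding s(3) by (simp_all add: e)
  moreover have "z $ 1 = (1-t) * c1 + t * d1" "z $ 2 = (1-t) * c2 + t * d2"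
    unfolding t(3) by (simp_all add: e)
  ultimately have "(1-s) * a1 + s * b1 = (1-t) * c1 + t * d1" "(1-s) * a2 + s * b2 = (1-t) * c2 + t * d2"
    by simp_all
  then have eq: "a1 + s * (b1 - a1) = c1 + t * (d1 - c1)" "a2 + s * (b2 - a2) = c2 + t * (d2 - c2)"
    by (simp_all add: algebra_simps)
  define A where "A = b1 - a1" define B where "B = b2 - a2"
  define C where "C = d1 - c1" define D where "D = d2 - c2"
  define X where "X = c1 - a1" define Y where "Y = c2 - a2"
  have eqs: "s * A = X + t * C" "s * B = Y + t * D"
    using eq by (simp_all add: A_def B_def C_def D_def X_def Y_def)
  have AB: "(A = 0 \<and> B = 0) \<or> (A = 1 \<and> B = 0) \<or> (A = -1 \<and> B = 0) \<or> (A = 0 \<and> B = 1) \<or> (A = 0 \<and> B = -1)"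
    using ab by (auto simp: e adj4_def A_def B_def)
  have C: "C = 0 \<or> C = 1 \<or> C = -1" and D: "D = 0 \<or> D = 1 \<or> D = -1"
    using cd by (auto simp: e adj8_def C_def D_def)
  have "(X = 0 \<and> Y = 0) \<or> (X + C = 0 \<and> Y + D = 0) \<or> (X = A \<and> Y = B) \<or> (X + C = A \<and> Y + D = B)"
  proof (cases "B = 0")
    case True
    then show ?thesis
      using unit_steps_meet_on_line[of s t A C D X Y] s(1,2) t(1,2) eqs AB C D by auto
  next
    case False
    then have "A = 0" "B \<in> {-1,0,1}" using AB by auto
    then show ?thesis
      using unit_steps_meet_on_line[of s t B D C Y X] s(1,2) t(1,2) eqs C D by auto
  qed
  then show ?thesis
    by (auto simp: e A_def B_def C_def D_def X_def Y_def)
qed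

definition rect :: "int \<Rightarrow> int \<Rightarrow> int \<Rightarrow> int \<Rightarrow> site set" where
  "rect a b c d = {a..b} \<times> {c..d}"

lemma crossings_meet:
  assumes "reach adj4 P l r" "reach adj8 Q u v"
    and "P \<subseteq> rect a b c d" "Q \<subseteq> rect a b c d"
    and "fst l = a" "fst r = b" "snd u = c" "snd v = d"
  shows "P \<inter> Q \<noteq> {}"
proof -
  obtain f where f: "path f" "pathstart f = pt l" "pathfinish f = pt r"
    "path_image f \<subseteq> {z. \<exists>a b. a \<in> P \<and> b \<in> P \<and> (a = b \<or> adj4 a b) \<and> z \<in> closed_segment (pt a) (pt b)}"
    using reach_polyline[OF assms(1)] by blast
  obtain g where g: "path g" "pathstart g = pt u" "pathfinish g = pt v"
    "path_image g \<subseteq> {z. \<exists>a b. a \<in> Q \<and> b \<in> Q \<and> (a = b \<or> adj8 a b) \<and> z \<in> closed_segment (pt a) (pt b)}"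
    using reach_polyline[OF assms(2)] by blast
  have pt_box: "pt x \<in> cbox (pt (a,c)) (pt (b,d))" if "x \<in> rect a b c d" for x
    using that by (auto simp: rect_def mem_box_cart forall_2)
  have seg: "closed_segment (pt x) (pt y) \<subseteq> cbox (pt (a,c)) (pt (b,d))"
    if "x \<in> rect a b c d" "y \<in> rect a b c d" for x y
    using closed_segment_subset[OF pt_box pt_box] that by simp
  have fi: "path_image f \<subseteq> cbox (pt (a,c)) (pt (b,d))"
    using f(4) seg assms(3) by fast
  have gi: "path_image g \<subseteq> cbox (pt (a,c)) (pt (b,d))"
    using g(4) seg assms(4) by fast
  obtain z where "z \<in> path_image f" "z \<in> path_image g"
    by (rule fashoda[OF f(1) g(1) fi gi]) (use f g assms in auto)
  then show ?thesis
    using f(4) g(4) lattice_segments_meet by blast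
qed

lemma parity_of_changes:
  fixes f :: "int \<Rightarrow> bool"
  shows "odd (\<Sum>x = a..<a + int k. of_bool (f x \<noteq> f (x + 1)) :: int) \<longleftrightarrow> f a \<noteq> f (a + int k)"
proof (induction k)
  case 0 then show ?case by simp
next
  case (Suc k)
  have "{a..<a + int (Suc k)} = insert (a + int k) {a..<a + int k}" by auto
  then have "(\<Sum>x = a..<a + int (Suc k). of_bool (f x \<noteq> f (x + 1)) :: int)
     = of_bool (f (a + int k) \<noteq> f (a + int k + 1)) + (\<Sum>x = a..<a + int k. of_bool (f x \<noteq> f (x + 1)))"
    by simp
  moreover have "a + int (Suc k) = a + int k + 1" by simp
  ultimately show ?case using Suc.IH
    by (simp only: even_add) auto
qed

lemma even_sum_shift:
  fixes e :: "int \<Rightarrow> int"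
  shows "even ((\<Sum>x = a..<a + int k. e x + e (x + 1)) - e a - e (a + int k))"
proof (induction k)
  case 0 then show ?case by simp
next
  case (Suc k)
  have "{a..<a + int (Suc k)} = insert (a + int k) {a..<a + int k}" by auto
  then have eq: "(\<Sum>x = a..<a + int (Suc k). e x + e (x + 1))
     = e (a + int k) + e (a + int k + 1) + (\<Sum>x = a..<a + int k. e x + e (x + 1))"
    by simp
  have 1: "a + int (Suc k) = a + int k + 1" by simp
  have "(\<Sum>x = a..<a + int (Suc k). e x + e (x + 1)) - e a - e (a + int (Suc k))
     = ((\<Sum>x = a..<a + int k. e x + e (x + 1)) - e a - e (a + int k)) + 2 * e (a + int k)"
    unfolding eq unfolding 1 by simp
  then show ?case using dvd_add[OF Suc.IH, of "2 * e (a + int k)"] by (simp only: dvd_triv_left)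
qed

text \<open>This is the Hex theorem for the square lattice, proved by a parity argument.  Let \<open>A\<close> be the set
  of sites joined to the left side by a path in \<open>S\<close>, enlarged by a column to the left of the rectangle, and
  let \<open>B\<close> be the set of sites outside \<open>S\<close> joined to the bottom side by diagonal and straight steps.
  Consider the lattice edges that leave \<open>A\<close> through a site of \<open>B\<close>.  The outer endpoints of all edges of a
  unit square that leave \<open>A\<close> are equal or neighbours (straight or diagonal), so all or none of them belong
  to \<open>B\<close>; hence each unit square has an even number of the edges considered, and the parity of their number in a row is the same for all rows.  If \<open>A\<close> does not
  reach the right side, this number is odd in the bottom row, where membership in \<open>B\<close> is automatic;
  so it is odd in the top row, which is therefore reached by \<open>B\<close>.\<close>

lemma primal_or_dual_crossing:
  assumes ab: "a \<le> b" and cd: "c \<le> d"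
  shows "(\<exists>l r. reach adj4 (S \<inter> rect a b c d) l r \<and> fst l = a \<and> fst r = b) \<or>
    (\<exists>u v. reach adj8 (rect a b c d - S) u v \<and> snd u = c \<and> snd v = d)"
proof (rule disjCI)
  let ?R = "rect a b c d"
  assume nodual: "\<not> (\<exists>u v. reach adj8 (?R - S) u v \<and> snd u = c \<and> snd v = d)"
  show "\<exists>l r. reach adj4 (S \<inter> ?R) l r \<and> fst l = a \<and> fst r = b"
  proof (rule ccontr)
    assume noprimal: "\<not> ?thesis"
    define A where "A = {x. fst x = a - 1 \<or> (\<exists>l. fst l = a \<and> reach adj4 (S \<inter> ?R) l x)}"
    define B where "B = {x. \<exists>u. snd u = c \<and> reach adj8 (?R - S) u x}"
    have B_R: "x \<in> ?R - S" if "x \<in> B" for x using that unfolding B_def by (blast dest: reach_in)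
    have A_step: "y \<in> A \<or> y \<in> ?R - S" if "x \<in> A" "adj4 x y" "y \<in> ?R" for x y
    proof (cases "y \<in> S")
      case True
      show ?thesis
      proof (cases "fst x = a - 1")
        case t: True
        then have "fst y = a" using that by (auto simp: adj4_def rect_def)
        then show ?thesis using reach_refl[of y "S \<inter> ?R" adj4] True that(3) unfolding A_def by blast
      next
        case False
        then obtain l where "fst l = a" "reach adj4 (S \<inter> ?R) l x" using \<open>x \<in> A\<close> unfolding A_def by blast
        then have "reach adj4 (S \<inter> ?R) l y" using that True reach_step[of adj4 _ l x y] by simp
        then show ?thesis using \<open>fst l = a\<close> unfolding A_def by blast
      qed
    qed (use that in auto)
    have B_step: "y \<in> B" if "x \<in> B" "y \<in> ?R - S" "adj8 x y" for x y
    proof -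
      obtain u where "snd u = c" "reach adj8 (?R - S) u x" using \<open>x \<in> B\<close> unfolding B_def by blast
      then have "reach adj8 (?R - S) u y" using that reach_step[of adj8 _ u x y] by simp
      then show ?thesis using \<open>snd u = c\<close> unfolding B_def by blast
    qed
    have B_bot: "y \<in> B" if "y \<in> ?R - S" "snd y = c" for y
      using that unfolding B_def by (blast intro: reach_refl)
    have rightcol: "x \<notin> A" if "fst x = b" for x
      using that noprimal ab unfolding A_def by fastforce
    \<comment> \<open>an edge that leaves \<open>A\<close> through a site of \<open>B\<close>\<close>
    define q where "q x y \<longleftrightarrow> (x \<in> A) \<noteq> (y \<in> A) \<and> (if x \<in> A then y else x) \<in> B" for x y
    define eh where "eh x y = (of_bool (q (x,y) (x+1,y)) :: int)" for x y
    define ev where "ev x y = (of_bool (q (x,y) (x,y+1)) :: int)" for x y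
    have square: "even (eh x y + eh x (y+1) + ev x y + ev (x+1) y)"
      if x: "a - 1 \<le> x" "x < b" and y: "c \<le> y" "y < d" for x y
    proof -
      let ?p = "(x,y)" and ?q = "(x+1,y)" and ?r = "(x,y+1)" and ?s = "(x+1,y+1)"
      have adj: "adj4 ?p ?q" "adj4 ?q ?p" "adj4 ?r ?s" "adj4 ?s ?r" "adj4 ?p ?r" "adj4 ?r ?p" "adj4 ?q ?s" "adj4 ?s ?q"
        by (auto simp: adj4_def)
      have adj': "adj8 u v" if "u \<in> {?p,?q,?r,?s}" "v \<in> {?p,?q,?r,?s}" "u \<noteq> v" for u v
        using that by (auto simp: adj8_def)
      have inR: "u \<in> ?R \<or> u \<in> A" if "u \<in> {?p,?q,?r,?s}" for u
      proof -
        have "fst u \<in> {a - 1..b}" "snd u \<in> {c..d}" using that x y by auto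
        then show ?thesis by (cases u) (auto simp: rect_def A_def)
      qed
      have one: "(v \<in> B \<longleftrightarrow> w \<in> B)"
        if "u \<in> A" "adj4 u v" "v \<notin> A" "u' \<in> A" "adj4 u' w" "w \<notin> A" "v \<in> {?p,?q,?r,?s}" "w \<in> {?p,?q,?r,?s}" for u v u' w
      proof (cases "v = w")
        case False
        have "v \<in> ?R - S" using A_step[OF that(1,2)] inR[OF that(7)] that(3) by blast
        moreover have "w \<in> ?R - S" using A_step[OF that(4,5)] inR[OF that(8)] that(6) by blast
        moreover have "adj8 v w" "adj8 w v" using adj' that(7,8) False by auto
        ultimately show ?thesis using B_step[of v w] B_step[of w v] by blast
      qed auto
      let ?Q = "{?p,?q,?r,?s}"
      define \<beta> where "\<beta> \<longleftrightarrow> (\<exists>u\<in>?Q. \<exists>v\<in>?Q. u \<in> A \<and> v \<notin> A \<and> adj4 u v \<and> v \<in> B)"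
      have q: "q u v \<longleftrightarrow> (u \<in> A) \<noteq> (v \<in> A) \<and> \<beta>"
        if uv: "u \<in> ?Q" "v \<in> ?Q" "adj4 u v" "adj4 v u" for u v
      proof
        assume "q u v"
        then have "(u \<in> A \<and> v \<notin> A \<and> v \<in> B) \<or> (v \<in> A \<and> u \<notin> A \<and> u \<in> B)"
          unfolding q_def by presburger
        then show "(u \<in> A) \<noteq> (v \<in> A) \<and> \<beta>" unfolding \<beta>_def using uv by blast
      next
        assume *: "(u \<in> A) \<noteq> (v \<in> A) \<and> \<beta>"
        then obtain u' v' where uv': "u' \<in> ?Q" "v' \<in> ?Q" "u' \<in> A" "v' \<notin> A" "adj4 u' v'" "v' \<in> B"
          unfolding \<beta>_def by blast
        show "q u v"
        proof (cases "u \<in> A")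
          case True
          then show ?thesis
            using one[OF True uv(3) _ uv'(3,5,4) uv(2) uv'(2)] * uv'(6) unfolding q_def by simp
        next
          case False
          then show ?thesis
            using one[OF _ uv(4) False uv'(3,5,4) uv(1) uv'(2)] * uv'(6) unfolding q_def by simp
        qed
      qed
      have "q ?p ?q \<longleftrightarrow> (?p \<in> A) \<noteq> (?q \<in> A) \<and> \<beta>" "q ?r ?s \<longleftrightarrow> (?r \<in> A) \<noteq> (?s \<in> A) \<and> \<beta>"
        "q ?p ?r \<longleftrightarrow> (?p \<in> A) \<noteq> (?r \<in> A) \<and> \<beta>" "q ?q ?s \<longleftrightarrow> (?q \<in> A) \<noteq> (?s \<in> A) \<and> \<beta>"
        by (rule q; simp add: adj del: prod.inject)+
      then show ?thesis
        unfolding eh_def ev_def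
        by (cases "?p \<in> A"; cases "?q \<in> A"; cases "?r \<in> A"; cases "?s \<in> A"; cases \<beta>) simp_all
    qed
    define row where "row y = (\<Sum>x = a-1..<b. eh x y)" for y
    obtain k where k: "b = (a - 1) + int k" using ab zle_iff_zadd[of "a - 1" b] by auto
    have rows: "even (row y + row (y+1))" if y: "c \<le> y" "y < d" for y
    proof -
      have "even (\<Sum>x = a-1..<b. eh x y + eh x (y+1) + ev x y + ev (x+1) y)"
        by (rule dvd_sum) (use square y in auto)
      also have "(\<Sum>x = a-1..<b. eh x y + eh x (y+1) + ev x y + ev (x+1) y)
         = row y + row (y+1) + (\<Sum>x = a-1..<b. ev x y + ev (x+1) y)"
        by (simp add: row_def sum.distrib)
      finally have 1: "even (row y + row (y+1) + (\<Sum>x = a-1..<b. ev x y + ev (x+1) y))" .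
      have "(a-1,y) \<in> A" "(a-1,y+1) \<in> A" by (simp_all add: A_def)
      moreover have "(b,y) \<notin> A" "(b,y+1) \<notin> A" by (simp_all add: rightcol)
      ultimately
      have "ev (a-1) y = 0" "ev b y = 0" by (simp_all add: ev_def q_def)
      then have "even (\<Sum>x = a-1..<b. ev x y + ev (x+1) y)"
        using even_sum_shift[where a = "a-1" and k = k and e = "\<lambda>x. ev x y"] unfolding k[symmetric] by simp
      then show ?thesis using 1 by simp
    qed
    have row_c: "odd (row c)"
    proof -
      have "eh x c = of_bool (((x,c) \<in> A) \<noteq> ((x+1,c) \<in> A))" if "x \<in> {a-1..<b}" for x
      proof -
        have "(x+1,c) \<in> B" if "(x,c) \<in> A" "(x+1,c) \<notin> A"
          using A_step[of "(x,c)" "(x+1,c)"] that \<open>x \<in> _\<close> cd B_bot[of "(x+1,c)"] by (simp add: adj4_def rect_def)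
        moreover have "(x,c) \<in> B" if "(x+1,c) \<in> A" "(x,c) \<notin> A"
        proof -
          have "x \<noteq> a - 1" using that by (auto simp: A_def)
          then show ?thesis
            using A_step[of "(x+1,c)" "(x,c)"] that \<open>x \<in> _\<close> cd B_bot[of "(x,c)"] by (simp add: adj4_def rect_def)
        qed
        ultimately show ?thesis by (auto simp: eh_def q_def)
      qed
      then have "row c = (\<Sum>x = a-1..<b. of_bool (((x,c) \<in> A) \<noteq> ((x+1,c) \<in> A)))"
        by (simp add: row_def)
      moreover have "(a-1,c) \<in> A" by (simp add: A_def)
      moreover have "(b,c) \<notin> A" by (simp add: rightcol)
      ultimately show ?thesis
        using parity_of_changes[where a = "a-1" and k = k and f = "\<lambda>x. (x,c) \<in> A"] unfolding k[symmetric] by simp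
    qed
    have "odd (row (c + int j))" if "c + int j \<le> d" for j
      using that
    proof (induction j)
      case (Suc j)
      then have "odd (row (c + int j))" "even (row (c + int j) + row (c + int j + 1))"
        using rows[of "c + int j"] by auto
      then show ?case by (simp add: algebra_simps)
    qed (use row_c in simp)
    from this[of "nat (d - c)"] have "odd (row d)" using cd by simp
    then have "row d \<noteq> 0" by auto
    then obtain x where "eh x d \<noteq> 0" unfolding row_def by (meson sum.neutral)
    then have "q (x,d) (x+1,d)" by (simp add: eh_def)
    then have "\<exists>v \<in> B. snd v = d" unfolding q_def by (metis snd_conv)
    then show False using nodual unfolding B_def by blast
  qed
qed

section \<open>Finite percolation and positive correlation\<close>

text \<open>A configuration is the set of its open sites.  On a finite set \<open>S\<close> the percolation measure is a
  finite sum, polynomial in \<open>p\<close>; this gives the continuity in \<open>p\<close> and makes changes of the lattice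
  (translations, reflections, embeddings) instances of a change of summation variable.\<close>

definition pr :: "real \<Rightarrow> 'v set \<Rightarrow> ('v set \<Rightarrow> bool) \<Rightarrow> real" where
  "pr p S P = (\<Sum>w\<in>Pow S. of_bool (P w) * (p ^ card w * (1 - p) ^ card (S - w)))"

lemma pr_cong: "(\<And>w. w \<subseteq> S \<Longrightarrow> P w = Q w) \<Longrightarrow> pr p S P = pr p S Q"
  unfolding pr_def by (intro sum.cong) auto

lemma pr_empty: "pr p {} P = of_bool (P {})"
  by (simp add: pr_def)

lemma pr_insert:
  assumes "finite S" "x \<notin> S"
  shows "pr p (insert x S) P = p * pr p S (\<lambda>w. P (insert x w)) + (1 - p) * pr p S P"
proof -
  have inj: "inj_on (insert x) (Pow S)"
    using assms(2) by (auto simp: inj_on_def)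
  have disj: "Pow S \<inter> insert x ` Pow S = {}" using assms(2) by auto
  let ?g = "\<lambda>w. of_bool (P w) * (p ^ card w * (1 - p) ^ card (insert x S - w))"
  have "pr p (insert x S) P = sum ?g (Pow S) + sum ?g (insert x ` Pow S)"
    unfolding pr_def Pow_insert using assms disj by (intro sum.union_disjoint) auto
  also have "sum ?g (Pow S) = (1 - p) * pr p S P"
    unfolding pr_def sum_distrib_left
  proof (rule sum.cong)
    fix w assume w: "w \<in> Pow S"
    then have "insert x S - w = insert x (S - w)" using assms(2) by auto
    then have "card (insert x S - w) = Suc (card (S - w))" using assms by simp
    then show "?g w = (1 - p) * (of_bool (P w) * (p ^ card w * (1 - p) ^ card (S - w)))"
      by simp
  qed simp
  also have "sum ?g (insert x ` Pow S) = p * pr p S (\<lambda>w. P (insert x w))"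
    unfolding pr_def sum_distrib_left sum.reindex[OF inj]
  proof (rule sum.cong)
    fix w assume w: "w \<in> Pow S"
    then have "insert x S - insert x w = S - w" "finite w" "x \<notin> w"
      using assms finite_subset by auto
    then show "(?g \<circ> insert x) w = p * (of_bool (P (insert x w)) * (p ^ card w * (1 - p) ^ card (S - w)))"
      by simp
  qed simp
  finally show ?thesis by simp
qed

lemma pr_True: "finite S \<Longrightarrow> pr p S (\<lambda>_. True) = 1"
  by (induction S rule: finite_induct) (simp_all add: pr_empty pr_insert)

lemma pr_nonneg: "0 \<le> p \<Longrightarrow> p \<le> 1 \<Longrightarrow> 0 \<le> pr p S P"
  unfolding pr_def by (intro sum_nonneg) simp

lemma pr_mono:
  assumes "0 \<le> p" "p \<le> 1" "\<And>w. w \<subseteq> S \<Longrightarrow> P w \<Longrightarrow> Q w"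
  shows "pr p S P \<le> pr p S Q"
  unfolding pr_def using assms by (intro sum_mono mult_right_mono) auto

lemma pr_le_1: "finite S \<Longrightarrow> 0 \<le> p \<Longrightarrow> p \<le> 1 \<Longrightarrow> pr p S P \<le> 1"
  using pr_mono[of p S P "\<lambda>_. True"] by (simp add: pr_True)

lemma pr_split: "pr p S P = pr p S (\<lambda>w. P w \<and> Q w) + pr p S (\<lambda>w. P w \<and> \<not> Q w)"
  unfolding pr_def sum.distrib[symmetric] by (intro sum.cong) auto

lemma pr_not: "finite S \<Longrightarrow> pr p S (\<lambda>w. \<not> P w) = 1 - pr p S P"
  using pr_split[of p S "\<lambda>_. True" P] pr_True[of S p] by simp

lemma pr_or: "pr p S (\<lambda>w. P w \<or> Q w) = pr p S P + pr p S Q - pr p S (\<lambda>w. P w \<and> Q w)"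
  unfolding pr_def sum.distrib[symmetric] sum_subtractf[symmetric] by (intro sum.cong) auto

lemma pr_and_ge:
  assumes "finite S" "0 \<le> p" "p \<le> 1"
  shows "pr p S (\<lambda>w. P w \<and> Q w) \<ge> pr p S P + pr p S Q - 1"
  using pr_or[of p S P Q] pr_le_1[of S p "\<lambda>w. P w \<or> Q w"] assms by simp

lemma pr_restrict_Un:
  assumes "finite U" "finite S" "S \<inter> U = {}"
  shows "pr p (S \<union> U) (\<lambda>w. P (w \<inter> S)) = pr p S P"
  using assms
proof (induction U rule: finite_induct)
  case empty
  then show ?case by (auto intro!: pr_cong simp: Int_absorb2)
next
  case (insert x U)
  then have "insert x w \<inter> S = w \<inter> S" for w by auto
  then show ?case using insert by (simp add: pr_insert algebra_simps)
qed

lemma pr_restrict: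
  assumes "finite T" "S \<subseteq> T"
  shows "pr p T (\<lambda>w. P (w \<inter> S)) = pr p S P"
  using pr_restrict_Un[of "T - S" S p P] assms finite_subset by (auto simp: Un_absorb1)

lemma pr_indep_Un:
  assumes "finite S" "finite T" "S \<inter> T = {}"
  shows "pr p (S \<union> T) (\<lambda>w. P (w \<inter> S) \<and> Q (w \<inter> T)) = pr p S P * pr p T Q"
  using assms
proof (induction S arbitrary: P rule: finite_induct)
  case empty
  have "pr p T (\<lambda>w. P {} \<and> Q (w \<inter> T)) = of_bool (P {}) * pr p T Q"
    unfolding pr_def sum_distrib_left by (intro sum.cong) (auto simp: Int_absorb2)
  then show ?case by (simp add: pr_empty)
next
  case (insert x S)
  then have x: "x \<notin> S" "x \<notin> T" by auto
  have IH: "pr p (S \<union> T) (\<lambda>w. P (w \<inter> S) \<and> Q (w \<inter> T)) = pr p S P * pr p T Q" for P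
    using insert by auto
  have "pr p (S \<union> T) (\<lambda>w. P (insert x w \<inter> insert x S) \<and> Q (insert x w \<inter> T))
      = pr p (S \<union> T) (\<lambda>w. P (insert x (w \<inter> S)) \<and> Q (w \<inter> T))"
    using x by (intro pr_cong) (simp add: Int_insert_left Int_insert_right)
  moreover have "pr p (S \<union> T) (\<lambda>w. P (w \<inter> insert x S) \<and> Q (w \<inter> T))
      = pr p (S \<union> T) (\<lambda>w. P (w \<inter> S) \<and> Q (w \<inter> T))"
  proof (intro pr_cong)
    fix w assume "w \<subseteq> S \<union> T"
    then have "w \<inter> insert x S = w \<inter> S" using x by auto
    then show "(P (w \<inter> insert x S) \<and> Q (w \<inter> T)) = (P (w \<inter> S) \<and> Q (w \<inter> T))" by simp
  qed
  ultimately show ?case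
    using insert x IH[of P] IH[of "\<lambda>w. P (insert x w)"]
    by (simp add: pr_insert algebra_simps)
qed

lemma pr_indep:
  assumes "finite U" "S \<subseteq> U" "T \<subseteq> U" "S \<inter> T = {}"
  shows "pr p U (\<lambda>w. P (w \<inter> S) \<and> Q (w \<inter> T)) = pr p S P * pr p T Q"
proof -
  have fin: "finite S" "finite T" using assms by (auto intro: finite_subset)
  have "pr p U (\<lambda>w. P (w \<inter> S) \<and> Q (w \<inter> T))
      = pr p U (\<lambda>w. (\<lambda>w'. P (w' \<inter> S) \<and> Q (w' \<inter> T)) (w \<inter> (S \<union> T)))"
    by (simp add: Int_assoc inf_sup_distrib2)
  also have "\<dots> = pr p (S \<union> T) (\<lambda>w. P (w \<inter> S) \<and> Q (w \<inter> T))"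
    by (rule pr_restrict) (use assms in auto)
  finally show ?thesis using pr_indep_Un[OF fin assms(4)] by simp
qed

lemma pr_image:
  assumes "inj_on f S"
  shows "pr p (f ` S) P = pr p S (\<lambda>w. P (f ` w))"
proof -
  have eq: "Pow (f ` S) = image f ` Pow S" by (auto simp: image_Pow_surj)
  have inj: "inj_on (image f) (Pow S)"
    using assms by (rule inj_on_image_Pow)
  show ?thesis
    unfolding pr_def eq sum.reindex[OF inj]
  proof (rule sum.cong)
    fix w assume w: "w \<in> Pow S"
    then have "card (f ` w) = card w" using assms by (meson PowD card_image inj_on_subset)
    moreover have "f ` S - f ` w = f ` (S - w)" using w assms by (simp add: inj_on_image_set_diff)
    moreover have "card (f ` (S - w)) = card (S - w)" using assms by (meson Diff_subset card_image inj_on_subset)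
    ultimately show "((\<lambda>w. of_bool (P w) * (p ^ card w * (1 - p) ^ card (f ` S - w))) \<circ> (`) f) w
      = of_bool (P (f ` w)) * (p ^ card w * (1 - p) ^ card (S - w))" by simp
  qed simp
qed

definition up_event :: "('v set \<Rightarrow> bool) \<Rightarrow> bool" where
  "up_event P \<longleftrightarrow> (\<forall>w w'. w \<subseteq> w' \<longrightarrow> P w \<longrightarrow> P w')"

text \<open>Harris' inequality, by induction over the sites: conditionally on the state of one site the inequality
  holds, and the two conditional probabilities of each event are ordered in the same way.\<close>

lemma harris:
  assumes "finite S" "0 \<le> p" "p \<le> 1" "up_event P" "up_event Q"
  shows "pr p S P * pr p S Q \<le> pr p S (\<lambda>w. P w \<and> Q w)"
  using assms(1,4,5)
proof (induction S arbitrary: P Q rule: finite_induct)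
  case empty
  then show ?case by (simp add: pr_empty)
next
  case (insert x S)
  let ?P = "\<lambda>w. P (insert x w)" and ?Q = "\<lambda>w. Q (insert x w)"
  have m: "up_event (\<lambda>w. R (insert x w))" if "up_event R" for R
    unfolding up_event_def
  proof (intro allI impI)
    fix w w' :: "'a set" assume "w \<subseteq> w'" "R (insert x w)"
    moreover from this have "insert x w \<subseteq> insert x w'" by auto
    ultimately show "R (insert x w')" using that unfolding up_event_def by blast
  qed
  have le: "pr p S P \<le> pr p S ?P" "pr p S Q \<le> pr p S ?Q"
    using insert.prems assms(2,3) unfolding up_event_def
    by (intro pr_mono; meson subset_insertI)+
  have "pr p (insert x S) P * pr p (insert x S) Q
      = p * (pr p S ?P * pr p S ?Q) + (1 - p) * (pr p S P * pr p S Q)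
        - (p * (1 - p)) * ((pr p S ?P - pr p S P) * (pr p S ?Q - pr p S Q))"
    using insert.hyps by (simp add: pr_insert algebra_simps)
  also have "\<dots> \<le> p * (pr p S ?P * pr p S ?Q) + (1 - p) * (pr p S P * pr p S Q)"
    using le assms(2,3) by simp
  also have "\<dots> \<le> p * pr p S (\<lambda>w. ?P w \<and> ?Q w) + (1 - p) * pr p S (\<lambda>w. P w \<and> Q w)"
    using insert.IH[OF m m, OF insert.prems] insert.IH[OF insert.prems] assms(2,3)
    by (intro add_mono mult_left_mono) auto
  also have "\<dots> = pr p (insert x S) (\<lambda>w. P w \<and> Q w)"
    using insert.hyps by (simp add: pr_insert)
  finally show ?case .
qed

lemma harris_not:
  assumes "finite S" "0 \<le> p" "p \<le> 1" "up_event P" "up_event Q"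
  shows "(1 - pr p S P) * (1 - pr p S Q) \<le> 1 - pr p S (\<lambda>w. P w \<or> Q w)"
  using harris[OF assms] pr_or[of p S P Q] by (simp add: algebra_simps)

lemma harris_Ex:
  assumes "finite S" "0 \<le> p" "p \<le> 1" "\<And>i. up_event (P i)"
  shows "(\<Prod>i<(N::nat). 1 - pr p S (P i)) \<le> 1 - pr p S (\<lambda>w. \<exists>i<N. P i w)"
proof (induction N)
  case 0
  show ?case by (simp add: pr_def)
next
  case (Suc N)
  have m: "up_event (\<lambda>w. \<exists>i<N. P i w)"
    using assms(4) unfolding up_event_def by meson
  have "(\<Prod>i<Suc N. 1 - pr p S (P i)) \<le> (1 - pr p S (\<lambda>w. \<exists>i<N. P i w)) * (1 - pr p S (P N))"
    using Suc pr_le_1[OF assms(1-3), of "P N"] by (simp add: mult_right_mono)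
  also have "\<dots> \<le> 1 - pr p S (\<lambda>w. (\<exists>i<N. P i w) \<or> P N w)"
    by (rule harris_not[OF assms(1-3) m assms(4)])
  also have "(\<lambda>w. (\<exists>i<N. P i w) \<or> P N w) = (\<lambda>w. \<exists>i<Suc N. P i w)"
    by (auto simp: less_Suc_eq)
  finally show ?case .
qed

text \<open>The complements of increasing events are positively correlated, so if each of them had probability
  more than \<open>d\<close>, then all of them together would have probability more than \<open>d ^ N\<close>.\<close>

lemma square_root_trick:
  assumes "finite S" "0 \<le> p" "p \<le> 1" "\<And>i. up_event (P i)" "0 < N" "0 \<le> d"
    and "1 - pr p S (\<lambda>w. \<exists>i<N. P i w) \<le> d ^ N"
  shows "\<exists>i<N. 1 - pr p S (P i) \<le> d"
proof (rule ccontr)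
  assume neg: "\<not> (\<exists>i<N. 1 - pr p S (P i) \<le> d)"
  have *: "d < 1 - pr p S (P i)" if "i < N" for i using neg that by force
  then have "d \<le> 1 - pr p S (P i)" "0 < 1 - pr p S (P i)" if "i < N" for i
    using that assms(6) by (force intro: less_imp_le le_less_trans)+
  then have "(\<Prod>i<N. d) < (\<Prod>i<N. 1 - pr p S (P i))"
    using assms(5,6) * by (intro prod_mono_strict[where i = 0]) auto
  then show False using harris_Ex[where P = P and N = N, OF assms(1-4)] assms(7) by simp
qed

lemma pr_continuous: "continuous_on UNIV (\<lambda>p. pr p S P)"
  unfolding pr_def by (intro continuous_intros)

lemma pr_Ex_disjoint:
  assumes "finite I" "\<And>w i j. w \<subseteq> S \<Longrightarrow> i \<in> I \<Longrightarrow> j \<in> I \<Longrightarrow> P i w \<Longrightarrow> P j w \<Longrightarrow> i = j"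
  shows "pr p S (\<lambda>w. \<exists>i\<in>I. P i w) = (\<Sum>i\<in>I. pr p S (P i))"
  using assms
proof (induction I rule: finite_induct)
  case empty then show ?case by (simp add: pr_def)
next
  case (insert i I)
  have "pr p S (\<lambda>w. \<exists>j\<in>insert i I. P j w) = pr p S (\<lambda>w. P i w \<or> (\<exists>j\<in>I. P j w))" by simp
  also have "\<dots> = pr p S (P i) + pr p S (\<lambda>w. \<exists>j\<in>I. P j w) - pr p S (\<lambda>w. P i w \<and> (\<exists>j\<in>I. P j w))"
    by (rule pr_or)
  also have "pr p S (\<lambda>w. P i w \<and> (\<exists>j\<in>I. P j w)) = pr p S (\<lambda>_. False)"
    using insert by (intro pr_cong) (metis insertCI)
  also have "pr p S (\<lambda>_. False) = 0" by (simp add: pr_def)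
  finally show ?case using insert by auto
qed

text \<open>Events that depend on finitely many sites with the same density have the same probability under
  the infinite product measure, whatever the densities of the other sites.\<close>

lemma site_measure_cylinder:
  assumes "finite S" "0 \<le> p" "p \<le> 1" "\<And>v. v \<in> S \<Longrightarrow> r v = p"
  shows "{\<omega>. P {v\<in>S. \<omega> v}} \<in> sets (site_measure r)"
    and "measure (site_measure r) {\<omega>. P {v\<in>S. \<omega> v}} = pr p S P"
proof -
  let ?M = "\<lambda>v. measure_pmf (bernoulli_pmf (r v))"
  interpret product_prob_space ?M UNIV
    by unfold_locales
  let ?C = "\<lambda>w. {\<omega>. {v\<in>S. \<omega> v} = w}"
  have C: "?C w = prod_emb UNIV ?M S (Pi\<^sub>E S (\<lambda>v. {v \<in> w}))" if "w \<subseteq> S" for w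
    using that by (auto simp: prod_emb_def PiE_iff restrict_def extensional_def)
  have Cs: "?C w \<in> sets (site_measure r)" if "w \<subseteq> S" for w
    unfolding C[OF that] site_measure_def using assms(1) by (intro sets_PiM_I) auto
  have Cm: "measure (site_measure r) (?C w) = p ^ card w * (1 - p) ^ card (S - w)" if "w \<subseteq> S" for w
  proof -
    have "measure (site_measure r) (?C w) = (\<Prod>v\<in>S. measure (?M v) {v \<in> w})"
      unfolding C[OF that] site_measure_def using assms(1) by (intro measure_PiM_emb) auto
    also have "\<dots> = (\<Prod>v\<in>S. if v \<in> w then p else 1 - p)"
      using assms(2-4) by (intro prod.cong) (auto simp: measure_pmf_single)
    also have "\<dots> = (\<Prod>v\<in>w. p) * (\<Prod>v\<in>S - w. 1 - p)"
      using prod.If_cases[OF assms(1), of "\<lambda>v. v \<in> w" "\<lambda>_. p" "\<lambda>_. 1 - p"] that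
      by (simp add: Int_absorb1 Collect_conv_if Diff_eq)
    finally show ?thesis by simp
  qed
  interpret sm: prob_space "site_measure r"
    unfolding site_measure_def by (rule prob_space_PiM) (rule measure_pmf.prob_space_axioms)
  have eq: "{\<omega>. P {v\<in>S. \<omega> v}} = (\<Union>w\<in>{w \<in> Pow S. P w}. ?C w)" by auto
  show "{\<omega>. P {v\<in>S. \<omega> v}} \<in> sets (site_measure r)"
    unfolding eq using assms(1) Cs by (intro sets.finite_UN) auto
  have "measure (site_measure r) {\<omega>. P {v\<in>S. \<omega> v}} = (\<Sum>w\<in>{w \<in> Pow S. P w}. measure (site_measure r) (?C w))"
    unfolding eq using assms(1) Cs
    by (intro sm.finite_measure_finite_Union) (auto simp: disjoint_family_on_def)
  also have "\<dots> = (\<Sum>w\<in>{w \<in> Pow S. P w}. p ^ card w * (1 - p) ^ card (S - w))"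
    using Cm by (intro sum.cong) auto
  also have "\<dots> = pr p S P"
    unfolding pr_def using assms(1) by (intro sum.mono_neutral_cong_left) auto
  finally show "measure (site_measure r) {\<omega>. P {v\<in>S. \<omega> v}} = pr p S P" .
qed

section \<open>Crossing probabilities\<close>

definition conn :: "site set \<Rightarrow> site set \<Rightarrow> site set \<Rightarrow> bool" where
  "conn S A B \<longleftrightarrow> (\<exists>u\<in>A. \<exists>v\<in>B. reach adj4 S u v)"

definition conn_prob :: "real \<Rightarrow> site set \<Rightarrow> site set \<Rightarrow> site set \<Rightarrow> real" where
  "conn_prob p R A B = pr p R (\<lambda>w. conn w A B)"

abbreviation vline :: "int \<Rightarrow> site set" where "vline a \<equiv> {x. fst x = a}"
abbreviation hline :: "int \<Rightarrow> site set" where "hline a \<equiv> {x. snd x = a}"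

lemma finite_rect [simp]: "finite (rect a b c d)"
  by (simp add: rect_def)

lemma in_rect: "(x, y) \<in> rect a b c d \<longleftrightarrow> a \<le> x \<and> x \<le> b \<and> c \<le> y \<and> y \<le> d"
  by (auto simp: rect_def)

lemma in_rect': "v \<in> rect a b c d \<longleftrightarrow> a \<le> fst v \<and> fst v \<le> b \<and> c \<le> snd v \<and> snd v \<le> d"
  by (auto simp: rect_def mem_Times_iff)

lemma conn_mono: "conn S A B \<Longrightarrow> S \<subseteq> T \<Longrightarrow> conn T A B"
  unfolding conn_def using reach_mono[of adj4 S _ _ T] by meson

lemma reach4_sym: "reach adj4 S u v \<Longrightarrow> reach adj4 S v u"
  by (rule reach_sym[of adj4]) (auto intro: adj4_sym)

lemma up_event_conn: "up_event (\<lambda>w. conn (w \<inter> R) A B)"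
  unfolding up_event_def
proof (intro allI impI)
  fix w w' :: "site set" assume "w \<subseteq> w'" "conn (w \<inter> R) A B"
  moreover from this have "w \<inter> R \<subseteq> w' \<inter> R" by auto
  ultimately show "conn (w' \<inter> R) A B" using conn_mono by blast
qed

lemma pr_conn:
  assumes "finite T" "R \<subseteq> T"
  shows "pr p T (\<lambda>w. conn (w \<inter> R) A B) = conn_prob p R A B"
  unfolding conn_prob_def using pr_restrict[OF assms, of p "\<lambda>w. conn w A B"] .

definition lattice_iso :: "(site \<Rightarrow> site) \<Rightarrow> bool" where
  "lattice_iso f \<longleftrightarrow> inj f \<and> (\<forall>u v. adj4 (f u) (f v) \<longleftrightarrow> adj4 u v)"

lemma conn_image:
  assumes "lattice_iso f"
  shows "conn (f ` S) A B \<longleftrightarrow> conn S (f -` A) (f -` B)"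
proof
  have inj: "inj f" and adj: "\<And>u v. adj4 (f u) (f v) \<longleftrightarrow> adj4 u v"
    using assms by (auto simp: lattice_iso_def)
  {
    assume "conn S (f -` A) (f -` B)"
    then obtain u v where "f u \<in> A" "f v \<in> B" "reach adj4 S u v" unfolding conn_def by blast
    then show "conn (f ` S) A B"
      using reach_map[of adj4 S u v adj4 f] adj unfolding conn_def by blast
  next
    assume "conn (f ` S) A B"
    then obtain u v where uv: "u \<in> A" "v \<in> B" "reach adj4 (f ` S) u v" by (auto simp: conn_def)
    then obtain u' v' where f: "u = f u'" "v = f v'" using reach_in[OF uv(3)] by auto
    have inv: "inv f (f x) = x" for x using inj by simp
    have "reach adj4 (inv f ` (f ` S)) (inv f u) (inv f v)"
      by (rule reach_map[OF uv(3)]) (auto simp: inv adj)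
    then have "reach adj4 S u' v'" by (simp add: f inv image_image)
    then show "conn S (f -` A) (f -` B)" using uv f by (auto simp: conn_def)
  }
qed

lemma conn_prob_image:
  assumes "lattice_iso f"
  shows "conn_prob p (f ` R) A B = conn_prob p R (f -` A) (f -` B)"
proof -
  have "inj_on f R" using assms by (auto simp: lattice_iso_def intro: inj_on_subset)
  then show ?thesis
    unfolding conn_prob_def using pr_image[of f R p "\<lambda>w. conn w A B"] by (simp add: conn_image[OF assms])
qed

definition shift :: "int \<Rightarrow> int \<Rightarrow> site \<Rightarrow> site" where "shift a b v = (fst v + a, snd v + b)"
definition reflect :: "site \<Rightarrow> site" where "reflect v = (- fst v, snd v)"

lemma lattice_iso_shift: "lattice_iso (shift a b)"
  by (auto simp: lattice_iso_def shift_def inj_def adj4_def)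

lemma lattice_iso_reflect: "lattice_iso reflect"
  unfolding lattice_iso_def reflect_def inj_def adj4_def by (simp add: prod_eq_iff; linarith)

lemma lattice_iso_swap: "lattice_iso prod.swap"
  by (auto simp: lattice_iso_def inj_def adj4_def)

lemma shift_rect: "shift s t ` rect a b c d = rect (a+s) (b+s) (c+t) (d+t)"
proof (intro set_eqI iffI)
  fix v assume "v \<in> rect (a+s) (b+s) (c+t) (d+t)"
  then have "v = shift s t (fst v - s, snd v - t)" "(fst v - s, snd v - t) \<in> rect a b c d"
    by (auto simp: shift_def in_rect')
  then show "v \<in> shift s t ` rect a b c d" by blast
qed (auto simp: shift_def in_rect)

lemma swap_rect: "prod.swap ` rect a b c d = rect c d a b"
  by (auto simp: rect_def product_swap)

text \<open>The probability of an open left-right crossing of a rectangle with \<open>a\<close> columns and \<open>b\<close> rows.\<close>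

definition crossing_prob :: "real \<Rightarrow> int \<Rightarrow> int \<Rightarrow> real" where
  "crossing_prob p a b = conn_prob p (rect 0 (a - 1) 0 (b - 1)) (vline 0) (vline (a - 1))"

lemma crossing_prob_shift: "conn_prob p (rect x (x + a - 1) y (y + b - 1)) (vline x) (vline (x + a - 1)) = crossing_prob p a b"
proof -
  have "shift x y ` rect 0 (a - 1) 0 (b - 1) = rect x (x + a - 1) y (y + b - 1)"
    by (simp add: shift_rect algebra_simps)
  moreover have "shift x y -` vline x = vline 0" "shift x y -` vline (x + a - 1) = vline (a - 1)"
    by (auto simp: shift_def)
  ultimately show ?thesis
    using conn_prob_image[OF lattice_iso_shift, of p x y "rect 0 (a - 1) 0 (b - 1)" "vline x" "vline (x + a - 1)"]
    by (simp add: crossing_prob_def)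
qed

lemma crossing_prob_swap: "conn_prob p (rect y (y + b - 1) x (x + a - 1)) (hline x) (hline (x + a - 1)) = crossing_prob p a b"
proof -
  have "prod.swap -` hline x = vline x" "prod.swap -` hline (x + a - 1) = vline (x + a - 1)" by auto
  then show ?thesis
    using conn_prob_image[OF lattice_iso_swap, of p "rect x (x + a - 1) y (y + b - 1)" "hline x" "hline (x + a - 1)"]
    by (simp add: swap_rect crossing_prob_shift)
qed

section \<open>Gluing by reflection\<close>

lemma reflect_reflect [simp]: "reflect (reflect v) = v" by (simp add: reflect_def)
lemma fst_reflect [simp]: "fst (reflect v) = - fst v" by (simp add: reflect_def)
lemma snd_reflect [simp]: "snd (reflect v) = snd v" by (simp add: reflect_def)

text \<open>Let \<open>\<Lambda>\<close> be \<open>rect (-L) L 0 h\<close>.  If the left half of \<open>\<Lambda>\<close> has a left-right crossing, then the lowest one and its mirror image separate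
  \<open>J\<close> from the bottom.  Given the lowest crossing, the configuration above the barrier is fresh; a path from
  \<open>J\<close> to the sides or to the bottom meets the left or the right half of the barrier or ends on the left or the
  right side, and by symmetry and Harris' inequality the left alternative fails with probability at most \<open>d\<close>.

  Instead of a lowest crossing the proof explores the set \<open>c\<close> of closed sites of the left half that are joined
  to the bottom by straight and diagonal closed steps.  The event \<open>F c\<close> that this set is \<open>c\<close> depends only on
  the state of \<open>e c\<close>, that is \<open>c\<close> together with its boundary \<open>bd c\<close>, whose sites are open.  A crossing of the
  left half keeps \<open>c\<close> away from the top, and then \<open>bd c\<close> itself contains a crossing.  The sites of \<open>bd c\<close>
  that can be reached from the top outside \<open>e c\<close> and its mirror image lie on that crossing; a path
  that takes a detour through the right half is folded back into the left half to see this.\<close>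

lemma gluing_by_reflection:
  fixes L h :: int
  assumes p: "0 \<le> p" "p \<le> 1" and Lh: "0 \<le> L" "0 \<le> h"
    and J: "J \<subseteq> hline h \<inter> rect (-L) L 0 h" "reflect ` J = J"
    and d: "0 \<le> d" "1 - conn_prob p (rect (-L) L 0 h) J (hline 0 \<union> vline (-L) \<union> vline L) \<le> d\<^sup>2"
  shows "conn_prob p (rect (-L) 0 0 h) (vline (-L)) (vline 0) * (1 - d)
    \<le> conn_prob p (rect (-L) L 0 h) (vline (-L)) J"
proof -
  let ?\<Lambda> = "rect (-L) L 0 h" and ?H = "rect (-L) 0 0 h"
  have sub: "?H \<subseteq> ?\<Lambda>" using Lh by (auto simp: in_rect)
  have reflect_in: "reflect v \<in> ?\<Lambda> \<longleftrightarrow> v \<in> ?\<Lambda>" for v by (auto simp: in_rect')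
  define bd where "bd c = {z \<in> ?H - c. snd z = 0 \<or> (\<exists>d\<in>c. adj8 z d)}" for c
  define e where "e c = c \<union> bd c" for c
  define E where "E c = e c \<union> reflect ` e c" for c
  define C where "C = {c. c \<subseteq> ?H \<and> (\<forall>v\<in>c. snd v \<noteq> h \<and> (\<exists>u. snd u = 0 \<and> reach adj8 c u v))}"
  define F where "F c w \<longleftrightarrow> c \<inter> w = {} \<and> bd c \<subseteq> w" for c w
  define K where "K c w \<longleftrightarrow> J \<inter> e c \<noteq> {} \<or> (\<exists>j\<in>J. \<exists>v. reach adj4 (w \<inter> (?\<Lambda> - E c)) j v \<and>
     (fst v = -L \<or> (\<exists>z\<in>e c. adj4 v z)))" for c w
  define K' where "K' c w \<longleftrightarrow> J \<inter> reflect ` e c \<noteq> {} \<or> (\<exists>j\<in>J. \<exists>v. reach adj4 (w \<inter> (?\<Lambda> - E c)) j v \<and>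
     (fst v = L \<or> (\<exists>z\<in>reflect ` e c. adj4 v z)))" for c w
  have finC: "finite C" by (rule finite_subset[of _ "Pow ?H"]) (auto simp: C_def)
  have eH: "e c \<subseteq> ?H" if "c \<in> C" for c using that by (auto simp: e_def bd_def C_def)
  have reflect_E: "reflect v \<in> E c \<longleftrightarrow> v \<in> E c" for v c
    unfolding E_def by (metis (no_types, lifting) Un_iff image_iff reflect_reflect)
  have bot: "v \<in> E c" if "v \<in> ?\<Lambda>" "snd v = 0" for v c
  proof (cases "fst v \<le> 0")
    case True
    then have "v \<in> e c" using that by (auto simp: e_def bd_def in_rect')
    then show ?thesis by (simp add: E_def)
  next
    case False
    then have "reflect v \<in> e c" using that by (auto simp: e_def bd_def in_rect')
    then show ?thesis using reflect_E[of v c] by (simp add: E_def)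
  qed
  have fresh: "1 - pr p ?\<Lambda> (K c) \<le> d" if c: "c \<in> C" for c
  proof -
    \<comment> \<open>follow the path from \<open>J\<close> until it meets the barrier or a side; the bottom row belongs to \<open>E c\<close>\<close>
    have imp: "K c w \<or> K' c w" if w: "conn (w \<inter> ?\<Lambda>) J (hline 0 \<union> vline (-L) \<union> vline L)" for w
    proof -
      obtain j v where j: "j \<in> J" and v: "v \<in> hline 0 \<union> vline (-L) \<union> vline L"
        and r: "reach adj4 (w \<inter> ?\<Lambda>) j v" using w unfolding conn_def by blast
      show ?thesis
      proof (cases "j \<in> E c")
        case True
        then show ?thesis using j by (auto simp: E_def K_def K'_def)
      next
        case False
        let ?S = "w \<inter> (?\<Lambda> - E c)"
        have S: "w \<inter> ?\<Lambda> \<inter> (?\<Lambda> - E c) = ?S" by auto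
        from reach_exit[OF r, of "?\<Lambda> - E c"] have
          "reach adj4 ?S j v \<or> (\<exists>x x'. reach adj4 ?S j x \<and> adj4 x x' \<and> x' \<in> w \<inter> ?\<Lambda> - (?\<Lambda> - E c))"
          using False J j unfolding S by blast
        then show ?thesis
        proof
          assume r: "reach adj4 ?S j v"
          then have "snd v \<noteq> 0" using bot[of v c] reach_in[OF r] by auto
          then show ?thesis using v r j unfolding K_def K'_def by blast
        next
          assume "\<exists>x x'. reach adj4 ?S j x \<and> adj4 x x' \<and> x' \<in> w \<inter> ?\<Lambda> - (?\<Lambda> - E c)"
          then show ?thesis using j unfolding K_def K'_def E_def by blast
        qed
      qed
    qed
    have inc: "up_event (K c)" "up_event (K' c)"
      unfolding up_event_def K_def K'_def
      using reach_mono[of adj4 "w \<inter> (?\<Lambda> - E c)" _ _ "w' \<inter> (?\<Lambda> - E c)" for w w'] by (meson Int_mono subset_refl)+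
    have img: "reflect ` ?\<Lambda> = ?\<Lambda>"
      using reflect_in by (metis (no_types, lifting) image_eqI reflect_reflect subsetI subset_antisym image_subsetI)
    have imgE: "reflect ` (w \<inter> (?\<Lambda> - E c)) = reflect ` w \<inter> (?\<Lambda> - E c)" for w
      using reflect_in reflect_E by (auto simp: image_iff)
    have KK: "K' c (reflect ` w) \<longleftrightarrow> K c w" for w
    proof -
      have 2: "adj4 (reflect u) (reflect v) \<longleftrightarrow> adj4 u v" for u v
        using lattice_iso_reflect unfolding lattice_iso_def by blast
      have 1: "reach adj4 (reflect ` S) (reflect u) (reflect v)" if "reach adj4 S u v" for S u v
        using reach_map[OF that, of adj4 reflect] 2 by blast
      have J': "reflect j \<in> J \<longleftrightarrow> j \<in> J" for j using J(2) by (metis image_eqI reflect_reflect)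
      have e': "reflect z \<in> reflect ` e c \<longleftrightarrow> z \<in> e c" for z by (metis image_iff reflect_reflect)
      have 3: "reach adj4 (reflect ` w \<inter> (?\<Lambda> - E c)) (reflect u) (reflect v) \<longleftrightarrow> reach adj4 (w \<inter> (?\<Lambda> - E c)) u v" for u v
        using 1[of "w \<inter> (?\<Lambda> - E c)" u v] 1[of "reflect ` (w \<inter> (?\<Lambda> - E c))" "reflect u" "reflect v"]
        by (auto simp: imgE[symmetric] image_image)
      have a: "J \<inter> reflect ` e c \<noteq> {} \<longleftrightarrow> J \<inter> e c \<noteq> {}"
        using J' e' by (metis disjoint_iff reflect_reflect)
      have b: "(\<exists>j\<in>J. \<exists>v. reach adj4 (reflect ` w \<inter> (?\<Lambda> - E c)) j v \<and> (fst v = L \<or> (\<exists>z\<in>reflect ` e c. adj4 v z)))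
         \<longleftrightarrow> (\<exists>j\<in>J. \<exists>v. reach adj4 (w \<inter> (?\<Lambda> - E c)) j v \<and> (fst v = -L \<or> (\<exists>z\<in>e c. adj4 v z)))" (is "?l = ?r")
      proof
        assume ?l
        then obtain j v where jv: "j \<in> J" "reach adj4 (reflect ` w \<inter> (?\<Lambda> - E c)) j v"
          "fst v = L \<or> (\<exists>z\<in>reflect ` e c. adj4 v z)" by blast
        have "reflect j \<in> J" using J' jv by simp
        moreover have "reach adj4 (w \<inter> (?\<Lambda> - E c)) (reflect j) (reflect v)"
          using 3[of "reflect j" "reflect v"] jv by simp
        moreover have "fst (reflect v) = -L \<or> (\<exists>z\<in>e c. adj4 (reflect v) z)"
          using jv(3) 2[of "reflect v"] by auto
        ultimately show ?r by blast
      next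
        assume ?r
        then obtain j v where jv: "j \<in> J" "reach adj4 (w \<inter> (?\<Lambda> - E c)) j v"
          "fst v = -L \<or> (\<exists>z\<in>e c. adj4 v z)" by blast
        have "reflect j \<in> J" using J' jv by simp
        moreover have "reach adj4 (reflect ` w \<inter> (?\<Lambda> - E c)) (reflect j) (reflect v)"
          using 3 jv by simp
        moreover have "fst (reflect v) = L \<or> (\<exists>z\<in>reflect ` e c. adj4 (reflect v) z)"
          using jv(3) 2[of v] by auto
        ultimately show ?l by blast
      qed
      show ?thesis unfolding K_def K'_def a b ..
    qed
    have inj: "inj_on reflect ?\<Lambda>" by (metis inj_onI reflect_reflect)
    have "pr p ?\<Lambda> (K' c) = pr p ?\<Lambda> (K c)"
      using pr_image[OF inj, of p "K' c"] by (simp add: img KK)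
    then have "(1 - pr p ?\<Lambda> (K c))\<^sup>2 \<le> 1 - pr p ?\<Lambda> (\<lambda>w. K c w \<or> K' c w)"
      using harris_not[OF finite_rect[of "-L" L 0 h] p inc] by (simp add: power2_eq_square)
    also have "\<dots> \<le> 1 - conn_prob p ?\<Lambda> J (hline 0 \<union> vline (-L) \<union> vline L)"
    proof -
      have "conn_prob p ?\<Lambda> J (hline 0 \<union> vline (-L) \<union> vline L) = pr p ?\<Lambda> (\<lambda>w. conn (w \<inter> ?\<Lambda>) J (hline 0 \<union> vline (-L) \<union> vline L))"
        by (simp add: pr_conn)
      also have "\<dots> \<le> pr p ?\<Lambda> (\<lambda>w. K c w \<or> K' c w)"
        by (rule pr_mono[OF p]) (rule imp)
      finally show ?thesis by simp
    qed
    also have "\<dots> \<le> d\<^sup>2" by (rule d)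
    finally show ?thesis using d(1) by (rule power2_le_imp_le)
  qed
  have hit: "conn (w \<inter> ?\<Lambda>) (vline (-L)) J" if c: "c \<in> C" and w: "F c w" "K c w" for c w
  proof -
    \<comment> \<open>such a path starts in \<open>c\<close> and cannot leave \<open>c\<close> without a step into \<open>bd c\<close>\<close>
    have noBT: "\<not> (\<exists>u v. reach adj8 (?H - bd c) u v \<and> snd u = 0 \<and> snd v = h)"
    proof
      assume "\<exists>u v. reach adj8 (?H - bd c) u v \<and> snd u = 0 \<and> snd v = h"
      then obtain u v where uv: "reach adj8 (?H - bd c) u v" "snd u = 0" "snd v = h" by blast
      from uv(1) have "v \<in> c"
      proof (induction rule: reach_induct)
        case refl then show ?case using uv(2) by (auto simp: bd_def)
      next
        case (step x y) then show ?case using adj8_sym[OF step(2)] by (auto simp: bd_def)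
      qed
      then show False using c uv(3) by (auto simp: C_def)
    qed
    then obtain l r where lr: "reach adj4 (bd c \<inter> ?H) l r" "fst l = -L" "fst r = 0"
      using primal_or_dual_crossing[of "-L" 0 0 h "bd c"] Lh by auto
    define P where "P = {x. reach adj4 (bd c \<inter> ?H) l x}"
    have PH: "P \<subseteq> bd c \<inter> ?H" unfolding P_def using reach_in[of adj4 "bd c \<inter> ?H" l] by blast
    have lP: "reach adj4 P l r" unfolding P_def by (rule reach_component[OF lr(1)])
    have Pw: "P \<subseteq> w \<inter> ?\<Lambda>" using PH w(1) sub by (auto simp: F_def)
    have lx: "reach adj4 (w \<inter> ?\<Lambda>) l x" if "x \<in> P" for x
      using that reach_mono[of adj4 "bd c \<inter> ?H" l x "w \<inter> ?\<Lambda>"] w(1) sub by (auto simp: P_def F_def)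
    \<comment> \<open>a site of \<open>bd c\<close> that is joined to the top outside \<open>e c\<close> lies on the crossing\<close>
    have onP: "z \<in> P" if z: "z \<in> bd c" and Q: "Q \<subseteq> ?H - e c" and zt: "reach adj8 (insert z Q) z t" "snd t = h" for z Q t
    proof -
      obtain u where u: "snd u = 0" "reach adj8 (c \<union> insert z Q) u z"
      proof (cases "snd z = 0")
        case True then show ?thesis using that reach_refl[of z "c \<union> insert z Q"] by blast
      next
        case False
        then obtain d where d: "d \<in> c" "adj8 z d" using z by (auto simp: bd_def)
        then obtain u where u: "snd u = 0" "reach adj8 c u d" using c by (auto simp: C_def)
        have "reach adj8 (c \<union> insert z Q) u d" using reach_mono[OF u(2)] by blast
        then have "reach adj8 (c \<union> insert z Q) u z" using reach_step d(2) adj8_sym by (metis UnI2 insertI1)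
        then show ?thesis using that u by blast
      qed
      have "reach adj8 (c \<union> insert z Q) u t"
        using reach_trans[OF u(2)] reach_mono[OF zt(1)] by blast
      moreover have "c \<union> insert z Q \<subseteq> ?H" using c z Q by (auto simp: C_def bd_def)
      ultimately have "P \<inter> (c \<union> insert z Q) \<noteq> {}"
        using crossings_meet[OF lP, of "c \<union> insert z Q" u t "-L" 0 0 h] PH lr u zt by auto
      moreover have "P \<inter> c = {}" "P \<inter> Q = {}" using PH Q by (auto simp: bd_def e_def)
      ultimately show ?thesis by auto
    qed
    show ?thesis using w(2) unfolding K_def
    proof (elim disjE bexE exE conjE)
      assume "J \<inter> e c \<noteq> {}"
      then obtain j where j: "j \<in> J" "j \<in> e c" by auto
      then have jh: "snd j = h" using J by auto
      then have "j \<in> bd c" using j c by (auto simp: e_def C_def)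
      then have "j \<in> P" using onP[of j "{}" j] jh reach_refl[of j "{j}"] by auto
      then show ?thesis using lx[of j] lr(2) j(1) unfolding conn_def by blast
    next
      fix j v assume jv: "j \<in> J" "reach adj4 (w \<inter> (?\<Lambda> - E c)) j v" "fst v = -L"
      have "reach adj4 (w \<inter> ?\<Lambda>) v j"
        using reach4_sym[OF reach_mono[OF jv(2), of "w \<inter> ?\<Lambda>"]] by blast
      then show ?thesis using jv(1,3) unfolding conn_def by blast
    next
      fix j v z assume jv: "j \<in> J" "reach adj4 (w \<inter> (?\<Lambda> - E c)) j v" and z: "z \<in> e c" "adj4 v z"
      have v: "v \<in> ?\<Lambda>" "v \<notin> E c" using reach_in[OF jv(2)] by auto
      have zH: "z \<in> ?H" using eH[OF c] z by auto
      \<comment> \<open>the right half is folded onto the left half; this preserves the complement of \<open>E c\<close>\<close>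
      define \<phi> where "\<phi> x = (- \<bar>fst x\<bar>, snd x)" for x :: site
      have \<phi>: "\<phi> x = x \<or> \<phi> x = reflect x" for x by (cases "fst x \<le> 0") (auto simp: \<phi>_def reflect_def)
      have \<phi>E: "\<phi> x \<notin> E c" if "x \<notin> E c" for x using \<phi>[of x] reflect_E[of x c] that by auto
      have \<phi>H: "\<phi> x \<in> ?H" if "x \<in> ?\<Lambda>" for x using that by (auto simp: \<phi>_def in_rect')
      have z\<phi>: "adj8 z (\<phi> v)"
      proof -
        have "fst z \<le> 0" using zH by (auto simp: in_rect')
        then show ?thesis using z(2) unfolding \<phi>_def adj4_def adj8_def prod_eq_iff fst_conv snd_conv by presburger
      qed
      have "z \<notin> c"
      proof
        assume "z \<in> c"
        then have "\<phi> v \<in> e c" using adj8_sym[OF z\<phi>] \<phi>H[OF v(1)] by (auto simp: e_def bd_def)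
        then show False using \<phi>E[OF v(2)] by (auto simp: E_def)
      qed
      then have zb: "z \<in> bd c" using z by (auto simp: e_def)
      define Q where "Q = \<phi> ` (w \<inter> (?\<Lambda> - E c))"
      have Q: "Q \<subseteq> ?H - e c" using \<phi>E \<phi>H by (auto simp: Q_def E_def)
      have "reach adj8 Q (\<phi> v) (\<phi> j)"
        unfolding Q_def
        by (rule reach_map[OF reach4_sym[OF jv(2)]])
          (unfold \<phi>_def adj4_def adj8_def prod_eq_iff fst_conv snd_conv, presburger)
      then have vQ: "reach adj8 (insert z Q) (\<phi> v) (\<phi> j)" "\<phi> v \<in> insert z Q"
        using reach_mono[of adj8 Q "\<phi> v" "\<phi> j" "insert z Q"] reach_in[of adj8 Q "\<phi> v" "\<phi> j"] by auto
      have "reach adj8 (insert z Q) z (\<phi> j)"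
        using reach_trans[OF reach_step[OF reach_refl[of z "insert z Q" adj8] z\<phi> vQ(2)] vQ(1)] by simp
      moreover have "snd (\<phi> j) = h" using J jv by (auto simp: \<phi>_def)
      ultimately have "z \<in> P" using onP[OF zb Q] by blast
      then have lz: "reach adj4 (w \<inter> ?\<Lambda>) l z" by (rule lx)
      have vj: "reach adj4 (w \<inter> ?\<Lambda>) v j"
        using reach4_sym[OF reach_mono[OF jv(2), of "w \<inter> ?\<Lambda>"]] by blast
      then have "v \<in> w \<inter> ?\<Lambda>" using reach_in by metis
      then have "reach adj4 (w \<inter> ?\<Lambda>) l j"
        using reach_trans[OF reach_step[OF lz adj4_sym[OF z(2)]] vj] by simp
      then show ?thesis using lr(2) jv(1) unfolding conn_def by blast
    qed
  qed
  \<comment> \<open>\<open>F c\<close> forces the explored set to be \<open>c\<close>, so these events are disjoint\<close>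
  have explored: "D = c" if cC: "c \<in> C" and Fc: "F c w" and Ddef: "D = {v. \<exists>u. snd u = 0 \<and> reach adj8 (?H - w) u v}" for c w D
  proof (intro set_eqI iffI)
    fix v assume "v \<in> D"
    then obtain u where u: "snd u = 0" "reach adj8 (?H - w) u v" using Ddef by blast
    from u(2) show "v \<in> c"
    proof (induction rule: reach_induct)
      case refl then show ?case using u(1) Fc by (auto simp: F_def bd_def)
    next
      case (step x y) then show ?case using adj8_sym[OF step(2)] Fc by (auto simp: F_def bd_def)
    qed
  next
    fix v assume "v \<in> c"
    then obtain u where u: "snd u = 0" "reach adj8 c u v" using cC \<open>v \<in> c\<close> by (auto simp: C_def)
    have "c \<subseteq> ?H - w" using cC Fc by (auto simp: C_def F_def)
    then show "v \<in> D" using u(1) Ddef reach_mono[OF u(2)] by blast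
  qed
  have unique: "c = c'" if "c \<in> C" "c' \<in> C" "F c w" "F c' w" for c c' w
    using explored[OF that(1,3) HOL.refl] explored[OF that(2,4) HOL.refl] by simp
  have crossing: "\<exists>c\<in>C. F c w" if w: "conn (w \<inter> ?H) (vline (-L)) (vline 0)" for w
  proof -
    define D where "D = {v. \<exists>u. snd u = 0 \<and> reach adj8 (?H - w) u v}"
    have DH: "D \<subseteq> ?H - w" unfolding D_def using reach_in[of adj8 "?H - w"] by blast
    have top: "snd v \<noteq> h" if "v \<in> D" for v
    proof
      assume "snd v = h"
      then obtain u where u: "snd u = 0" "reach adj8 (?H - w) u v" using \<open>v \<in> D\<close> unfolding D_def by blast
      obtain l r where "fst l = -L" "fst r = 0" "reach adj4 (w \<inter> ?H) l r" using w unfolding conn_def by blast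
      then have "(w \<inter> ?H) \<inter> (?H - w) \<noteq> {}"
        using crossings_meet[of "w \<inter> ?H" l r "?H - w" u v "-L" 0 0 h] u \<open>snd v = h\<close> by auto
      then show False by auto
    qed
    have conn_D: "\<exists>u. snd u = 0 \<and> reach adj8 D u v" if "v \<in> D" for v
    proof -
      obtain u where u: "snd u = 0" "reach adj8 (?H - w) u v" using \<open>v \<in> D\<close> unfolding D_def by blast
      have "{x. reach adj8 (?H - w) u x} \<subseteq> D" using u(1) unfolding D_def by blast
      then show ?thesis using reach_mono[OF reach_component[OF u(2)]] u(1) by blast
    qed
    have "bd D \<subseteq> w"
    proof
      fix z assume z: "z \<in> bd D"
      show "z \<in> w"
      proof (rule ccontr)
        assume "z \<notin> w"
        then have zH: "z \<in> ?H - w" using z by (auto simp: bd_def)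
        have "z \<in> D"
        proof (cases "snd z = 0")
          case True
          then show ?thesis using reach_refl[OF zH, of adj8] unfolding D_def by blast
        next
          case False
          then obtain d where "d \<in> D" "adj8 z d" using z by (auto simp: bd_def)
          then obtain u where "snd u = 0" "reach adj8 (?H - w) u d" unfolding D_def by blast
          then show ?thesis using reach_step[of adj8 "?H - w" u d z, OF _ adj8_sym[OF \<open>adj8 z d\<close>] zH] unfolding D_def by blast
        qed
        then show False using z by (auto simp: bd_def)
      qed
    qed
    then have "F D w" using DH by (auto simp: F_def)
    moreover have "D \<in> C" using DH top conn_D unfolding C_def by blast
    ultimately show ?thesis by blast
  qed
  have "conn_prob p ?H (vline (-L)) (vline 0) * (1 - d) \<le> (\<Sum>c\<in>C. pr p ?\<Lambda> (F c)) * (1 - d)" if d1: "d \<le> 1"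
  proof (rule mult_right_mono)
    have "conn_prob p ?H (vline (-L)) (vline 0) = pr p ?\<Lambda> (\<lambda>w. conn (w \<inter> ?H) (vline (-L)) (vline 0))"
      using sub by (simp add: pr_conn)
    also have "\<dots> \<le> pr p ?\<Lambda> (\<lambda>w. \<exists>c\<in>C. F c w)"
      by (rule pr_mono[OF p]) (rule crossing)
    also have "\<dots> = (\<Sum>c\<in>C. pr p ?\<Lambda> (F c))"
      by (rule pr_Ex_disjoint[OF finC]) (rule unique)
    finally show "conn_prob p ?H (vline (-L)) (vline 0) \<le> (\<Sum>c\<in>C. pr p ?\<Lambda> (F c))" .
  qed (use d1 in simp)
  moreover have "(\<Sum>c\<in>C. pr p ?\<Lambda> (F c)) * (1 - d) \<le> (\<Sum>c\<in>C. pr p ?\<Lambda> (\<lambda>w. F c w \<and> K c w))"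
    unfolding sum_distrib_right
  proof (rule sum_mono)
    fix c assume c: "c \<in> C"
    have e\<Lambda>: "e c \<subseteq> ?\<Lambda>" using eH[OF c] sub by auto
    have F': "F c w = F c (w \<inter> e c)" for w by (auto simp: F_def e_def)
    have F'': "(\<lambda>w. F c (w \<inter> e c)) = F c" using F' by (intro ext) blast
    have K': "K c w = K c (w \<inter> (?\<Lambda> - E c))" for w by (simp add: K_def Int_assoc)
    have K'': "(\<lambda>w. K c (w \<inter> (?\<Lambda> - E c))) = K c" using K' by (intro ext) blast
    have "pr p ?\<Lambda> (\<lambda>w. F c w \<and> K c w) = pr p ?\<Lambda> (\<lambda>w. F c (w \<inter> e c) \<and> K c (w \<inter> (?\<Lambda> - E c)))"
      by (rule pr_cong) (use F' K' in blast)
    also have "\<dots> = pr p (e c) (F c) * pr p (?\<Lambda> - E c) (K c)"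
      by (rule pr_indep) (use e\<Lambda> in \<open>auto simp: E_def\<close>)
    also have "pr p (e c) (F c) = pr p ?\<Lambda> (F c)"
      using pr_restrict[OF finite_rect e\<Lambda>, of p "F c"] unfolding F'' by simp
    also have "pr p (?\<Lambda> - E c) (K c) = pr p ?\<Lambda> (K c)"
      using pr_restrict[OF finite_rect[of "-L" L 0 h] Diff_subset[of _ "E c"], where p = p and P = "K c"] unfolding K'' by simp
    finally show "pr p ?\<Lambda> (F c) * (1 - d) \<le> pr p ?\<Lambda> (\<lambda>w. F c w \<and> K c w)"
      using fresh[OF c] pr_nonneg[OF p, of ?\<Lambda> "F c"] by (simp add: mult_left_mono)
  qed
  moreover have "(\<Sum>c\<in>C. pr p ?\<Lambda> (\<lambda>w. F c w \<and> K c w)) \<le> conn_prob p ?\<Lambda> (vline (-L)) J"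
  proof -
    have "(\<Sum>c\<in>C. pr p ?\<Lambda> (\<lambda>w. F c w \<and> K c w)) = pr p ?\<Lambda> (\<lambda>w. \<exists>c\<in>C. F c w \<and> K c w)"
      by (rule pr_Ex_disjoint[OF finC, symmetric]) (use unique in blast)
    also have "\<dots> \<le> pr p ?\<Lambda> (\<lambda>w. conn (w \<inter> ?\<Lambda>) (vline (-L)) J)"
      by (rule pr_mono[OF p]) (use hit in blast)
    finally show ?thesis by (simp add: pr_conn)
  qed
  moreover have "conn_prob p ?H (vline (-L)) (vline 0) * (1 - d) \<le> conn_prob p ?\<Lambda> (vline (-L)) J" if "1 < d"
  proof -
    have "conn_prob p ?H (vline (-L)) (vline 0) * (1 - d) \<le> 0"
      unfolding conn_prob_def by (rule mult_nonneg_nonpos) (use that pr_nonneg[OF p] in auto)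
    also have "0 \<le> conn_prob p ?\<Lambda> (vline (-L)) J" using pr_nonneg[OF p] by (simp add: conn_prob_def)
    finally show ?thesis .
  qed
  ultimately show ?thesis by fastforce
qed

section \<open>From arms in the quadrant to long crossings\<close>

lemma reflect_rect: "reflect ` rect a b c d = rect (-b) (-a) c d"
proof (intro set_eqI iffI)
  fix v assume "v \<in> rect (-b) (-a) c d"
  then have "v = reflect (reflect v)" "reflect v \<in> rect a b c d"
    by (simp_all add: in_rect')
  then show "v \<in> reflect ` rect a b c d" by blast
qed (auto simp: in_rect')

lemma conn_prob_mono:
  assumes "0 \<le> p" "p \<le> 1" "finite R" "finite R'"
    and "\<And>w. conn (w \<inter> R) A B \<Longrightarrow> conn (w \<inter> R') A' B'"
  shows "conn_prob p R A B \<le> conn_prob p R' A' B'"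
proof -
  have "conn_prob p R A B = pr p (R \<union> R') (\<lambda>w. conn (w \<inter> R) A B)" using assms by (simp add: pr_conn)
  also have "\<dots> \<le> pr p (R \<union> R') (\<lambda>w. conn (w \<inter> R') A' B')" using assms by (intro pr_mono) auto
  also have "\<dots> = conn_prob p R' A' B'" using assms by (simp add: pr_conn)
  finally show ?thesis .
qed

lemma conn_prob_le_1: "0 \<le> p \<Longrightarrow> p \<le> 1 \<Longrightarrow> finite R \<Longrightarrow> conn_prob p R A B \<le> 1"
  by (simp add: conn_prob_def pr_le_1)

lemma conn_Un: "conn S A (B \<union> C) \<longleftrightarrow> conn S A B \<or> conn S A C"
  unfolding conn_def by blast

definition annulus :: "int \<Rightarrow> int \<Rightarrow> site set" where
  "annulus m n = rect 0 n 0 n - rect 0 m 0 m"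

text \<open>The arm starts at a site just outside the inner box, so the event does not depend on the
  states inside that box.\<close>

definition arm_prob :: "real \<Rightarrow> int \<Rightarrow> int \<Rightarrow> real" where
  "arm_prob p m n = conn_prob p (annulus m n) (rect 0 (m+1) 0 (m+1)) (vline n \<union> hline n)"

lemma finite_annulus [simp]: "finite (annulus m n)"
  by (simp add: annulus_def)

text \<open>An arm to a larger box contains an arm to each box in between.\<close>

lemma arm_antimono:
  assumes p: "0 \<le> p" "p \<le> 1" and mn: "m < n'" "n' \<le> n" "0 \<le> m"
  shows "arm_prob p m n \<le> arm_prob p m n'"
  unfolding arm_prob_def
proof (rule conn_prob_mono[OF p])
  fix w assume "conn (w \<inter> annulus m n) (rect 0 (m+1) 0 (m+1)) (vline n \<union> hline n)"
  then obtain u v where u: "u \<in> rect 0 (m+1) 0 (m+1)" and v: "v \<in> vline n \<union> hline n"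
    and r: "reach adj4 (w \<inter> annulus m n) u v" unfolding conn_def by blast
  have uT: "u \<in> rect 0 n' 0 n'" using u mn by (auto simp: in_rect')
  have eq: "w \<inter> annulus m n \<inter> rect 0 n' 0 n' = w \<inter> annulus m n'"
    using mn by (auto simp: annulus_def in_rect')
  from reach_exit[OF r uT] show "conn (w \<inter> annulus m n') (rect 0 (m+1) 0 (m+1)) (vline n' \<union> hline n')"
    unfolding eq
  proof (elim disjE exE conjE)
    assume r': "reach adj4 (w \<inter> annulus m n') u v"
    then have "v \<in> rect 0 n' 0 n'" using reach_in[OF r'] by (auto simp: annulus_def)
    then have "v \<in> vline n' \<union> hline n'" using v mn by (auto simp: in_rect')
    then show ?thesis using r' u unfolding conn_def by blast
  next
    fix x x' assume x: "reach adj4 (w \<inter> annulus m n') u x" "adj4 x x'" "x' \<in> w \<inter> annulus m n - rect 0 n' 0 n'"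
    have "x \<in> rect 0 n' 0 n'" using reach_in[OF x(1)] by (auto simp: annulus_def)
    then have "x \<in> vline n' \<union> hline n'" using x(2,3) by (auto simp: annulus_def in_rect' adj4_def)
    then show ?thesis using x(1) u unfolding conn_def by blast
  qed
qed auto

text \<open>The quadrant is symmetric about its diagonal, so an arm that ends on one of the two outer sides can be
  required to end on the right one; it then contains a crossing of the rectangle to the right of the inner
  box.\<close>

lemma crossing_from_arm:
  assumes p: "0 \<le> p" "p \<le> 1" and mn: "0 \<le> m" "m < n" and d: "0 \<le> d" "1 - arm_prob p m n \<le> d\<^sup>2"
  shows "1 - crossing_prob p (n - m) (n + 1) \<le> d"
proof -
  let ?A = "annulus m n" and ?I = "rect 0 (m+1) 0 (m+1)"
  have sw: "prod.swap ` ?A = ?A" "prod.swap -` ?I = ?I" "prod.swap -` hline n = vline n"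
    by (auto simp: annulus_def image_set_diff swap_rect in_rect')
  have "conn_prob p ?A ?I (hline n) = conn_prob p ?A ?I (vline n)"
    using conn_prob_image[OF lattice_iso_swap, of p ?A ?I "hline n"] by (simp add: sw)
  then have "(1 - conn_prob p ?A ?I (vline n))\<^sup>2 = (1 - pr p ?A (\<lambda>w. conn (w \<inter> ?A) ?I (vline n))) * (1 - pr p ?A (\<lambda>w. conn (w \<inter> ?A) ?I (hline n)))"
    by (simp add: pr_conn power2_eq_square)
  also have "\<dots> \<le> 1 - pr p ?A (\<lambda>w. conn (w \<inter> ?A) ?I (vline n) \<or> conn (w \<inter> ?A) ?I (hline n))"
    using harris_not[OF finite_annulus p up_event_conn up_event_conn] .
  also have "pr p ?A (\<lambda>w. conn (w \<inter> ?A) ?I (vline n) \<or> conn (w \<inter> ?A) ?I (hline n)) = arm_prob p m n"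
    unfolding arm_prob_def pr_conn[OF finite_annulus subset_refl, symmetric]
    by (simp only: conn_Un)
  also have "1 - arm_prob p m n \<le> d\<^sup>2" by (rule d)
  finally have 1: "1 - conn_prob p ?A ?I (vline n) \<le> d" using d(1) by (rule power2_le_imp_le)
  have "conn_prob p ?A ?I (vline n) \<le> conn_prob p (rect (m+1) n 0 n) (vline (m+1)) (vline n)"
  proof (rule conn_prob_mono[OF p])
    fix w assume "conn (w \<inter> ?A) ?I (vline n)"
    then obtain u v where u: "u \<in> ?I" and v: "fst v = n" and r': "reach adj4 (w \<inter> ?A) u v"
      unfolding conn_def by blast
    note r = reach4_sym[OF r']
    have vT: "v \<in> {x. m + 1 \<le> fst x}" using v mn by auto
    have sub: "w \<inter> ?A \<inter> {x. m + 1 \<le> fst x} \<subseteq> w \<inter> rect (m+1) n 0 n"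
      by (auto simp: annulus_def in_rect')
    have "\<exists>x. fst x = m + 1 \<and> reach adj4 (w \<inter> ?A \<inter> {x. m + 1 \<le> fst x}) v x"
      using reach_exit[OF r vT]
    proof (elim disjE exE conjE)
      assume r': "reach adj4 (w \<inter> ?A \<inter> {x. m + 1 \<le> fst x}) v u"
      then show ?thesis using reach_in[OF r'] u by (intro exI[of _ u]) (auto simp: in_rect')
    next
      fix x x' assume x: "reach adj4 (w \<inter> ?A \<inter> {x. m + 1 \<le> fst x}) v x" "adj4 x x'"
        "x' \<in> w \<inter> ?A - {x. m + 1 \<le> fst x}"
      then show ?thesis using reach_in[OF x(1)] by (intro exI[of _ x]) (auto simp: adj4_def)
    qed
    then obtain x where x: "fst x = m + 1" "reach adj4 (w \<inter> ?A \<inter> {x. m + 1 \<le> fst x}) v x" by blast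
    then have "reach adj4 (w \<inter> rect (m+1) n 0 n) x v"
      using reach4_sym[OF reach_mono[OF x(2) sub]] by simp
    then show "conn (w \<inter> rect (m+1) n 0 n) (vline (m+1)) (vline n)"
      using x(1) v unfolding conn_def by blast
  qed auto
  also have "\<dots> = crossing_prob p (n - m) (n + 1)"
    using crossing_prob_shift[of p "m+1" "n - m" 0 "n + 1"] by simp
  finally show ?thesis using 1 by simp
qed

text \<open>Cut the top side into \<open>N\<close> segments with \<open>2 * m + 1\<close> sites: one of them is likely to be
  joined to the bottom.  Translate it to the centre.  The translated rectangle need not fit into the new
  one, but a path that leaves the new rectangle does so through its left or its right side.\<close>

lemma segment_of_top:
  assumes p: "0 \<le> p" "p \<le> 1" and m: "0 \<le> m" and W: "W < int N * (2*m+1)" "0 < N"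
    and h: "0 \<le> h" and L: "m \<le> L"
    and d: "0 \<le> d" "1 - conn_prob p (rect 0 W 0 h) (hline 0) (hline h) \<le> d ^ N"
  shows "1 - conn_prob p (rect (-L) L 0 h) (rect (-m) m h h) (hline 0 \<union> vline (-L) \<union> vline L) \<le> d"
proof -
  let ?R = "rect 0 W 0 h" and ?\<Lambda> = "rect (-L) L 0 h" and ?J = "rect (-m) m h h"
  define s where "s i = int i * (2*m+1) + m" for i :: nat
  define Ji where "Ji i = rect (s i - m) (s i + m) h h" for i
  have "conn_prob p ?R (hline 0) (hline h) \<le> pr p ?R (\<lambda>w. \<exists>i<N. conn (w \<inter> ?R) (Ji i) (hline 0))"
  proof -
    have "\<exists>i<N. conn (w \<inter> ?R) (Ji i) (hline 0)" if "conn (w \<inter> ?R) (hline 0) (hline h)" for w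
    proof -
      obtain u v where u: "snd u = 0" and v: "snd v = h" and r': "reach adj4 (w \<inter> ?R) u v"
        using \<open>conn (w \<inter> ?R) (hline 0) (hline h)\<close> unfolding conn_def by blast
      note r = reach4_sym[OF r']
      have vR: "0 \<le> fst v" "fst v \<le> W" using reach_in[OF r] by (auto simp: in_rect')
      define i where "i = nat (fst v div (2*m+1))"
      have i: "int i = fst v div (2*m+1)" using vR m by (simp add: i_def pos_imp_zdiv_nonneg_iff)
      have dm: "int i * (2*m+1) + fst v mod (2*m+1) = fst v" "0 \<le> fst v mod (2*m+1)" "fst v mod (2*m+1) < 2*m+1"
        unfolding i using m pos_mod_bound[of "2*m+1" "fst v"] by (simp_all add: div_mult_mod_eq)
      have lo: "int i * (2*m+1) \<le> fst v" and hi: "fst v < int i * (2*m+1) + (2*m+1)"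
        using dm by linarith+
      then have iv: "v \<in> Ji i" using v by (auto simp: Ji_def s_def in_rect')
      have "int i * (2*m+1) < int N * (2*m+1)" using lo vR W by linarith
      then have "i < N" using m by simp
      then show ?thesis using iv u r unfolding conn_def by blast
    qed
    then show ?thesis
      unfolding pr_conn[OF finite_rect subset_refl, symmetric] using p by (intro pr_mono) auto
  qed
  then have "1 - pr p ?R (\<lambda>w. \<exists>i<N. conn (w \<inter> ?R) (Ji i) (hline 0)) \<le> d ^ N" using d by simp
  from square_root_trick[OF finite_rect p up_event_conn W(2) d(1) this]
  obtain i where i: "1 - conn_prob p ?R (Ji i) (hline 0) \<le> d" by (auto simp: pr_conn)
  have "conn_prob p ?R (Ji i) (hline 0) = conn_prob p (rect (0 - s i) (W - s i) 0 h) ?J (hline 0)"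
  proof -
    have "shift (s i) 0 -` Ji i = ?J" "shift (s i) 0 -` hline 0 = hline 0"
      by (auto simp: shift_def Ji_def in_rect')
    then show ?thesis
      using conn_prob_image[OF lattice_iso_shift, of p "s i" 0 "rect (0 - s i) (W - s i) 0 h" "Ji i" "hline 0"]
      by (simp add: shift_rect)
  qed
  also have "\<dots> \<le> conn_prob p ?\<Lambda> ?J (hline 0 \<union> vline (-L) \<union> vline L)"
  proof (rule conn_prob_mono[OF p])
    let ?R' = "rect (0 - s i) (W - s i) 0 h"
    fix w assume "conn (w \<inter> ?R') ?J (hline 0)"
    then obtain u v where u: "u \<in> ?J" and v: "snd v = 0" and r: "reach adj4 (w \<inter> ?R') u v"
      unfolding conn_def by blast
    have uT: "u \<in> ?\<Lambda>" using u L h by (auto simp: in_rect')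
    have sub: "w \<inter> ?R' \<inter> ?\<Lambda> \<subseteq> w \<inter> ?\<Lambda>" by auto
    have "\<exists>x \<in> hline 0 \<union> vline (-L) \<union> vline L. reach adj4 (w \<inter> ?R' \<inter> ?\<Lambda>) u x"
      using reach_exit[OF r uT]
    proof (elim disjE exE conjE)
      assume "reach adj4 (w \<inter> ?R' \<inter> ?\<Lambda>) u v" then show ?thesis using v by blast
    next
      fix x x' assume x: "reach adj4 (w \<inter> ?R' \<inter> ?\<Lambda>) u x" "adj4 x x'" "x' \<in> w \<inter> ?R' - ?\<Lambda>"
      have "x \<in> ?\<Lambda>" using reach_in[OF x(1)] by auto
      then have "x \<in> vline (-L) \<union> vline L" using x(2,3) by (auto simp: in_rect' adj4_def)
      then show ?thesis using x(1) by blast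
    qed
    then show "conn (w \<inter> ?\<Lambda>) ?J (hline 0 \<union> vline (-L) \<union> vline L)"
      using u reach_mono[OF _ sub, of adj4 u] unfolding conn_def by blast
  qed auto
  finally show ?thesis using i by simp
qed

lemma reach_horizontal:
  assumes "\<And>k. x \<le> k \<Longrightarrow> k \<le> x + int n \<Longrightarrow> (k, y) \<in> S"
  shows "reach adj4 S (x, y) (x + int n, y)"
  using assms
proof (induction n)
  case 0 then show ?case by (auto intro: reach_refl)
next
  case (Suc n)
  have "reach adj4 S (x, y) (x + int n, y)" by (rule Suc.IH) (use Suc.prems in simp)
  moreover have "adj4 (x + int n, y) (x + int (Suc n), y)" by (simp add: adj4_def)
  moreover have "(x + int (Suc n), y) \<in> S" by (rule Suc.prems) auto
  ultimately show ?case by (rule reach_step)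
qed

lemma reach_vertical:
  assumes "\<And>k. y \<le> k \<Longrightarrow> k \<le> y + int n \<Longrightarrow> (x, k) \<in> S"
  shows "reach adj4 S (x, y) (x, y + int n)"
  using assms
proof (induction n)
  case 0 then show ?case by (auto intro: reach_refl)
next
  case (Suc n)
  have "reach adj4 S (x, y) (x, y + int n)" by (rule Suc.IH) (use Suc.prems in simp)
  moreover have "adj4 (x, y + int n) (x, y + int (Suc n))" by (simp add: adj4_def)
  moreover have "(x, y + int (Suc n)) \<in> S" by (rule Suc.prems) auto
  ultimately show ?case by (rule reach_step)
qed

lemma reach_4_8: "reach adj4 S u v \<Longrightarrow> reach adj8 S u v"
  using reach_map[of adj4 S u v adj8 "\<lambda>x. x"] adj4_imp_adj8 by auto

text \<open>A connection from the left side to the top and a connection from the right side to a point further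
  left on the top cross each other.  Adding a row above and a column to the right of the rectangle, and
  prolonging the first connection along the new row and the second one along the new column, turns them into a
  left-right and a bottom-top crossing whose prolongations are disjoint.\<close>

lemma interlaced_connections_meet:
  assumes P: "reach adj4 S l j" "fst l = a" "snd j = d"
    and Q: "reach adj4 S r j'" "fst r = b" "snd j' = d"
    and j: "fst j' < fst j" and S: "S \<subseteq> rect a b c d"
  shows "reach adj4 S l r"
proof -
  define C1 where "C1 = {x. reach adj4 S l x}"
  define C2 where "C2 = {x. reach adj4 S r x}"
  have in_S: "l \<in> S" "j \<in> S" "r \<in> S" "j' \<in> S" using reach_in[OF P(1)] reach_in[OF Q(1)] by auto
  have CS: "C1 \<subseteq> S" "C2 \<subseteq> S" unfolding C1_def C2_def using reach_in[of adj4 S] by blast+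
  \<comment> \<open>the prolongations along the new row and the new column\<close>
  define X1 where "X1 = {(x, d+1) | x. fst j \<le> x \<and> x \<le> b + 1}"
  define X2 where "X2 = insert (fst j', d+1) {(b+1, y) | y. c \<le> y \<and> y \<le> snd r}"
  have jb: "a \<le> fst j" "fst j \<le> b" "a \<le> fst j'" "fst j' \<le> b" "c \<le> snd r" "snd r \<le> d"
    using subsetD[OF S in_S(2)] subsetD[OF S in_S(3)] subsetD[OF S in_S(4)] by (auto simp: in_rect')
  have "rect a b c d \<subseteq> rect a (b+1) c (d+1)" by (auto simp: rect_def)
  moreover have "X1 \<subseteq> rect a (b+1) c (d+1)" "X2 \<subseteq> rect a (b+1) c (d+1)"
    using jb by (auto simp: X1_def X2_def in_rect)
  ultimately have box: "C1 \<union> X1 \<subseteq> rect a (b+1) c (d+1)" "C2 \<union> X2 \<subseteq> rect a (b+1) c (d+1)"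
    using CS S by blast+
  have "reach adj4 (C1 \<union> X1) l (b+1, d+1)"
  proof -
    have 1: "reach adj4 (C1 \<union> X1) l j"
      using reach_mono[OF reach_component[OF P(1)]] by (simp add: C1_def)
    have "(fst j, d+1) \<in> C1 \<union> X1" using jb by (simp add: X1_def)
    moreover have "adj4 j (fst j, d+1)" using P by (simp add: adj4_def)
    ultimately have 2: "reach adj4 (C1 \<union> X1) l (fst j, d+1)" using reach_step[OF 1] by blast
    have "reach adj4 (C1 \<union> X1) (fst j, d+1) (fst j + int (nat (b + 1 - fst j)), d+1)"
      by (rule reach_horizontal) (use jb in \<open>auto simp: X1_def\<close>)
    then show ?thesis using reach_trans[OF 2] jb by simp
  qed
  moreover have "reach adj8 (C2 \<union> X2) (b+1, c) (fst j', d+1)"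
  proof -
    have 1: "reach adj4 (C2 \<union> X2) r j'"
      using reach_mono[OF reach_component[OF Q(1)]] by (simp add: C2_def)
    have "(fst j', d+1) \<in> C2 \<union> X2" by (simp add: X2_def)
    moreover have "adj4 j' (fst j', d+1)" using Q by (simp add: adj4_def)
    ultimately have 2: "reach adj4 (C2 \<union> X2) r (fst j', d+1)" using reach_step[OF 1] by blast
    have "reach adj4 (C2 \<union> X2) (b+1, c) (b+1, c + int (nat (snd r - c)))"
      by (rule reach_vertical) (use jb in \<open>auto simp: X2_def\<close>)
    then have 3: "reach adj4 (C2 \<union> X2) (b+1, c) (b+1, snd r)" using jb by simp
    have "r \<in> C2 \<union> X2" using reach_in[OF 1] by blast
    moreover have "adj4 (b+1, snd r) r" using Q by (simp add: adj4_def)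
    ultimately have "reach adj4 (C2 \<union> X2) (b+1, c) r" using reach_step[OF 3] by blast
    then show ?thesis using reach_4_8[OF reach_trans[OF _ 2]] by blast
  qed
  ultimately have "(C1 \<union> X1) \<inter> (C2 \<union> X2) \<noteq> {}"
    using crossings_meet[of "C1 \<union> X1" l "(b+1,d+1)" "C2 \<union> X2" "(b+1,c)" "(fst j', d+1)" a "b+1" c "d+1"] box P(2)
    by simp
  moreover have "X1 \<inter> X2 = {}" using j jb by (auto simp: X1_def X2_def)
  moreover have "C1 \<inter> X2 = {}" "X1 \<inter> C2 = {}"
    using CS S by (auto simp: X1_def X2_def rect_def)
  ultimately obtain x where "x \<in> C1" "x \<in> C2" by blast
  then have "reach adj4 S l x" "reach adj4 S r x" by (auto simp: C1_def C2_def)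
  then show ?thesis using reach_trans[OF _ reach4_sym] by blast
qed

text \<open>The reflected event joins the segment to the right side; translated by the length of the segment, it
  interlaces with the original one.\<close>

lemma crossing_from_halves:
  assumes p: "0 \<le> p" "p \<le> 1" and m: "0 \<le> m" "2*m+1 \<le> 2*L" and h: "0 \<le> h"
    and d: "1 - conn_prob p (rect (-L) L 0 h) (vline (-L)) (rect (-m) m h h) \<le> d"
  shows "1 - crossing_prob p (2*L - 2*m) (h+1) \<le> 2*d"
proof -
  let ?\<Lambda> = "rect (-L) L 0 h" and ?J = "rect (-m) m h h"
  define s where "s = 2*m+1"
  \<comment> \<open>the translate by the number \<open>s\<close> of sites of the segment\<close>
  let ?\<Lambda>' = "rect (-L-s) (L-s) 0 h" and ?J' = "rect (-m-s) (m-s) h h" and ?R = "rect (-L) (L-s) 0 h"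
  have eq1: "conn_prob p ?\<Lambda> (vline L) ?J = conn_prob p ?\<Lambda> (vline (-L)) ?J"
  proof -
    have "reflect -` vline (-L) = vline L" "reflect -` ?J = ?J"
      by (auto simp: in_rect reflect_def)
    then show ?thesis
      using conn_prob_image[OF lattice_iso_reflect, of p ?\<Lambda> "vline (-L)" ?J] by (simp add: reflect_rect)
  qed
  have eq2: "conn_prob p ?\<Lambda>' (vline (L-s)) ?J' = conn_prob p ?\<Lambda> (vline L) ?J"
  proof -
    have "shift (-s) 0 -` vline (L-s) = vline L" "shift (-s) 0 -` ?J' = ?J"
      by (auto simp: shift_def in_rect')
    then show ?thesis
      using conn_prob_image[OF lattice_iso_shift, of p "-s" 0 ?\<Lambda> "vline (L-s)" ?J'] by (simp add: shift_rect)
  qed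
  let ?U = "?\<Lambda> \<union> ?\<Lambda>'"
  have "1 - 2*d \<le> pr p ?U (\<lambda>w. conn (w \<inter> ?\<Lambda>) (vline (-L)) ?J \<and> conn (w \<inter> ?\<Lambda>') (vline (L-s)) ?J')"
    using pr_and_ge[of ?U p "\<lambda>w. conn (w \<inter> ?\<Lambda>) (vline (-L)) ?J" "\<lambda>w. conn (w \<inter> ?\<Lambda>') (vline (L-s)) ?J'"] p d
    by (simp add: pr_conn eq1 eq2)
  also have "\<dots> \<le> pr p ?U (\<lambda>w. conn (w \<inter> ?R) (vline (-L)) (vline (L-s)))"
  proof (rule pr_mono[OF p])
    fix w assume w: "conn (w \<inter> ?\<Lambda>) (vline (-L)) ?J \<and> conn (w \<inter> ?\<Lambda>') (vline (L-s)) ?J'"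
    obtain l j where lj: "fst l = -L" "j \<in> ?J" "reach adj4 (w \<inter> ?\<Lambda>) l j" using w unfolding conn_def by blast
    obtain r j' where rj: "fst r = L-s" "j' \<in> ?J'" "reach adj4 (w \<inter> ?\<Lambda>') r j'" using w unfolding conn_def by blast
    have lR: "l \<in> ?R" using reach_in[OF lj(3)] lj(1) m by (auto simp: in_rect' s_def)
    have rR: "r \<in> ?R" using reach_in[OF rj(3)] rj(1) m by (auto simp: in_rect' s_def)
    have sub: "w \<inter> ?\<Lambda> \<inter> ?R \<subseteq> w \<inter> ?R" "w \<inter> ?\<Lambda>' \<inter> ?R \<subseteq> w \<inter> ?R" by auto
    show "conn (w \<inter> ?R) (vline (-L)) (vline (L-s))"
      using reach_exit[OF lj(3) lR]
    proof (elim disjE exE conjE)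
      fix x x' assume x: "reach adj4 (w \<inter> ?\<Lambda> \<inter> ?R) l x" "adj4 x x'" "x' \<in> w \<inter> ?\<Lambda> - ?R"
      have "x \<in> ?R" using reach_in[OF x(1)] by auto
      then have "fst x = L - s" using x(2,3) by (auto simp: in_rect' adj4_def)
      then show ?thesis using reach_mono[OF x(1) sub(1)] lj(1) unfolding conn_def by blast
    next
      assume lj': "reach adj4 (w \<inter> ?\<Lambda> \<inter> ?R) l j"
      show ?thesis using reach_exit[OF rj(3) rR]
      proof (elim disjE exE conjE)
        fix x x' assume x: "reach adj4 (w \<inter> ?\<Lambda>' \<inter> ?R) r x" "adj4 x x'" "x' \<in> w \<inter> ?\<Lambda>' - ?R"
        have "x \<in> ?R" using reach_in[OF x(1)] by auto
        then have "fst x = - L" using x(2,3) by (auto simp: in_rect' adj4_def)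
        then show ?thesis using reach4_sym[OF reach_mono[OF x(1) sub(2)]] rj(1) unfolding conn_def by blast
      next
        assume rj': "reach adj4 (w \<inter> ?\<Lambda>' \<inter> ?R) r j'"
        have "reach adj4 (w \<inter> ?R) l r"
          by (rule interlaced_connections_meet[OF reach_mono[OF lj' sub(1)] _ _ reach_mono[OF rj' sub(2)], of "-L" h "L-s" 0])
            (use lj rj in \<open>auto simp: in_rect' s_def\<close>)
        then show ?thesis using lj(1) rj(1) unfolding conn_def by blast
      qed
    qed
  qed
  also have "\<dots> = conn_prob p ?R (vline (-L)) (vline (L-s))"
    by (rule pr_conn) (use m in \<open>auto simp: in_rect' s_def\<close>)
  also have "\<dots> = crossing_prob p (2*L - 2*m) (h+1)"
    using crossing_prob_shift[of p "-L" "2*L - 2*m" 0 "h+1"] by (simp add: s_def algebra_simps)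
  finally show ?thesis by simp
qed

lemma crossing_prob_antimono:
  assumes p: "0 \<le> p" "p \<le> 1" and "1 \<le> a'" "a' \<le> a"
  shows "crossing_prob p a b \<le> crossing_prob p a' b"
  unfolding crossing_prob_def
proof (rule conn_prob_mono[OF p])
  let ?R = "rect 0 (a-1) 0 (b-1)" and ?R' = "rect 0 (a'-1) 0 (b-1)"
  fix w assume "conn (w \<inter> ?R) (vline 0) (vline (a-1))"
  then obtain u v where u: "fst u = 0" and v: "fst v = a-1" and r: "reach adj4 (w \<inter> ?R) u v"
    unfolding conn_def by blast
  have uT: "u \<in> ?R'" using reach_in[OF r] u assms by (auto simp: in_rect')
  have eq: "w \<inter> ?R \<inter> ?R' = w \<inter> ?R'" using assms by (auto simp: in_rect')
  from reach_exit[OF r uT] show "conn (w \<inter> ?R') (vline 0) (vline (a'-1))"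
    unfolding eq
  proof (elim disjE exE conjE)
    assume r': "reach adj4 (w \<inter> ?R') u v"
    then have "v \<in> vline (a'-1)" using reach_in[OF r'] v assms by (auto simp: in_rect')
    then show ?thesis using r' u unfolding conn_def by blast
  next
    fix x x' assume x: "reach adj4 (w \<inter> ?R') u x" "adj4 x x'" "x' \<in> w \<inter> ?R - ?R'"
    then have "x \<in> vline (a'-1)" using reach_in[OF x(1)] by (auto simp: in_rect' adj4_def)
    then show ?thesis using x(1) u unfolding conn_def by blast
  qed
qed auto

text \<open>The two rectangles may stick out of each other as in a cross: both paths are crossings of
  \<open>rect x0 x1 v0 v1\<close>.\<close>

lemma LR_meets_TB:
  assumes "reach adj4 (w \<inter> rect x0 x1 y0 y1) l r" "fst l = x0" "fst r = x1"
    and "reach adj4 (w \<inter> rect u0 u1 v0 v1) b t" "snd b = v0" "snd t = v1"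
    and "x0 \<le> u0" "u1 \<le> x1" "v0 \<le> y0" "y1 \<le> v1"
  obtains z where "reach adj4 (w \<inter> rect x0 x1 y0 y1) l z" "reach adj4 (w \<inter> rect u0 u1 v0 v1) b z"
proof -
  let ?P = "{z. reach adj4 (w \<inter> rect x0 x1 y0 y1) l z}"
  let ?Q = "{z. reach adj4 (w \<inter> rect u0 u1 v0 v1) b z}"
  have "?P \<subseteq> rect x0 x1 v0 v1" "?Q \<subseteq> rect x0 x1 v0 v1"
    using assms(7-10)
    by (auto simp: in_rect' dest!: reach_in)
  then have "?P \<inter> ?Q \<noteq> {}"
    by (rule crossings_meet[OF reach_component[OF assms(1)] reach_4_8[OF reach_component[OF assms(4)]]]) (fact assms)+
  then show ?thesis using that by blast
qed

text \<open>Two long crossings that overlap in a square are tied together by a vertical crossing of the square.\<close>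

lemma crossing_prob_concat:
  assumes p: "0 \<le> p" "p \<le> 1" and b: "1 \<le> b" "b \<le> a" "b \<le> a'"
  shows "1 - crossing_prob p (a + a' - b) b \<le> (1 - crossing_prob p a b) + (1 - crossing_prob p a' b) + (1 - crossing_prob p b b)"
proof -
  let ?R1 = "rect 0 (a-1) 0 (b-1)" and ?R2 = "rect (a-b) (a+a'-b-1) 0 (b-1)" and ?R3 = "rect (a-b) (a-1) 0 (b-1)"
  let ?R = "rect 0 (a+a'-b-1) 0 (b-1)"
  let ?E1 = "\<lambda>w. conn (w \<inter> ?R1) (vline 0) (vline (a-1))"
  let ?E2 = "\<lambda>w. conn (w \<inter> ?R2) (vline (a-b)) (vline (a+a'-b-1))"
  let ?E3 = "\<lambda>w. conn (w \<inter> ?R3) (hline 0) (hline (b-1))"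
  have sub: "?R1 \<subseteq> ?R" "?R2 \<subseteq> ?R" "?R3 \<subseteq> ?R" using b by (auto simp: in_rect')
  have e1: "pr p ?R ?E1 = crossing_prob p a b" using sub by (simp add: pr_conn crossing_prob_def)
  have e2: "pr p ?R ?E2 = crossing_prob p a' b" using sub crossing_prob_shift[of p "a-b" a' 0 b] by (simp add: pr_conn algebra_simps)
  have e3: "pr p ?R ?E3 = crossing_prob p b b" using sub crossing_prob_swap[of p "a-b" b 0 b] by (simp add: pr_conn algebra_simps)
  have "pr p ?R (\<lambda>w. (?E1 w \<and> ?E2 w) \<and> ?E3 w) \<le> pr p ?R (\<lambda>w. conn (w \<inter> ?R) (vline 0) (vline (a+a'-b-1)))"
  proof (rule pr_mono[OF p])
    fix w assume w: "(?E1 w \<and> ?E2 w) \<and> ?E3 w"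
    obtain l r where lr: "fst l = 0" "fst r = a-1" "reach adj4 (w \<inter> ?R1) l r" using w unfolding conn_def by blast
    obtain l' r' where lr': "fst l' = a-b" "fst r' = a+a'-b-1" "reach adj4 (w \<inter> ?R2) l' r'" using w unfolding conn_def by blast
    obtain u t where ut: "snd u = 0" "snd t = b-1" "reach adj4 (w \<inter> ?R3) u t" using w unfolding conn_def by blast
    obtain z where z: "reach adj4 (w \<inter> ?R1) l z" "reach adj4 (w \<inter> ?R3) u z"
      by (rule LR_meets_TB[OF lr(3,1,2) ut(3,1,2)]) (use b in auto)
    obtain z' where z': "reach adj4 (w \<inter> ?R2) l' z'" "reach adj4 (w \<inter> ?R3) u z'"
      by (rule LR_meets_TB[OF lr'(3,1,2) ut(3,1,2)]) (use b in auto)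
    have up: "reach adj4 (w \<inter> ?R) x y" if "reach adj4 (w \<inter> R) x y" "R \<subseteq> ?R" for R x y
      using reach_mono[OF that(1)] that(2) by blast
    have "reach adj4 (w \<inter> ?R) l z" "reach adj4 (w \<inter> ?R) z u" "reach adj4 (w \<inter> ?R) u z'" "reach adj4 (w \<inter> ?R) z' l'"
      "reach adj4 (w \<inter> ?R) l' r'"
      using up[OF z(1) sub(1)] up[OF reach4_sym[OF z(2)] sub(3)] up[OF z'(2) sub(3)] up[OF reach4_sym[OF z'(1)] sub(2)]
        up[OF lr'(3) sub(2)] by auto
    then have "reach adj4 (w \<inter> ?R) l r'" by (meson reach_trans)
    then show "conn (w \<inter> ?R) (vline 0) (vline (a+a'-b-1))" using lr(1) lr'(2) unfolding conn_def by blast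
  qed
  also have "\<dots> = crossing_prob p (a + a' - b) b" by (simp add: pr_conn crossing_prob_def)
  finally show ?thesis
    using pr_and_ge[OF finite_rect[of 0 "a+a'-b-1" 0 "b-1"] p, of "\<lambda>w. ?E1 w \<and> ?E2 w" ?E3]
      pr_and_ge[OF finite_rect[of 0 "a+a'-b-1" 0 "b-1"] p, of ?E1 ?E2] unfolding e1 e2 e3 by linarith
qed

text \<open>Concatenation gives crossings of length four with five times the error; the rectangle of
  double height contains two independent copies, both of which have to fail.\<close>

lemma crossing_prob_double:
  assumes p: "0 \<le> p" "p \<le> 1" and b: "1 \<le> b"
  shows "1 - crossing_prob p (4*b) (2*b) \<le> 25 * (1 - crossing_prob p (2*b) b)\<^sup>2"
proof -
  let ?u = "1 - crossing_prob p (2*b) b"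
  have hc1: "crossing_prob p a b \<le> 1" for a unfolding crossing_prob_def using p by (intro conn_prob_le_1) auto
  have sq: "1 - crossing_prob p b b \<le> ?u" using crossing_prob_antimono[OF p, of b "2*b" b] b by simp
  have "1 - crossing_prob p (3*b) b \<le> 3 * ?u"
    using crossing_prob_concat[OF p, of b "2*b" "2*b"] b sq by (simp add: algebra_simps)
  then have long: "1 - crossing_prob p (4*b) b \<le> 5 * ?u"
    using crossing_prob_concat[OF p, of b "3*b" "2*b"] b sq by (simp add: algebra_simps)
  let ?R1 = "rect 0 (4*b-1) 0 (b-1)" and ?R2 = "rect 0 (4*b-1) b (2*b-1)" and ?R = "rect 0 (4*b-1) 0 (2*b-1)"
  let ?E = "\<lambda>w. conn w (vline 0) (vline (4*b-1))"
  have sub: "?R1 \<subseteq> ?R" "?R2 \<subseteq> ?R" "?R1 \<inter> ?R2 = {}" using b by (auto simp: in_rect')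
  have e1: "pr p ?R1 ?E = crossing_prob p (4*b) b" by (simp add: crossing_prob_def conn_prob_def)
  have e2: "pr p ?R2 ?E = crossing_prob p (4*b) b"
    using crossing_prob_shift[of p 0 "4*b" b b] by (simp add: conn_prob_def algebra_simps)
  have "1 - crossing_prob p (4*b) (2*b) = pr p ?R (\<lambda>w. \<not> ?E w)"
    by (simp add: pr_not crossing_prob_def conn_prob_def)
  also have "\<dots> \<le> pr p ?R (\<lambda>w. \<not> ?E (w \<inter> ?R1) \<and> \<not> ?E (w \<inter> ?R2))"
    by (rule pr_mono[OF p]) (use conn_mono in blast)
  also have "\<dots> = pr p ?R1 (\<lambda>w. \<not> ?E w) * pr p ?R2 (\<lambda>w. \<not> ?E w)"
    by (rule pr_indep) (use sub in auto)
  also have "\<dots> = (1 - crossing_prob p (4*b) b)\<^sup>2"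
    by (simp add: pr_not e1 e2 power2_eq_square)
  also have "\<dots> \<le> (5 * ?u)\<^sup>2"
    using long hc1[of "4*b"] by (intro power_mono) auto
  also have "\<dots> = 25 * ?u\<^sup>2" by (simp only: power_mult_distrib) simp
  finally show ?thesis .
qed

text \<open>The exponent 40 accounts for the three applications of the square-root trick: a square root for the
  diagonal symmetry, a tenth root for the segments of the top side and a square root for the reflection.
  An arm of length \<open>20 * m\<close> contains one of length \<open>h = 19 * m - 1\<close>; the longer one is used for the
  vertical crossing, the shorter one for the horizontal crossing of the left half, so that both
  rectangles have \<open>h + 1\<close> rows although each is a little shorter in the direction of its crossing.\<close>

lemma long_crossing_from_arm:
  assumes p: "0 \<le> p" "p \<le> 1" and m: "1 \<le> m" and t: "0 \<le> t" "t \<le> 1" and arm: "1 - arm_prob p m (20*m) \<le> t ^ 40"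
  shows "1 - crossing_prob p (2 * (19*m)) (19*m) \<le> 12 * t"
proof -
  define h where "h = 19*m - 1"
  \<comment> \<open>chosen so that \<open>rect (-L) 0 0 h\<close> has the \<open>h - m\<close> columns that an arm of length \<open>h\<close> crosses\<close>
  define L where "L = 18*m - 2"
  have arm1: "1 - arm_prob p m h \<le> (t ^ 20)\<^sup>2" "1 - arm_prob p m (20*m) \<le> (t ^ 20)\<^sup>2"
    using arm_antimono[OF p, of m h "20*m"] arm m by (simp_all add: h_def flip: power_mult)
  have G: "1 - conn_prob p (rect (-L) 0 0 h) (vline (-L)) (vline 0) \<le> t ^ 20"
  proof -
    have "1 - crossing_prob p (h - m) (h + 1) \<le> t ^ 20"
      by (rule crossing_from_arm[OF p _ _ _ arm1(1)]) (use m t in \<open>auto simp: h_def\<close>)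
    moreover have "conn_prob p (rect (-L) 0 0 h) (vline (-L)) (vline 0) = crossing_prob p (h - m) (h + 1)"
      using crossing_prob_shift[of p "-L" "h - m" 0 "h + 1"] by (simp add: L_def h_def)
    ultimately show ?thesis by simp
  qed
  have TB: "1 - conn_prob p (rect 0 (20*m) 0 h) (hline 0) (hline h) \<le> (t\<^sup>2) ^ 10"
  proof -
    have "1 - crossing_prob p (20*m - m) (20*m + 1) \<le> t ^ 20"
      by (rule crossing_from_arm[OF p _ _ _ arm1(2)]) (use m t in auto)
    moreover have "conn_prob p (rect 0 (20*m) 0 h) (hline 0) (hline h) = crossing_prob p (20*m - m) (20*m + 1)"
      using crossing_prob_swap[of p 0 "20*m + 1" 0 "20*m - m"] by (simp add: h_def)
    ultimately show ?thesis by (simp flip: power_mult)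
  qed
  let ?J = "rect (-m) m h h"
  have J: "1 - conn_prob p (rect (-L) L 0 h) ?J (hline 0 \<union> vline (-L) \<union> vline L) \<le> t\<^sup>2"
    by (rule segment_of_top[OF p _ _ _ _ _ _ TB]) (use m t in \<open>auto simp: h_def L_def\<close>)
  have "conn_prob p (rect (-L) 0 0 h) (vline (-L)) (vline 0) * (1 - t) \<le> conn_prob p (rect (-L) L 0 h) (vline (-L)) ?J"
  proof (rule gluing_by_reflection[OF p _ _ _ _ _ J])
    show "reflect ` ?J = ?J"
      by (simp add: reflect_rect)
  qed (use m t in \<open>auto simp: h_def L_def in_rect'\<close>)
  moreover have "(1 - t) * (1 - t ^ 20) \<le> (1 - t) * conn_prob p (rect (-L) 0 0 h) (vline (-L)) (vline 0)"
    using G t by (intro mult_left_mono) auto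
  ultimately have "(1 - t) * (1 - t ^ 20) \<le> conn_prob p (rect (-L) L 0 h) (vline (-L)) ?J" by (simp add: mult.commute)
  moreover have "t ^ 20 \<le> t" using t power_decreasing[of 1 20 t] by simp
  moreover have "0 \<le> t * t ^ 20" using t by simp
  ultimately have half: "1 - conn_prob p (rect (-L) L 0 h) (vline (-L)) ?J \<le> 2 * t" by (simp add: algebra_simps)
  have a: "1 - crossing_prob p (2*L - 2*m) (h+1) \<le> 4 * t"
    using crossing_from_halves[OF p _ _ _ half] m by (simp add: L_def h_def)
  have h1: "h + 1 = 19*m" by (simp add: h_def)
  have sq: "1 - crossing_prob p (19*m) (19*m) \<le> 4*t"
    using a crossing_prob_antimono[OF p, of "19*m" "2*L - 2*m" "19*m"] m by (simp add: L_def h1)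
  have "1 - crossing_prob p (2*(2*L - 2*m) - 19*m) (19*m) \<le> 12 * t"
    using crossing_prob_concat[OF p, of "19*m" "2*L - 2*m" "2*L - 2*m"] a[unfolded h1] sq m by (simp add: L_def algebra_simps)
  then show ?thesis
    using crossing_prob_antimono[OF p, of "2*(19*m)" "2*(2*L - 2*m) - 19*m" "19*m"] m by (simp add: L_def)
qed

section \<open>Long crossings and percolation\<close>

lemma connected_in_imp_reach:
  assumes "connected_in \<omega> u v"
  shows "reach adjacent {x. \<omega> x} u v"
proof -
  have "reach adjacent {x. \<omega> x} (hd vs) (last vs)"
    if "vs \<noteq> []" "successively adjacent vs" "\<forall>x\<in>set vs. \<omega> x" for vs
    using that
  proof (induction vs rule: rev_nonempty_induct)
    case (single x) then show ?case by (auto intro: reach_refl)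
  next
    case (snoc x xs)
    then have "reach adjacent {x. \<omega> x} (hd xs) (last xs)" "adjacent (last xs) x"
      by (auto simp: successively_append_iff)
    then show ?case using snoc by (auto intro: reach_step)
  qed
  then show ?thesis using assms unfolding connected_in_def open_path_def by blast
qed

lemma reach_imp_connected_in:
  assumes "reach adjacent {x. \<omega> x} u v"
  shows "connected_in \<omega> u v"
  using assms
proof (induction rule: reach_induct)
  case refl
  then show ?case unfolding connected_in_def open_path_def by (intro exI[of _ "[u]"]) auto
next
  case (step v w)
  then obtain vs where vs: "vs \<noteq> []" "distinct vs" "successively adjacent vs" "\<forall>v\<in>set vs. \<omega> v" "hd vs = u" "last vs = v"
    unfolding connected_in_def open_path_def by blast
  show ?case
  proof (cases "w \<in> set vs")
    case True
    then obtain as bs where "vs = as @ w # bs" by (meson split_list)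
    then have eq: "vs = (as @ [w]) @ bs" by simp
    have "successively adjacent (as @ [w])" using vs(3) unfolding eq successively_append_iff[of _ "as @ [w]"] by simp
    moreover have "hd (as @ [w]) = u" using vs(5) unfolding eq by (cases as) auto
    ultimately show ?thesis using vs(2,4) unfolding connected_in_def open_path_def eq
      by (intro exI[of _ "as @ [w]"]) auto
  next
    case False
    then show ?thesis using vs step unfolding connected_in_def open_path_def
      by (intro exI[of _ "vs @ [w]"]) (auto simp: successively_append_iff)
  qed
qed

definition site_of :: "vertex \<Rightarrow> site" where "site_of v = (int (fst v), int (snd v))"

lemma inj_site_of: "inj site_of" by (auto simp: inj_def site_of_def)

lemma adj4_site_of [simp]: "adj4 (site_of u) (site_of v) \<longleftrightarrow> adjacent u v"
  by (simp add: adj4_def adjacent_def site_of_def)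

lemma site_of_box: "rect 0 (int n) 0 (int n) = site_of ` ({..n} \<times> {..n})"
proof (intro set_eqI iffI)
  fix v assume "v \<in> rect 0 (int n) 0 (int n)"
  then have "v = site_of (nat (fst v), nat (snd v))" "(nat (fst v), nat (snd v)) \<in> {..n} \<times> {..n}"
    by (auto simp: in_rect' site_of_def)
  then show "v \<in> site_of ` ({..n} \<times> {..n})" by blast
qed (auto simp: in_rect' site_of_def)

lemma reach_site_of: "reach adj4 (site_of ` S) (site_of u) (site_of v) \<longleftrightarrow> reach adjacent S u v"
proof
  assume "reach adjacent S u v"
  then show "reach adj4 (site_of ` S) (site_of u) (site_of v)" by (rule reach_map) simp
next
  have inv: "inv site_of (site_of x) = x" for x using inj_site_of by simp
  assume "reach adj4 (site_of ` S) (site_of u) (site_of v)"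
  then have "reach adjacent (inv site_of ` (site_of ` S)) (inv site_of (site_of u)) (inv site_of (site_of v))"
    by (rule reach_map) (auto simp: inv)
  then show "reach adjacent S u v" by (simp add: inv image_image)
qed

definition far :: "nat \<Rightarrow> (vertex \<Rightarrow> bool) set" where
  "far N = {\<omega>. \<exists>v. N < fst v + snd v \<and> connected_in \<omega> (0,0) v}"

lemma origin_to_infinity_far: "origin_to_infinity = (\<Inter>N. far N)"
proof (intro set_eqI iffI)
  fix \<omega> assume "\<omega> \<in> origin_to_infinity"
  then show "\<omega> \<in> (\<Inter>N. far N)" unfolding origin_to_infinity_def far_def by blast
next
  fix \<omega> assume "\<omega> \<in> (\<Inter>N. far N)"
  then have "\<forall>N. \<exists>v. N < fst v + snd v \<and> connected_in \<omega> (0,0) v" by (auto simp: far_def)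
  then obtain s where "\<forall>N. N < fst (s N) + snd (s N) \<and> connected_in \<omega> (0, 0) (s N)"
    by metis
  then show "\<omega> \<in> origin_to_infinity" unfolding origin_to_infinity_def by blast
qed

lemma far_sets: "far N \<in> sets (site_measure r)"
proof -
  have [measurable]: "Measurable.pred (site_measure r) (\<lambda>\<omega>. \<omega> v)" for v
    unfolding site_measure_def by (rule measurable_compose[OF measurable_component_singleton]) auto
  have eq: "far N = {\<omega> \<in> space (site_measure r). \<exists>vs. (N < fst (last vs) + snd (last vs) \<and> vs \<noteq> [] \<and> distinct vs \<and>
        successively adjacent vs \<and> hd vs = (0, 0)) \<and> (\<forall>v\<in>set vs. \<omega> v)}"
    unfolding far_def connected_in_def open_path_def by (simp only: space_site_measure UNIV_I simp_thms) blast
  show ?thesis unfolding eq by measurable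
qed

lemma prob_space_site_measure: "prob_space (site_measure r)"
  unfolding site_measure_def by (rule prob_space_PiM) (rule measure_pmf.prob_space_axioms)

text \<open>Percolation is the decreasing limit of the events \<open>far K\<close>.\<close>

lemma percolation_lower_bound:
  assumes "\<And>K. c \<le> measure (site_measure r) (far K)"
  shows "c \<le> measure (site_measure r) origin_to_infinity"
proof -
  interpret prob_space "site_measure r" by (rule prob_space_site_measure)
  have "decseq far" unfolding decseq_def far_def by (auto intro: le_less_trans)
  then have "(\<lambda>N. measure (site_measure r) (far N)) \<longlonglongrightarrow> measure (site_measure r) (\<Inter>N. far N)"
    using far_sets by (intro finite_Lim_measure_decseq) auto
  then show ?thesis unfolding origin_to_infinity_far by (rule LIMSEQ_le_const) (use assms in blast)
qed

lemma pr_all_open: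
  assumes "finite S" shows "pr p S (\<lambda>w. S \<subseteq> w) = p ^ card S"
proof -
  have "pr p S (\<lambda>w. S \<subseteq> w) = (\<Sum>w\<in>{S}. of_bool (S \<subseteq> w) * (p ^ card w * (1 - p) ^ card (S - w)))"
    unfolding pr_def using assms by (intro sum.mono_neutral_right) auto
  then show ?thesis by simp
qed

lemma pr_0:
  assumes "finite S" shows "pr 0 S P = of_bool (P {})"
proof -
  have "pr 0 S P = (\<Sum>w\<in>{{}}. of_bool (P w) * (0 ^ card w * (1 - 0) ^ card (S - w)))"
    unfolding pr_def
  proof (intro sum.mono_neutral_right ballI)
    fix w assume "w \<in> Pow S - {{}}"
    then have "0 < card w" using assms by (auto simp: card_gt_0_iff intro: finite_subset)
    then show "of_bool (P w) * (0 ^ card w * (1 - 0) ^ card (S - w)) = (0::real)" by simp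
  qed (use assms in auto)
  then show ?thesis by simp
qed

text \<open>The recursion \<open>u \<mapsto> 25 * u\<^sup>2\<close> at least halves every value up to \<open>1/50\<close>.\<close>

lemma crossing_prob_scales:
  assumes p: "0 \<le> p" "p \<le> 1" and b: "1 \<le> b" and u: "1 - crossing_prob p (2*b) b \<le> 1/50"
  shows "1 - crossing_prob p (2*(2^k*b)) (2^k*b) \<le> (1/50) * (1/2)^k"
proof (induction k)
  case 0 then show ?case using u by simp
next
  case (Suc k)
  let ?B = "2^k*b"
  have "1 - crossing_prob p (2*?B) ?B \<ge> 0" unfolding crossing_prob_def using conn_prob_le_1[OF p] by simp
  then have sq: "(1 - crossing_prob p (2*?B) ?B)\<^sup>2 \<le> ((1/50) * (1/2)^k)\<^sup>2" using Suc by (intro power_mono) auto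
  have "1 * 1 \<le> ?B" using b by (intro mult_mono) auto
  then have "1 - crossing_prob p (4*?B) (2*?B) \<le> 25 * (1 - crossing_prob p (2*?B) ?B)\<^sup>2" by (intro crossing_prob_double p) simp
  also have "\<dots> \<le> 25 * ((1/50) * (1/2)^k)\<^sup>2" using sq by simp
  also have "\<dots> = (1/100) * ((1/2)^k * (1/2)^k)" by (simp add: power2_eq_square)
  also have "\<dots> \<le> (1/100) * ((1/2)^k * 1)" by (intro mult_left_mono) (auto simp: power_le_one)
  finally show ?case by (simp add: algebra_simps)
qed

text \<open>Cross rectangles of doubling size alternately from left to right and from bottom to top.  Consecutive
  crossings meet, so together with a fully open first rectangle they join the origin to arbitrarily distant
  sites.  The errors sum up to at most \<open>1/25\<close>, and by Harris' inequality the open first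
  rectangle costs only a constant factor.\<close>

lemma percolation_from_long_crossings:
  assumes p: "0 \<le> p" "p \<le> 1" and b: "1 \<le> b" and u: "1 - crossing_prob p (2*b) b \<le> 1/50"
  shows "0 < measure (site_measure (\<lambda>_. p)) origin_to_infinity"
proof -
  define B where "B k = 2^k * b" for k :: nat
  have B: "1 \<le> B k" "B (Suc k) = 2 * B k" "2^k \<le> B k" for k
  proof -
    have "2^k * 1 \<le> B k" unfolding B_def using b by (intro mult_left_mono) auto
    then show "2^k \<le> B k" by simp
    moreover have "(1::int) \<le> 2^k" by simp
    ultimately show "1 \<le> B k" by linarith
  qed (simp add: B_def)
  define R where "R k = (if even k then rect 0 (2*B k - 1) 0 (B k - 1) else rect 0 (B k - 1) 0 (2*B k - 1))" for k
  \<comment> \<open>the coordinate along which the \<open>k\<close>-th rectangle is crossed\<close>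
  define co :: "nat \<Rightarrow> site \<Rightarrow> int" where "co k = (if even k then fst else snd)" for k
  define E where "E k w \<longleftrightarrow> conn (w \<inter> R k) {x. co k x = 0} {x. co k x = 2*B k - 1}" for k w
  have B_mono: "B j \<le> B k" if "j \<le> k" for j k
    using that b unfolding B_def by (intro mult_right_mono power_increasing) auto
  define Q where "Q k = rect 0 (2*B k) 0 (2*B k)" for k
  have RQ: "R j \<subseteq> Q k" if "j \<le> k" for j k
    using B_mono[OF that] B(1)[of j] by (auto simp: R_def Q_def in_rect)
  have finR: "finite (R k)" for k by (simp add: R_def)
  have finQ: "finite (Q k)" for k by (simp add: Q_def)
  have prE: "1 - pr p (Q k) (E j) \<le> (1/50) * (1/2)^j" if "j \<le> k" for j k
  proof -
    have "pr p (Q k) (E j) = conn_prob p (R j) {x. co j x = 0} {x. co j x = 2*B j - 1}"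
      unfolding E_def by (rule pr_conn[OF finQ RQ[OF that]])
    also have "\<dots> = crossing_prob p (2 * B j) (B j)"
      using crossing_prob_shift[of p 0 "2*B j" 0 "B j"] crossing_prob_swap[of p 0 "B j" 0 "2*B j"]
      by (simp add: R_def co_def)
    finally show ?thesis using crossing_prob_scales[OF p b u, of j] by (simp add: B_def)
  qed
  have all: "1 - pr p (Q k) (\<lambda>w. \<forall>i<n. E i w) \<le> (\<Sum>i<n. (1/50) * (1/2)^i)" if "n \<le> Suc k" for n k
    using that
  proof (induction n)
    case 0 then show ?case using pr_True[OF finQ] by simp
  next
    case (Suc n)
    have eq: "(\<lambda>w. \<forall>i<Suc n. E i w) = (\<lambda>w. (\<forall>i<n. E i w) \<and> E n w)" by (auto simp: less_Suc_eq)
    show ?case unfolding eq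
      using pr_and_ge[OF finQ p, of k "\<lambda>w. \<forall>i<n. E i w" "E n"] prE[of n k] Suc by simp
  qed
  have geo: "(\<Sum>i<n. (1/50) * (1/2)^i) \<le> (1/25::real)" for n
  proof -
    have "(\<Sum>i<n. (1/2::real)^i) = 2 * (1 - (1/2)^n)" using sum_gp_strict[of "1/2::real" n] by simp
    then have "(\<Sum>i<n. (1/2::real)^i) \<le> 2" by simp
    then show ?thesis unfolding sum_distrib_left[symmetric] by linarith
  qed
  define c where "c = p ^ card (R 0) * (24/25)"
  have "0 < p"
  proof (rule ccontr)
    assume "\<not> 0 < p"
    then have "p = 0" using p by simp
    then have "crossing_prob p (2*b) b = 0" by (simp add: crossing_prob_def conn_prob_def pr_0 conn_def reach_def)
    then show False using u by simp
  qed
  then have "0 < c" by (simp add: c_def)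
  have incE: "up_event (\<lambda>w. \<forall>i<n. E i w)" for n
    using up_event_conn unfolding up_event_def E_def by meson
  have incW: "up_event (\<lambda>w. R 0 \<subseteq> w)" unfolding up_event_def by blast
  have c_le: "c \<le> pr p (Q k) (\<lambda>w. R 0 \<subseteq> w \<and> (\<forall>i<Suc k. E i w))" for k
  proof -
    have "pr p (Q k) (\<lambda>w. R 0 \<subseteq> w) = pr p (Q k) (\<lambda>w. R 0 \<subseteq> w \<inter> R 0)" by simp
    also have "\<dots> = p ^ card (R 0)"
      using pr_restrict[OF finQ RQ[of 0 k], of p "\<lambda>w. R 0 \<subseteq> w"] pr_all_open[OF finR] by simp
    finally have 1: "pr p (Q k) (\<lambda>w. R 0 \<subseteq> w) = p ^ card (R 0)" .
    have "24/25 \<le> pr p (Q k) (\<lambda>w. \<forall>i<Suc k. E i w)"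
      using all[of "Suc k" k] geo[of "Suc k"] by linarith
    then have "c \<le> pr p (Q k) (\<lambda>w. R 0 \<subseteq> w) * pr p (Q k) (\<lambda>w. \<forall>i<Suc k. E i w)"
      unfolding c_def 1 using p by (intro mult_left_mono) auto
    also have "\<dots> \<le> pr p (Q k) (\<lambda>w. R 0 \<subseteq> w \<and> (\<forall>i<Suc k. E i w))"
      by (rule harris[OF finQ p incW incE])
    finally show ?thesis .
  qed
  have reachable: "\<exists>l r. co i l = 0 \<and> co i r = 2*B i - 1 \<and> reach adj4 (w \<inter> R i) l r \<and> reach adj4 (w \<inter> Q k) (0,0) l"
    if w: "R 0 \<subseteq> w" "\<forall>i<Suc k. E i w" and "i \<le> k" for i k w
    using \<open>i \<le> k\<close>
  proof (induction i)
    case 0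
    obtain l r where lr: "co 0 l = 0" "co 0 r = 2*B 0 - 1" "reach adj4 (w \<inter> R 0) l r"
      using w(2) unfolding E_def conn_def by blast
    have l: "fst l = 0" "0 \<le> snd l" "snd l \<le> B 0 - 1"
      using reach_in[OF lr(3)] lr(1) by (auto simp: R_def in_rect' co_def)
    have "reach adj4 (R 0) (0,0) (0, 0 + int (nat (snd l)))"
      by (rule reach_vertical) (use l B(1)[of 0] in \<open>auto simp: R_def in_rect\<close>)
    moreover have "(0, 0 + int (nat (snd l))) = l" using l by (simp add: prod_eq_iff)
    ultimately have "reach adj4 (w \<inter> Q k) (0,0) l"
      using reach_mono[of adj4 "R 0" "(0,0)" l "w \<inter> Q k"] w(1) RQ[of 0 k] by simp
    then show ?case using lr by blast
  next
    case (Suc i)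
    then obtain l r where lr: "co i l = 0" "co i r = 2*B i - 1" "reach adj4 (w \<inter> R i) l r" "reach adj4 (w \<inter> Q k) (0,0) l"
      by auto
    have "E (Suc i) w" using w(2) Suc.prems by simp
    then obtain l' r' where lr': "co (Suc i) l' = 0" "co (Suc i) r' = 2*B (Suc i) - 1" "reach adj4 (w \<inter> R (Suc i)) l' r'"
      unfolding E_def conn_def by blast
    have "\<exists>z. reach adj4 (w \<inter> R i) l z \<and> reach adj4 (w \<inter> R (Suc i)) l' z"
    proof (cases "even i")
      case True
      have "reach adj4 (w \<inter> rect 0 (2*B i - 1) 0 (B i - 1)) l r" "fst l = 0" "fst r = 2*B i - 1"
        "reach adj4 (w \<inter> rect 0 (B (Suc i) - 1) 0 (2*B (Suc i) - 1)) l' r'" "snd l' = 0" "snd r' = 2*B (Suc i) - 1"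
        using lr lr' True by (simp_all add: R_def co_def)
      then obtain z where "reach adj4 (w \<inter> rect 0 (2*B i - 1) 0 (B i - 1)) l z"
        "reach adj4 (w \<inter> rect 0 (B (Suc i) - 1) 0 (2*B (Suc i) - 1)) l' z"
        by (rule LR_meets_TB) (use B(1,2)[of i] in auto)
      then show ?thesis using True unfolding R_def by (intro exI[of _ z]) simp
    next
      case False
      have "reach adj4 (w \<inter> rect 0 (2*B (Suc i) - 1) 0 (B (Suc i) - 1)) l' r'" "fst l' = 0" "fst r' = 2*B (Suc i) - 1"
        "reach adj4 (w \<inter> rect 0 (B i - 1) 0 (2*B i - 1)) l r" "snd l = 0" "snd r = 2*B i - 1"
        using lr lr' False by (simp_all add: R_def co_def)
      then obtain z where "reach adj4 (w \<inter> rect 0 (2*B (Suc i) - 1) 0 (B (Suc i) - 1)) l' z"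
        "reach adj4 (w \<inter> rect 0 (B i - 1) 0 (2*B i - 1)) l z"
        by (rule LR_meets_TB) (use B(1,2)[of i] in auto)
      then show ?thesis using False unfolding R_def by (intro exI[of _ z]) simp
    qed
    then obtain z where z: "reach adj4 (w \<inter> R i) l z" "reach adj4 (w \<inter> R (Suc i)) l' z" by blast
    have sub: "w \<inter> R i \<subseteq> w \<inter> Q k" "w \<inter> R (Suc i) \<subseteq> w \<inter> Q k" using RQ[of i k] RQ[of "Suc i" k] Suc.prems by auto
    have "reach adj4 (w \<inter> Q k) (0,0) l'"
      using reach_trans[OF lr(4) reach_trans[OF reach_mono[OF z(1) sub(1)] reach4_sym[OF reach_mono[OF z(2) sub(2)]]]] .
    then show ?case using lr' by blast
  qed
  have "c \<le> measure (site_measure (\<lambda>_. p)) (far K)" for K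
  proof -
    interpret prob_space "site_measure (\<lambda>_. p)" by (rule prob_space_site_measure)
    define k where "k = Suc K"
    obtain n where n: "int n = 2 * B k" using B(1)[of k] by (metis nonneg_int_cases mult_nonneg_nonneg order_trans zero_le_one zero_le_numeral)
    define S where "S = {..n} \<times> {..n}"
    have QS: "Q k = site_of ` S" unfolding Q_def S_def n[symmetric] by (rule site_of_box)
    have finS: "finite S" by (simp add: S_def)
    let ?P = "\<lambda>w. R 0 \<subseteq> w \<and> (\<forall>i<Suc k. E i w)"
    have inj: "inj_on site_of S" using inj_site_of by (rule inj_on_subset) simp
    have "c \<le> pr p (site_of ` S) ?P" using c_le[of k] unfolding QS .
    also have "\<dots> = pr p S (\<lambda>w. ?P (site_of ` w))" by (rule pr_image[OF inj])
    also have "\<dots> = measure (site_measure (\<lambda>_. p)) {\<omega>. ?P (site_of ` {v\<in>S. \<omega> v})}"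
      by (rule site_measure_cylinder(2)[symmetric, OF finS p]) simp
    also have "\<dots> \<le> measure (site_measure (\<lambda>_. p)) (far K)"
    proof (rule finite_measure_mono[OF _ far_sets], rule subsetI)
      fix \<omega> assume "\<omega> \<in> {\<omega>. ?P (site_of ` {v\<in>S. \<omega> v})}"
      then have w: "R 0 \<subseteq> site_of ` {v\<in>S. \<omega> v}" "\<forall>i<Suc k. E i (site_of ` {v\<in>S. \<omega> v})" by auto
      let ?w = "site_of ` {v\<in>S. \<omega> v}"
      obtain l r where lr: "co k r = 2*B k - 1" "reach adj4 (?w \<inter> R k) l r" "reach adj4 (?w \<inter> Q k) (0,0) l"
        using reachable[OF w order_refl] by blast
      have sub: "?w \<inter> R k \<subseteq> ?w" "?w \<inter> Q k \<subseteq> ?w" by auto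
      have "reach adj4 ?w (0,0) r"
        using reach_trans[OF reach_mono[OF lr(3) sub(2)] reach_mono[OF lr(2) sub(1)]] .
      moreover have "r \<in> ?w" using reach_in[OF calculation] by simp
      then obtain v where v: "r = site_of v" by blast
      moreover have "(0,0) = site_of (0,0)" by (simp add: site_of_def)
      ultimately have "reach adjacent {v\<in>S. \<omega> v} (0,0) v" using reach_site_of by metis
      then have "reach adjacent {v. \<omega> v} (0,0) v" by (rule reach_mono) auto
      then have "connected_in \<omega> (0,0) v" by (rule reach_imp_connected_in)
      moreover have "K < fst v + snd v"
      proof -
        have "int (2^k) \<le> int (fst v + snd v)"
          using lr(1) B(3)[of k] B(1)[of k] unfolding v by (auto simp: co_def site_of_def split: if_splits)
        moreover have "K < 2^k" unfolding k_def by (meson less_exp lessI less_trans)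
        ultimately show ?thesis by linarith
      qed
      ultimately show "\<omega> \<in> far K" unfolding far_def by blast
    qed
    finally show ?thesis .
  qed
  then have "c \<le> measure (site_measure (\<lambda>_. p)) origin_to_infinity" by (rule percolation_lower_bound)
  then show ?thesis using \<open>0 < c\<close> by simp
qed

lemma p_crit_set:
  defines "A \<equiv> {p \<in> {0..1}. measure (site_measure (\<lambda>_. p)) origin_to_infinity = 0}"
  shows "0 \<in> A" "bdd_above A" "0 \<le> p_crit" "p_crit \<le> 1"
proof -
  interpret prob_space "site_measure (\<lambda>_. 0)" by (rule prob_space_site_measure)
  have "measure (site_measure (\<lambda>_. 0)) {\<omega>. (0,0) \<in> {v\<in>{(0,0)}. \<omega> v}} = 0"
    by (subst site_measure_cylinder(2)[where P = "\<lambda>w. (0,0) \<in> w" and S = "{(0,0)}" and p = 0]) (auto simp: pr_0)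
  moreover have "origin_to_infinity \<subseteq> {\<omega>. (0,0) \<in> {v\<in>{(0,0)}. \<omega> v}}"
    unfolding origin_to_infinity_far far_def using reach_in connected_in_imp_reach by fastforce
  moreover have "{\<omega>. (0,0) \<in> {v\<in>{(0,0)::vertex}. \<omega> v}} \<in> sets (site_measure (\<lambda>_. 0))"
    by (rule site_measure_cylinder(1)[where P = "\<lambda>w. (0,0) \<in> w" and S = "{(0,0)}" and p = 0]) auto
  ultimately have "measure (site_measure (\<lambda>_. 0)) origin_to_infinity \<le> 0"
    using finite_measure_mono[of origin_to_infinity] by metis
  then show 0: "0 \<in> A" by (simp add: A_def measure_le_0_iff)
  show bdd: "bdd_above A" by (rule bdd_aboveI[of _ 1]) (auto simp: A_def)
  have eq: "p_crit = Sup A" by (simp add: p_crit_def A_def)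
  show "0 \<le> p_crit" unfolding eq by (rule cSup_upper[OF 0 bdd])
  show "p_crit \<le> 1" unfolding eq by (rule cSup_least) (use 0 in blast, auto simp: A_def)
qed

text \<open>Otherwise there would be long crossings with probability more than \<open>49/50\<close> at \<open>p_crit\<close> and, by
  continuity, at all \<open>p\<close> near \<open>p_crit\<close>, among them some at which there is no percolation.\<close>

theorem arm_at_criticality:
  "\<exists>\<eta>>0. \<eta> \<le> 1 \<and> (\<forall>m\<ge>1. arm_prob p_crit m (20*m) \<le> 1 - \<eta>)"
proof (intro exI conjI allI impI)
  let ?t = "1/700 :: real"
  show "0 < ?t ^ 40" "?t ^ 40 \<le> 1" by (simp_all add: power_le_one)
  fix m :: int assume m: "1 \<le> m"
  show "arm_prob p_crit m (20*m) \<le> 1 - ?t ^ 40"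
  proof (rule ccontr)
    assume "\<not> ?thesis"
    then have "1 - arm_prob p_crit m (20*m) \<le> ?t ^ 40" by linarith
    then have "1 - crossing_prob p_crit (2*(19*m)) (19*m) \<le> 12 * ?t"
      by (intro long_crossing_from_arm) (use m p_crit_set in auto)
    then have "crossing_prob p_crit (2*(19*m)) (19*m) > 49/50" by simp
    moreover have "isCont (\<lambda>p. crossing_prob p (2*(19*m)) (19*m)) p_crit"
      using pr_continuous unfolding crossing_prob_def conn_prob_def by (auto simp: continuous_on_eq_continuous_at)
    then have "((\<lambda>p. crossing_prob p (2*(19*m)) (19*m)) \<longlongrightarrow> crossing_prob p_crit (2*(19*m)) (19*m)) (nhds p_crit)"
      using tendsto_at_iff_tendsto_nhds[of "\<lambda>p. crossing_prob p (2*(19*m)) (19*m)" p_crit] by (simp add: isCont_def)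
    ultimately have "eventually (\<lambda>p. crossing_prob p (2*(19*m)) (19*m) > 49/50) (nhds p_crit)"
      using order_tendstoD(1) by blast
    then obtain d where d: "0 < d" "\<And>p. dist p p_crit < d \<Longrightarrow> crossing_prob p (2*(19*m)) (19*m) > 49/50"
      by (auto simp: eventually_nhds_metric)
    let ?A = "{p \<in> {0..1}. measure (site_measure (\<lambda>_. p)) origin_to_infinity = 0}"
    have "p_crit - d < Sup ?A" using d(1) by (simp add: p_crit_def)
    then obtain p where p: "p \<in> ?A" "p_crit - d < p"
      using less_cSup_iff[of ?A "p_crit - d"] p_crit_set by blast
    have "p \<le> p_crit" unfolding p_crit_def using p(1) p_crit_set(2) by (rule cSup_upper)
    then have "crossing_prob p (2*(19*m)) (19*m) > 49/50" using p d(2)[of p] by (simp add: dist_real_def)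
    then have "0 < measure (site_measure (\<lambda>_. p)) origin_to_infinity"
      by (intro percolation_from_long_crossings[of p "19*m"]) (use p m in auto)
    then show False using p by simp
  qed
qed

section \<open>Gaps of heavy-tailed renewal sets\<close>

text \<open>Here \<open>F k\<close> is the probability that a spacing exceeds \<open>k\<close>, so that the sum over \<open>k \<le> n\<close> is the mean
  of a spacing truncated at \<open>n + 1\<close>.\<close>

definition heavy_scales :: "real \<Rightarrow> (nat \<Rightarrow> real) \<Rightarrow> nat set" where
  "heavy_scales c F = {n. 0 < F n \<and> c * (\<Sum>k\<le>n. F k) \<le> real (n + 1) * F n}"

lemma powr_Suc_diff_le:
  assumes "0 < a" "a < 1"
  shows "real (n + 1) powr a - real n powr a \<le> real (n + 1) powr (a - 1)"
proof -
  define y where "y = real n / real (n + 1)"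
  have y: "0 \<le> y" "y \<le> 1" by (simp_all add: y_def)
  have "y \<le> y powr a"
  proof (cases "y = 0")
    case False
    then have "y powr 1 \<le> y powr a" using y assms by (intro powr_mono') auto
    then show ?thesis using False y by simp
  qed simp
  then have "real (n + 1) powr a * y \<le> real (n + 1) powr a * y powr a" by (intro mult_left_mono) auto
  also have "\<dots> = real n powr a" by (simp add: y_def flip: powr_mult)
  finally have "real (n + 1) powr a - real n powr a \<le> real (n + 1) powr a * (1 - y)" by (simp add: algebra_simps)
  also have "1 - y = 1 / real (n + 1)" by (simp add: y_def field_simps)
  also have "real (n + 1) powr a * (1 / real (n + 1)) = real (n + 1) powr (a - 1)"
    by (simp add: powr_diff)
  finally show ?thesis .
qed

lemma powr_le_sum:
  assumes "0 < a" "a < 1"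
  shows "real k powr a \<le> (\<Sum>n<k. real (n + 1) powr (a - 1))"
proof (induction k)
  case (Suc k)
  then show ?case using powr_Suc_diff_le[OF assms, of k] by simp
qed simp

text \<open>Weighted arithmetic-geometric mean inequality, from the convexity of the exponential function.\<close>

lemma concave_step:
  assumes "0 < c" "c < 1" "1 \<le> n"
  shows "(real n / real (n + 1)) powr c \<le> 1 - c / real (n + 1)"
proof -
  define x where "x = real n / real (n + 1)"
  have x: "0 < x" "x = 1 - 1 / real (n + 1)" using assms by (simp_all add: x_def field_simps)
  have "exp ((1 - c) * 0 + c * ln x) \<le> (1 - c) * exp 0 + c * exp (ln x)"
    using convex_onD[OF exp_convex, of c 0 "ln x"] assms by simp
  then have "x powr c \<le> (1 - c) + c * x" using x(1) by (simp add: powr_def)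
  moreover have "c * x = c - c / real (n + 1)" by (simp add: x(2) algebra_simps)
  ultimately show ?thesis unfolding x_def[symmetric] by linarith
qed

text \<open>If all scales \<open>n \<ge> n0\<close> were light, then the truncated mean \<open>S n\<close> would satisfy
  \<open>S (n + 1) * (1 - c / (n + 1)) \<le> S n\<close> and grow at most like \<open>n powr c\<close>; the tail would be at most of
  order \<open>n powr (c - 1)\<close>, and the moment of order \<open>a\<close> would be finite because \<open>a + c < 1\<close>.\<close>

lemma (in prob_space) infinite_heavy_scales:
  fixes X :: "'a \<Rightarrow> nat"
  assumes X: "X \<in> measurable M (count_space UNIV)" and a: "0 < a" "a < 1"
    and inf: "(\<integral>\<^sup>+ x. ennreal (real (X x) powr a) \<partial>M) = \<infinity>"
  shows "infinite (heavy_scales ((1 - a) / 2) (\<lambda>n. prob {x \<in> space M. n < X x}))"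
proof
  define F where "F n = prob {x \<in> space M. n < X x}" for n
  define c where "c = (1 - a) / 2"
  have c: "0 < c" "c < 1" "a + c < 1" using a by (auto simp: c_def field_simps)
  define S where "S n = (\<Sum>k<n. F k)" for n
  have F0: "0 \<le> F n" for n by (simp add: F_def)
  have S0: "0 \<le> S n" for n unfolding S_def using F0 by (intro sum_nonneg) auto
  assume "finite (heavy_scales ((1 - a) / 2) (\<lambda>n. prob {x \<in> space M. n < X x}))"
  then have fin: "finite (heavy_scales c F)" by (simp add: c_def F_def[abs_def])
  obtain n0 where n0: "heavy_scales c F \<subseteq> {..<n0}" "1 \<le> n0"
    using finite_nat_bounded[OF fin] by (metis lessThan_subset_iff linorder_le_cases order_trans)
  have light: "real (n + 1) * F n \<le> c * S (n + 1)" if "n0 \<le> n" for n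
  proof -
    have "n \<notin> heavy_scales c F" using that n0 by auto
    moreover have "S (n + 1) = (\<Sum>k\<le>n. F k)" by (simp add: S_def lessThan_Suc_atMost)
    ultimately show ?thesis using F0[of n] S0[of "n+1"] c by (cases "F n = 0") (auto simp: heavy_scales_def)
  qed
  define A where "A = S n0 / real n0 powr c"
  have growth: "S n \<le> A * real n powr c" if "n0 \<le> n" for n
    using that
  proof (induction n rule: dec_induct)
    case base then show ?case using n0 by (simp add: A_def)
  next
    case (step n)
    have n: "1 \<le> n" using step n0 by simp
    have "F n \<le> S (n + 1) * (c / real (n + 1))" using light[OF step(1)] by (simp add: field_simps)
    then have "S (n + 1) * (1 - c / real (n + 1)) \<le> S n" by (simp add: S_def algebra_simps)
    moreover have "S (n + 1) * (real n / real (n + 1)) powr c \<le> S (n + 1) * (1 - c / real (n + 1))"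
      using concave_step[OF c(1,2) n] S0 by (intro mult_left_mono)
    ultimately have "S (n + 1) * (real n / real (n + 1)) powr c \<le> A * real n powr c" using step by linarith
    then have "S (n + 1) * real n powr c / real (n + 1) powr c \<le> A * real n powr c" by (simp add: powr_divide)
    then have "S (n + 1) * real n powr c \<le> (A * real (n + 1) powr c) * real n powr c" by (simp add: field_simps)
    then show ?case using n by simp
  qed
  have bound: "real (n + 1) powr (a - 1) * F n \<le> (c * A) * real (n + 1) powr (a + c - 2)" if "n0 \<le> n" for n
  proof -
    have "real (n + 1) * F n \<le> c * (A * real (n + 1) powr c)"
      using light[OF that] growth[of "n + 1"] that c by (smt (verit) mult_left_mono trans_le_add1)
    then have "F n \<le> c * A * (real (n + 1) powr c / real (n + 1))" by (simp add: field_simps)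
    then have "real (n + 1) powr (a - 1) * F n \<le> real (n + 1) powr (a - 1) * (c * A * (real (n + 1) powr c / real (n + 1)))"
      by (intro mult_left_mono) auto
    also have "real (n + 1) powr c / real (n + 1) = real (n + 1) powr (c - 1)" by (simp add: powr_diff)
    also have "real (n + 1) powr (a - 1) * (c * A * real (n + 1) powr (c - 1)) = c * A * real (n + 1) powr (a + c - 2)"
      by (simp add: powr_add[symmetric] algebra_simps)
    finally show ?thesis .
  qed
  have "summable (\<lambda>n. real (n + 1) powr (a + c - 2))"
  proof -
    have "summable (\<lambda>n. real n powr (a + c - 2))" using c by (subst summable_real_powr_iff) simp
    then show ?thesis using summable_Suc_iff[of "\<lambda>n. real n powr (a + c - 2)"] by simp
  qed
  then have "summable (\<lambda>n. (c * A) * real (n + 1) powr (a + c - 2))" by (rule summable_mult)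
  then have sm: "summable (\<lambda>n. real (n + 1) powr (a - 1) * F n)"
    by (rule summable_comparison_test'[where N = n0]) (use bound F0 in auto)
  have "(\<integral>\<^sup>+ x. ennreal (real (X x) powr a) \<partial>M)
      \<le> (\<integral>\<^sup>+ x. (\<Sum>n. ennreal (real (n + 1) powr (a - 1)) * indicator {x \<in> space M. n < X x} x) \<partial>M)"
  proof (rule nn_integral_mono)
    fix x assume x: "x \<in> space M"
    have "ennreal (real (X x) powr a) \<le> ennreal (\<Sum>n<X x. real (n + 1) powr (a - 1))"
      by (intro ennreal_leI powr_le_sum a)
    also have "\<dots> = (\<Sum>n<X x. ennreal (real (n + 1) powr (a - 1)) * indicator {x \<in> space M. n < X x} x)"
      using x by (subst sum_ennreal[symmetric]) auto
    also have "\<dots> \<le> (\<Sum>n. ennreal (real (n + 1) powr (a - 1)) * indicator {x \<in> space M. n < X x} x)"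
      by (rule sum_le_suminf) auto
    finally show "ennreal (real (X x) powr a) \<le> (\<Sum>n. ennreal (real (n + 1) powr (a - 1)) * indicator {x \<in> space M. n < X x} x)" .
  qed
  also have "\<dots> = (\<Sum>n. \<integral>\<^sup>+ x. ennreal (real (n + 1) powr (a - 1)) * indicator {x \<in> space M. n < X x} x \<partial>M)"
    using X by (intro nn_integral_suminf) auto
  also have "\<dots> = (\<Sum>n. ennreal (real (n + 1) powr (a - 1) * F n))"
    using X by (intro suminf_cong) (auto simp: nn_integral_cmult_indicator F_def emeasure_eq_measure ennreal_mult)
  also have "\<dots> = ennreal (\<Sum>n. real (n + 1) powr (a - 1) * F n)"
    using sm F0 by (intro suminf_ennreal2) auto
  also have "\<dots> < \<infinity>" by simp
  finally show False using inf by simp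
qed

lemma le_less_measurable:
  fixes f g :: "'a \<Rightarrow> nat"
  assumes [measurable]: "f \<in> measurable M (count_space UNIV)" "g \<in> measurable M (count_space UNIV)"
  shows "{x \<in> space M. f x \<le> s \<and> n < g x} \<in> sets M"
  by measurable

text \<open>With \<open>m = 2 * (n div 40)\<close>, gaps of the columns and of the rows at the same \<open>n\<close> leave the annulus
  between the boxes of sizes \<open>m\<close> and \<open>20 * m \<le> n\<close> empty.  The factor two leaves room for finitely many initial spacings, which the tail events
  below ignore.\<close>

definition gap :: "nat \<Rightarrow> nat set \<Rightarrow> bool" where
  "gap n C \<longleftrightarrow> C \<inter> {2 * (n div 40)<..n} = {}"

locale iid_spacings = prob_space M for M :: "'a measure" +
  fixes X :: "nat \<Rightarrow> 'a \<Rightarrow> nat" and F :: "nat \<Rightarrow> real"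
  assumes indep: "indep_vars (\<lambda>_. count_space UNIV) X {1..}"
    and tail: "\<And>k n. 1 \<le> k \<Longrightarrow> prob {x \<in> space M. n < X k x} = F n"
begin

lemma X_measurable: "1 \<le> k \<Longrightarrow> X k \<in> measurable M (count_space UNIV)"
  using indep by (auto simp: indep_vars_def)

lemma sum_measurable:
  assumes "1 \<le> i" shows "(\<lambda>x. \<Sum>l\<in>{i..<j}. X l x) \<in> measurable M (count_space UNIV)"
  by (rule measurable_sum_nat) (use assms X_measurable in auto)

lemma F_nonneg: "0 \<le> F n"
  using tail[of 1 n] by (metis measure_nonneg order_refl)

definition big_jump :: "nat \<Rightarrow> nat \<Rightarrow> 'a \<Rightarrow> bool" where
  "big_jump i n x \<longleftrightarrow> (\<exists>j\<ge>i. (\<Sum>l\<in>{i..<j}. X l x) \<le> n div 40 \<and> n < X j x)"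

text \<open>Up to the event that some term exceeds \<open>n\<close>, the sum is the sum of the truncated terms, to
  which Markov's inequality applies.\<close>

lemma prob_small_sum:
  assumes "1 \<le> j"
  shows "prob {x \<in> space M. (\<Sum>l\<in>{1..<j}. X l x) \<le> n div 40}
    \<ge> 1 - real (j - 1) * F n - real (j - 1) * (\<Sum>k<n. F k) / real (n div 40 + 1)"
proof -
  define Y where "Y x = (\<Sum>l\<in>{1..<j}. real (min (X l x) n))" for x
  have Xm [measurable]: "X l \<in> measurable M (count_space UNIV)" if "l \<in> {1..<j}" for l
    using that X_measurable by simp
  have ind: "real (min (X l x) n) = (\<Sum>k<n. indicator {x \<in> space M. k < X l x} x)" if "x \<in> space M" for l x
  proof -
    have "(\<Sum>k<n. indicator {x \<in> space M. k < X l x} x) = (\<Sum>k\<in>{..<n}. of_bool (k < X l x) :: real)"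
      using that by (intro sum.cong) (auto simp: indicator_def)
    also have "\<dots> = real (card {k \<in> {..<n}. k < X l x})" by (simp add: sum.If_cases Int_def of_bool_def)
    also have "{k \<in> {..<n}. k < X l x} = {..<min (X l x) n}" by auto
    finally show ?thesis by simp
  qed
  have E1: "integrable M (\<lambda>x. real (min (X l x) n))" "expectation (\<lambda>x. real (min (X l x) n)) = (\<Sum>k<n. F k)"
    if l: "l \<in> {1..<j}" for l
  proof -
    have [measurable]: "{x \<in> space M. k < X l x} \<in> events" for k using Xm[OF l] by measurable
    have "integrable M (\<lambda>x. \<Sum>k<n. indicator {x \<in> space M. k < X l x} x :: real)"
      by (intro Bochner_Integration.integrable_sum) (simp add: emeasure_eq_measure)
    then show "integrable M (\<lambda>x. real (min (X l x) n))"
      by (subst Bochner_Integration.integrable_cong[OF refl ind]) auto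
    have "expectation (\<lambda>x. real (min (X l x) n)) = expectation (\<lambda>x. \<Sum>k<n. indicator {x \<in> space M. k < X l x} x)"
      by (rule Bochner_Integration.integral_cong[OF refl ind])
    also have "\<dots> = (\<Sum>k<n. F k)"
      using tail l by (subst Bochner_Integration.integral_sum) (auto simp: emeasure_eq_measure)
    finally show "expectation (\<lambda>x. real (min (X l x) n)) = (\<Sum>k<n. F k)" .
  qed
  have intY: "integrable M Y" unfolding Y_def using E1 by (intro Bochner_Integration.integrable_sum)
  have EY: "expectation Y = real (j - 1) * (\<Sum>k<n. F k)"
    unfolding Y_def using E1 by (subst Bochner_Integration.integral_sum) auto
  let ?s = "real (n div 40 + 1)"
  have markov: "prob {x \<in> space M. Y x \<ge> ?s} \<le> expectation Y / ?s"
    by (rule integral_Markov_inequality_measure[OF intY, of "{}"]) (auto simp: Y_def intro!: sum_nonneg)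
  let ?A = "{x \<in> space M. (\<Sum>l\<in>{1..<j}. X l x) \<le> n div 40}"
  let ?B = "\<Union>l\<in>{1..<j}. {x \<in> space M. n < X l x}"
  have Am: "?A \<in> events" using sum_measurable[of 1 j] by measurable
  have Bm: "{x \<in> space M. n < X l x} \<in> events" if "l \<in> {1..<j}" for l using Xm[OF that] by measurable
  have Ym: "{x \<in> space M. Y x \<ge> ?s} \<in> events" using borel_measurable_integrable[OF intY] by measurable
  have "space M - ?A \<subseteq> ?B \<union> {x \<in> space M. Y x \<ge> ?s}"
  proof
    fix x assume x: "x \<in> space M - ?A"
    show "x \<in> ?B \<union> {x \<in> space M. Y x \<ge> ?s}"
    proof (cases "x \<in> ?B")
      case False
      then have "Y x = (\<Sum>l\<in>{1..<j}. real (X l x))" unfolding Y_def using x by (intro sum.cong) (auto simp: min_def not_less)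
      also have "\<dots> = real (\<Sum>l\<in>{1..<j}. X l x)" by simp
      also have "\<dots> \<ge> ?s" using x by (intro of_nat_mono) auto
      finally show ?thesis using x by simp
    qed simp
  qed
  then have "prob (space M - ?A) \<le> prob (?B \<union> {x \<in> space M. Y x \<ge> ?s})"
    using Bm Ym by (intro finite_measure_mono sets.Un sets.finite_UN) auto
  also have "\<dots> \<le> prob ?B + prob {x \<in> space M. Y x \<ge> ?s}"
    using Bm Ym by (intro measure_Un_le sets.finite_UN) auto
  also have "prob ?B \<le> (\<Sum>l\<in>{1..<j}. prob {x \<in> space M. n < X l x})"
    using Bm by (intro finite_measure_subadditive_finite) auto
  also have "\<dots> = real (j - 1) * F n" using tail by simp
  finally have "prob (space M - ?A) \<le> real (j - 1) * F n + real (j - 1) * (\<Sum>k<n. F k) / ?s"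
    using markov EY by simp
  then show ?thesis using prob_compl[OF Am] by simp
qed

lemma indep_sum_jump:
  assumes "1 \<le> j"
  shows "prob {x \<in> space M. (\<Sum>l\<in>{1..<j}. X l x) \<le> s \<and> n < X j x}
    = prob {x \<in> space M. (\<Sum>l\<in>{1..<j}. X l x) \<le> s} * F n"
proof -
  have "indep_vars (\<lambda>_. borel) (\<lambda>i x. real (X i x)) {1..}"
    by (rule indep_vars_compose2[OF indep]) auto
  then have "indep_vars (\<lambda>_. borel) (\<lambda>i x. real (X i x)) (insert j {1..<j})"
    by (rule indep_vars_subset) (use assms in auto)
  then have iv: "indep_var borel (\<lambda>x. real (X j x)) borel (\<lambda>x. \<Sum>l\<in>{1..<j}. real (X l x))"
    by (intro indep_vars_sum) auto
  have "prob ((\<lambda>x. (real (X j x), \<Sum>l\<in>{1..<j}. real (X l x))) -` ({real n<..} \<times> {..real s}) \<inter> space M)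
    = prob ((\<lambda>x. real (X j x)) -` {real n<..} \<inter> space M) * prob ((\<lambda>x. \<Sum>l\<in>{1..<j}. real (X l x)) -` {..real s} \<inter> space M)"
    by (rule indep_varD[OF iv]) auto
  moreover have "(\<lambda>x. (real (X j x), \<Sum>l\<in>{1..<j}. real (X l x))) -` ({real n<..} \<times> {..real s}) \<inter> space M
     = {x \<in> space M. (\<Sum>l\<in>{1..<j}. X l x) \<le> s \<and> n < X j x}"
    by (auto simp flip: of_nat_sum)
  moreover have "(\<lambda>x. real (X j x)) -` {real n<..} \<inter> space M = {x \<in> space M. n < X j x}" by auto
  moreover have "(\<lambda>x. \<Sum>l\<in>{1..<j}. real (X l x)) -` {..real s} \<inter> space M = {x \<in> space M. (\<Sum>l\<in>{1..<j}. X l x) \<le> s}"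
    by (auto simp flip: of_nat_sum)
  ultimately show ?thesis using tail[OF assms, of n] by simp
qed

lemma big_jump_event: "{x \<in> space M. big_jump 1 n x} \<in> events"
proof -
  have "{x \<in> space M. big_jump 1 n x} = (\<Union>j\<in>{1..}. {x \<in> space M. (\<Sum>l\<in>{1..<j}. X l x) \<le> n div 40 \<and> n < X j x})"
    by (auto simp: big_jump_def)
  also have "\<dots> \<in> events"
    by (intro sets.countable_UN'' le_less_measurable sum_measurable X_measurable) auto
  finally show ?thesis .
qed

text \<open>For different \<open>j\<close> the events that \<open>j\<close> is the index of the big jump are disjoint.  Each has probability
  at least \<open>F n / 2\<close> as long as \<open>j\<close> is at most of order \<open>1 / F n\<close>, because at a heavy scale the sum of the
  first \<open>j\<close> spacings is then likely to be small.\<close>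

lemma prob_big_jump:
  assumes c: "0 < c" and n: "n \<in> heavy_scales c F"
  shows "1 / (4 * (1 + 40 / c)) \<le> prob {x \<in> space M. big_jump 1 n x}"
proof -
  define \<kappa> where "\<kappa> = 1 + 40 / c"
  have \<kappa>: "0 < \<kappa>" using c by (simp add: \<kappa>_def add_pos_pos)
  have Fn: "0 < F n" and heavy: "c * (\<Sum>k\<le>n. F k) \<le> real (n + 1) * F n"
    using n by (auto simp: heavy_scales_def)
  let ?s = "n div 40"
  have mean: "(\<Sum>k<n. F k) / real (?s + 1) \<le> 40 / c * F n"
  proof -
    have "(\<Sum>k<n. F k) \<le> (\<Sum>k\<le>n. F k)" using F_nonneg by (intro sum_mono2) auto
    also have "\<dots> \<le> real (n + 1) * F n / c" using heavy c by (simp add: field_simps)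
    also have "\<dots> \<le> (40 * real (?s + 1)) * F n / c"
    proof -
      have "n + 1 \<le> 40 * (?s + 1)" by presburger
      then have "real (n + 1) \<le> 40 * real (?s + 1)" by (metis of_nat_mono of_nat_mult of_nat_numeral)
      then show ?thesis using c Fn by (intro divide_right_mono mult_right_mono) auto
    qed
    finally show ?thesis by (simp add: field_simps)
  qed
  \<comment> \<open>up to this many terms, the partial sum is small with probability at least \<open>1/2\<close>\<close>
  define J where "J = nat \<lfloor>1 / (2 * \<kappa> * F n)\<rfloor>"
  have J: "real J \<le> 1 / (2 * \<kappa> * F n)" "1 / (2 * \<kappa> * F n) \<le> real J + 1"
    unfolding J_def using \<kappa> Fn by (simp_all; linarith)+
  define D where "D j = {x \<in> space M. (\<Sum>l\<in>{1..<j}. X l x) \<le> ?s \<and> n < X j x}" for j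
  have Dm: "D j \<in> events" if "j \<in> {1..J+1}" for j
    unfolding D_def by (intro le_less_measurable sum_measurable X_measurable) (use that in auto)
  have Dp: "F n / 2 \<le> prob (D j)" if j: "j \<in> {1..J+1}" for j
  proof -
    have "real (j - 1) * F n + real (j - 1) * (\<Sum>k<n. F k) / real (?s + 1)
        \<le> real (j - 1) * F n + real (j - 1) * (40 / c * F n)"
      using mean mult_left_mono[OF mean, of "real (j - 1)"] by simp
    also have "\<dots> = real (j - 1) * (\<kappa> * F n)" by (simp add: \<kappa>_def algebra_simps)
    also have "\<dots> \<le> real J * (\<kappa> * F n)" using j \<kappa> Fn by (intro mult_right_mono) auto
    also have "\<dots> \<le> 1 / (2 * \<kappa> * F n) * (\<kappa> * F n)" using J \<kappa> Fn by (intro mult_right_mono) auto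
    also have "\<dots> = 1/2" using \<kappa> Fn by simp
    finally have "1/2 \<le> prob {x \<in> space M. (\<Sum>l\<in>{1..<j}. X l x) \<le> ?s}"
      using prob_small_sum[of j n] j by simp
    then have "1/2 * F n \<le> prob {x \<in> space M. (\<Sum>l\<in>{1..<j}. X l x) \<le> ?s} * F n" using Fn by (intro mult_right_mono) auto
    then show ?thesis using indep_sum_jump[of j ?s n] j unfolding D_def by simp
  qed
  have disj: "disjoint_family_on D {1..J+1}"
  proof -
    have False if "x \<in> D i" "x \<in> D j" "i < j" "1 \<le> i" for x i j
    proof -
      have "X i x \<le> (\<Sum>l\<in>{1..<j}. X l x)" using that by (intro member_le_sum) auto
      then have "n < ?s" using that by (auto simp: D_def)
      then show False by simp
    qed
    then show ?thesis unfolding disjoint_family_on_def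
      by (metis (no_types, lifting) atLeastAtMost_iff disjoint_iff linorder_neqE_nat)
  qed
  have "1 / (4 * \<kappa>) = 1 / (2 * \<kappa> * F n) * (F n / 2)" using Fn by simp
  also have "\<dots> \<le> (real J + 1) * (F n / 2)" using J Fn by (intro mult_right_mono) auto
  also have "\<dots> = (\<Sum>j\<in>{1..J+1}. F n / 2)" by simp
  also have "\<dots> \<le> (\<Sum>j\<in>{1..J+1}. prob (D j))" using Dp by (rule sum_mono)
  also have "\<dots> = prob (\<Union>j\<in>{1..J+1}. D j)"
    using Dm disj by (intro finite_measure_finite_Union[symmetric]) auto
  also have "\<dots> \<le> prob {x \<in> space M. big_jump 1 n x}"
  proof (rule finite_measure_mono)
    show "(\<Union>j\<in>{1..J+1}. D j) \<subseteq> {x \<in> space M. big_jump 1 n x}" by (auto simp: D_def big_jump_def)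
    show "{x \<in> space M. big_jump 1 n x} \<in> events" by (rule big_jump_event)
  qed
  finally show ?thesis by (simp add: \<kappa>_def)
qed

lemma gap_of_big_jump:
  assumes "1 \<le> i" "big_jump i n x" "(\<Sum>l\<in>{1..<i}. X l x) \<le> n div 40"
  shows "gap n (selected (\<lambda>k. X k x))"
proof -
  obtain j where j: "i \<le> j" "(\<Sum>l\<in>{i..<j}. X l x) \<le> n div 40" "n < X j x"
    using assms(2) by (auto simp: big_jump_def)
  have "(\<Sum>l\<in>{1..<j}. X l x) = (\<Sum>l\<in>{1..<i}. X l x) + (\<Sum>l\<in>{i..<j}. X l x)"
    using assms(1) j(1) by (simp add: sum.atLeastLessThan_concat)
  then have before: "(\<Sum>l\<in>{1..<j}. X l x) \<le> 2 * (n div 40)" using assms(3) j(2) by simp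
  have "(\<Sum>k=1..m. X k x) \<notin> {2 * (n div 40)<..n}" for m
  proof (cases "m < j")
    case True
    then have "(\<Sum>k=1..m. X k x) \<le> (\<Sum>l\<in>{1..<j}. X l x)" by (intro sum_mono2) auto
    then show ?thesis using before by simp
  next
    case False
    then have "X j x \<le> (\<Sum>k=1..m. X k x)" using assms(1) j(1) by (intro member_le_sum) auto
    then show ?thesis using j(3) by simp
  qed
  then show ?thesis by (auto simp: gap_def selected_def)
qed

text \<open>The event that infinitely many scales have a big jump counted from index \<open>i\<close> on increases with \<open>i\<close>,
  since a fixed spacing exceeds only finitely many scales.  The union over \<open>i\<close> is a tail event of positive
  probability.  The spacings before \<open>i\<close> have a fixed sum, which is negligible at large scales.\<close>

lemma infinitely_many_gaps:
  assumes c: "0 < c" and I: "I \<subseteq> heavy_scales c F" "infinite I"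
  shows "AE x in M. infinite {n \<in> I. gap n (selected (\<lambda>k. X k x))}"
proof -
  define E where "E i = {x \<in> space M. infinite {n \<in> I. big_jump i n x}}" for i
  have meas: "E i \<in> sets N" if "space N = space M" "\<And>j. i \<le> j \<Longrightarrow> X j \<in> measurable N (count_space UNIV)" for N i
  proof -
    have 1: "{x \<in> space N. (\<Sum>l\<in>{i..<j}. X l x) \<le> n div 40 \<and> n < X j x} \<in> sets N" if "i \<le> j" for j n
      by (intro le_less_measurable measurable_sum_nat) (use \<open>\<And>j. i \<le> j \<Longrightarrow> _\<close> that in auto)
    have "E i = (\<Inter>N'. \<Union>n\<in>I \<inter> {N'..}. \<Union>j\<in>{i..}. {x \<in> space N. (\<Sum>l\<in>{i..<j}. X l x) \<le> n div 40 \<and> n < X j x})"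
      unfolding E_def infinite_nat_iff_unbounded_le big_jump_def that(1) by (rule set_eqI) (simp, blast)
    also have "\<dots> \<in> sets N"
      using 1 by (intro sets.countable_INT' image_subsetI sets.countable_UN'') auto
    finally show ?thesis .
  qed
  have mono: "E i \<subseteq> E (Suc i)" for i
  proof
    fix x assume x: "x \<in> E i"
    have "{n \<in> I. big_jump i n x} \<subseteq> {n \<in> I. big_jump (Suc i) n x} \<union> {..X i x}"
    proof
      fix n assume n: "n \<in> {n \<in> I. big_jump i n x}"
      then obtain j where j: "i \<le> j" "(\<Sum>l\<in>{i..<j}. X l x) \<le> n div 40" "n < X j x" by (auto simp: big_jump_def)
      show "n \<in> {n \<in> I. big_jump (Suc i) n x} \<union> {..X i x}"
      proof (cases "j = i")
        case False
        have "(\<Sum>l\<in>{Suc i..<j}. X l x) \<le> (\<Sum>l\<in>{i..<j}. X l x)" by (intro sum_mono2) auto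
        then show ?thesis using n j False by (auto simp: big_jump_def intro!: exI[of _ j])
      qed (use j in auto)
    qed
    moreover have "x \<in> space M" "infinite {n \<in> I. big_jump i n x}" using x unfolding E_def by blast+
    ultimately have "infinite ({n \<in> I. big_jump (Suc i) n x} \<union> {..X i x})" using infinite_super by meson
    then have "infinite {n \<in> I. big_jump (Suc i) n x}" by simp
    then show "x \<in> E (Suc i)" using \<open>x \<in> space M\<close> unfolding E_def by blast
  qed
  have mono': "E i \<subseteq> E j" if "i \<le> j" for i j using lift_Suc_mono_le[of E, OF mono that] .
  define T where "T = (\<Union>i\<in>{1..}. E i)"
  define A where "A i = {X (Suc i) -` B \<inter> space M | B. B \<in> sets (count_space (UNIV :: nat set))}" for i
  have sa: "sigma_algebra (space M) (A i)" for i
  proof -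
    have "A i = sets (vimage_algebra (space M) (X (Suc i)) (count_space UNIV))"
      unfolding A_def by (rule sets_vimage_algebra2[symmetric]) simp
    then show ?thesis
      using sets.sigma_algebra_axioms[of "vimage_algebra (space M) (X (Suc i)) (count_space UNIV)"] by simp
  qed
  have indepA: "indep_sets A UNIV"
  proof -
    define G where "G i = {X i -` B \<inter> space M | B. B \<in> sets (count_space (UNIV :: nat set))}" for i
    have G: "indep_sets G {1..}"
      using indep unfolding indep_vars_def2 G_def by simp
    have A_G: "A i = G (Suc i)" for i by (simp add: A_def G_def)
    show ?thesis
    proof (rule indep_setsI)
      fix i show "A i \<subseteq> events" using G unfolding A_G indep_sets_def by simp
    next
      fix B :: "nat \<Rightarrow> 'a set" and J :: "nat set"
      assume J: "J \<noteq> {}" "finite J" "\<forall>j\<in>J. B j \<in> A j"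
      have "prob (\<Inter>j\<in>Suc ` J. B (j - 1)) = (\<Prod>j\<in>Suc ` J. prob (B (j - 1)))"
        by (rule indep_setsD[OF G]) (use J A_G in auto)
      then show "prob (\<Inter>j\<in>J. B j) = (\<Prod>j\<in>J. prob (B j))" by (simp add: prod.reindex)
    qed
  qed
  have "T \<in> tail_events A"
    unfolding tail_events_def
  proof
    fix m :: nat
    let ?G = "\<Union> (A ` {m..})"
    let ?N = "sigma (space M) ?G"
    have G: "?G \<subseteq> Pow (space M)" by (auto simp: A_def)
    have "X j \<in> measurable ?N (count_space UNIV)" if "Suc m \<le> j" for j
    proof (rule measurableI)
      fix B :: "nat set"
      have "X j -` B \<inter> space M \<in> ?G" using that by (auto simp: A_def intro!: bexI[of _ "j - 1"])
      then show "X j -` B \<inter> space ?N \<in> sets ?N" using G by (simp add: space_measure_of_conv)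
    qed simp
    then have "E i \<in> sets ?N" if "Suc m \<le> i" for i
      using that by (intro meas) (auto simp: space_measure_of_conv)
    then have "(\<Union>i\<in>{Suc m..}. E i) \<in> sets ?N" by (intro sets.countable_UN'') auto
    moreover have "T = (\<Union>i\<in>{Suc m..}. E i)"
    proof
      show "T \<subseteq> (\<Union>i\<in>{Suc m..}. E i)"
      proof
        fix x assume "x \<in> T"
        then obtain i where "x \<in> E i" by (auto simp: T_def)
        then have "x \<in> E (max i (Suc m))" using mono'[of i "max i (Suc m)"] by auto
        then show "x \<in> (\<Union>i\<in>{Suc m..}. E i)" by (intro UN_I[of "max i (Suc m)"]) auto
      qed
    qed (unfold T_def, intro UN_mono, auto)
    ultimately show "T \<in> sigma_sets (space M) ?G" using G by simp
  qed
  then have zero_one: "prob T = 0 \<or> prob T = 1"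
    using kolmogorov_0_1_law[OF sa indepA] by blast
  have Em: "E i \<in> events" if "1 \<le> i" for i using meas[of M i] X_measurable that by simp
  have Tm: "T \<in> events" unfolding T_def using Em by (intro sets.countable_UN'') auto
  define \<rho> where "\<rho> = 1 / (4 * (1 + 40 / c))"
  have \<rho>: "0 < \<rho>" using c by (simp add: \<rho>_def add_pos_pos)
  define V where "V N = (\<Union>n\<in>I \<inter> {N..}. {x \<in> space M. big_jump 1 n x})" for N
  have Vm: "V N \<in> events" for N unfolding V_def using big_jump_event by (intro sets.countable_UN'') auto
  have "\<rho> \<le> prob (V N)" for N
  proof -
    obtain n where n: "N \<le> n" "n \<in> I" using I(2) by (auto simp: infinite_nat_iff_unbounded_le)
    have "\<rho> \<le> prob {x \<in> space M. big_jump 1 n x}" unfolding \<rho>_def using prob_big_jump[OF c] n I(1) by blast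
    also have "\<dots> \<le> prob (V N)" using n Vm by (intro finite_measure_mono) (auto simp: V_def)
    finally show ?thesis .
  qed
  moreover have "(\<lambda>N. prob (V N)) \<longlonglongrightarrow> prob (\<Inter>N. V N)"
    using Vm by (intro finite_Lim_measure_decseq) (auto simp: decseq_def V_def)
  ultimately have "\<rho> \<le> prob (\<Inter>N. V N)" by (intro LIMSEQ_le_const) auto
  also have "(\<Inter>N. V N) = E 1"
    unfolding E_def V_def infinite_nat_iff_unbounded_le by auto
  also have "prob (E 1) \<le> prob T" using Tm by (intro finite_measure_mono) (auto simp: T_def)
  finally have "prob T = 1" using zero_one \<rho> by auto
  then have "AE x in M. x \<in> T" using Tm by (simp add: prob_eq_1)
  then show ?thesis
  proof (rule AE_mp, intro AE_I2 impI)
    fix x assume "x \<in> T"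
    then obtain i where i: "1 \<le> i" "x \<in> E i" by (auto simp: T_def)
    define s where "s = (\<Sum>l\<in>{1..<i}. X l x)"
    have "{n \<in> I. big_jump i n x} \<subseteq> {n \<in> I. gap n (selected (\<lambda>k. X k x))} \<union> {..<40 * s}"
    proof
      fix n assume n: "n \<in> {n \<in> I. big_jump i n x}"
      show "n \<in> {n \<in> I. gap n (selected (\<lambda>k. X k x))} \<union> {..<40 * s}"
      proof (cases "40 * s \<le> n")
        case True
        then have "s \<le> n div 40" by simp
        then show ?thesis using gap_of_big_jump[OF i(1), of n x] n by (auto simp: s_def)
      qed auto
    qed
    moreover have "infinite {n \<in> I. big_jump i n x}" using i(2) unfolding E_def by blast
    ultimately have "infinite ({n \<in> I. gap n (selected (\<lambda>k. X k x))} \<union> {..<40 * s})" using infinite_super by meson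
    then show "infinite {n \<in> I. gap n (selected (\<lambda>k. X k x))}" by simp
  qed
qed

end

section \<open>Absence of percolation\<close>

definition annulusN :: "nat \<Rightarrow> vertex set" where
  "annulusN m = {..20 * m} \<times> {..20 * m} - {..m} \<times> {..m}"

lemma finite_annulusN: "finite (annulusN m)" by (simp add: annulusN_def)

lemma site_of_annulusN: "site_of ` annulusN m = annulus (int m) (20 * int m)"
proof -
  have "site_of ` annulusN m = site_of ` ({..20*m} \<times> {..20*m}) - site_of ` ({..m} \<times> {..m})"
    unfolding annulusN_def using inj_site_of by (rule image_set_diff)
  then show ?thesis by (simp add: annulus_def flip: site_of_box)
qed

text \<open>The arm event of the quadrant annulus, for a set of open sites with natural coordinates.\<close>

definition crosses :: "nat \<Rightarrow> vertex set \<Rightarrow> bool" where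
  "crosses m w \<longleftrightarrow> conn (site_of ` w) (rect 0 (int m + 1) 0 (int m + 1)) (vline (20 * int m) \<union> hline (20 * int m))"

lemma pr_crosses: "pr p (annulusN m) (crosses m) = arm_prob p (int m) (20 * int m)"
proof -
  have "inj_on site_of (annulusN m)" using inj_site_of by (rule inj_on_subset) simp
  from pr_image[OF this, of p "\<lambda>w. conn w (rect 0 (int m + 1) 0 (int m + 1)) (vline (20 * int m) \<union> hline (20 * int m))"]
  show ?thesis unfolding arm_prob_def conn_prob_def site_of_annulusN crosses_def by simp
qed

text \<open>Cut the path at its first exit from the outer box and drop everything up to the last visit to the
  inner box before that.\<close>

lemma leaving_crosses:
  assumes "reach adj4 W u v" "W \<subseteq> {x. 0 \<le> fst x \<and> 0 \<le> snd x}"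
    and "u \<in> rect 0 m 0 m" "v \<notin> rect 0 n 0 n" "0 \<le> m" "m < n"
  shows "conn (W \<inter> annulus m n) (rect 0 (m+1) 0 (m+1)) (vline n \<union> hline n)" (is ?C)
proof -
  from assms(1) have "?C \<or> v \<in> rect 0 m 0 m \<or> (\<exists>u\<in>rect 0 (m+1) 0 (m+1). reach adj4 (W \<inter> annulus m n) u v)"
  proof (induction rule: reach_induct)
    case refl then show ?case using assms by simp
  next
    case (step x y)
    have y: "0 \<le> fst y" "0 \<le> snd y" using step assms(2) by auto
    consider ?C | "x \<in> rect 0 m 0 m" | u where "u \<in> rect 0 (m+1) 0 (m+1)" "reach adj4 (W \<inter> annulus m n) u x"
      using step by blast
    then show ?case
    proof cases
      case 2
      show ?thesis
      proof (cases "y \<in> rect 0 m 0 m")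
        case False
        have "y \<in> rect 0 (m+1) 0 (m+1)" using 2 y step(2) by (auto simp: in_rect' adj4_def)
        moreover have "y \<in> annulus m n" using False calculation assms by (auto simp: annulus_def in_rect')
        ultimately show ?thesis using reach_refl[of y "W \<inter> annulus m n" adj4] step(3) by blast
      qed simp
    next
      case (3 u)
      have x: "x \<in> annulus m n" using reach_in[OF 3(2)] by simp
      show ?thesis
      proof (cases "y \<in> rect 0 n 0 n")
        case True
        then show ?thesis
          using 3 reach_step[OF 3(2) step(2)] step(3) by (cases "y \<in> rect 0 m 0 m") (auto simp: annulus_def)
      next
        case False
        then have "x \<in> vline n \<union> hline n" using x y step(2) by (auto simp: annulus_def in_rect' adj4_def)
        then show ?thesis using 3 unfolding conn_def by blast
      qed
    qed simp
  qed
  moreover have "v \<notin> rect 0 m 0 m" using assms by (auto simp: in_rect')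
  moreover have "v \<in> rect 0 n 0 n" if "reach adj4 (W \<inter> annulus m n) u v" for u
    using reach_in[OF that] by (auto simp: annulus_def)
  ultimately show ?thesis using assms(4) by blast
qed

lemma percolation_crosses:
  assumes "\<omega> \<in> origin_to_infinity" "1 \<le> m"
  shows "crosses m {v \<in> annulusN m. \<omega> v}"
proof -
  have "\<omega> \<in> far (40 * m)" using assms(1) by (simp add: origin_to_infinity_far)
  then obtain v where v: "40 * m < fst v + snd v" "connected_in \<omega> (0,0) v" unfolding far_def by blast
  let ?W = "site_of ` {x. \<omega> x}"
  have r: "reach adj4 ?W (site_of (0,0)) (site_of v)" using connected_in_imp_reach[OF v(2)] by (simp add: reach_site_of)
  have "conn (?W \<inter> annulus (int m) (20 * int m)) (rect 0 (int m+1) 0 (int m+1)) (vline (20 * int m) \<union> hline (20 * int m))"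
    by (rule leaving_crosses[OF r]) (use v(1) assms(2) in \<open>auto simp: site_of_def in_rect\<close>)
  moreover have "?W \<inter> annulus (int m) (20 * int m) = site_of ` {v \<in> annulusN m. \<omega> v}"
    unfolding site_of_annulusN[symmetric] image_Int[OF inj_site_of, symmetric] by (rule arg_cong[where f = "image site_of"]) auto
  ultimately show ?thesis by (simp add: crosses_def)
qed

text \<open>By induction on \<open>k\<close>, percolation implies an event on \<open>k\<close> disjoint annuli outside \<open>C \<times> R\<close> whose
  probability is at most \<open>(1 - \<eta>) ^ k\<close>; the next annulus is chosen beyond the previous ones.\<close>

lemma no_percolation_with_gaps:
  assumes inf: "infinite {n. gap n C \<and> gap n R}"
  shows "measure (env_measure (C \<times> R) p p_crit) origin_to_infinity = 0"
proof -
  obtain \<eta> where \<eta>: "0 < \<eta>" "\<eta> \<le> 1" "\<And>m. 1 \<le> m \<Longrightarrow> arm_prob p_crit m (20*m) \<le> 1 - \<eta>"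
    using arm_at_criticality by blast
  let ?\<mu> = "env_measure (C \<times> R) p p_crit"
  interpret prob_space ?\<mu> unfolding env_measure_def by (rule prob_space_site_measure)
  have q: "0 \<le> p_crit" "p_crit \<le> 1" using p_crit_set by auto
  have blocks: "\<exists>U P. finite U \<and> U \<inter> C \<times> R = {} \<and> pr p_crit U P \<le> (1 - \<eta>) ^ k \<and>
      (\<forall>\<omega>\<in>origin_to_infinity. P {v \<in> U. \<omega> v})" for k
  proof (induction k)
    case 0
    show ?case by (intro exI[of _ "{}"] exI[of _ "\<lambda>_. True"]) (simp add: pr_True)
  next
    case (Suc k)
    then obtain U P where U: "finite U" "U \<inter> C \<times> R = {}" "pr p_crit U P \<le> (1 - \<eta>) ^ k"
      "\<forall>\<omega>\<in>origin_to_infinity. P {v \<in> U. \<omega> v}" by blast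
    obtain b where b: "U \<subseteq> {..b} \<times> {..b}"
    proof -
      obtain b1 where "fst ` U \<subseteq> {..b1}" using finite_nat_iff_bounded_le U(1) by blast
      moreover obtain b2 where "snd ` U \<subseteq> {..b2}" using finite_nat_iff_bounded_le U(1) by blast
      ultimately have "U \<subseteq> {..max b1 b2} \<times> {..max b1 b2}" by fastforce
      then show ?thesis using that by blast
    qed
    obtain n where n: "40 * (b + 1) \<le> n" "gap n C" "gap n R"
      using inf unfolding infinite_nat_iff_unbounded_le by blast
    define m where "m = 2 * (n div 40)"
    have m: "b \<le> m" "1 \<le> m" "20 * m \<le> n" using n(1) by (auto simp: m_def)
    have disj: "U \<inter> annulusN m = {}" using b m by (fastforce simp: annulusN_def)
    have free: "annulusN m \<inter> C \<times> R = {}"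
    proof -
      have *: "x \<le> m" if "x \<in> C \<or> x \<in> R" "x \<le> 20 * m" for x
        using that n(2,3) m(3) by (force simp: gap_def m_def[symmetric] disjoint_iff)
      then show ?thesis by (auto simp: annulusN_def)
    qed
    let ?P = "\<lambda>w. P (w \<inter> U) \<and> crosses m (w \<inter> annulusN m)"
    have "pr p_crit (U \<union> annulusN m) ?P = pr p_crit U P * pr p_crit (annulusN m) (crosses m)"
      by (rule pr_indep_Un[OF U(1) finite_annulusN disj])
    also have "\<dots> \<le> (1 - \<eta>) ^ k * (1 - \<eta>)"
      using U(3) \<eta> m(2) pr_nonneg[OF q, of "annulusN m" "crosses m"]
      by (intro mult_mono) (auto simp: pr_crosses)
    finally have "pr p_crit (U \<union> annulusN m) ?P \<le> (1 - \<eta>) ^ Suc k" by (simp add: mult.commute)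
    moreover have "?P {v \<in> U \<union> annulusN m. \<omega> v}" if "\<omega> \<in> origin_to_infinity" for \<omega>
    proof -
      have "{v \<in> U \<union> annulusN m. \<omega> v} \<inter> U = {v \<in> U. \<omega> v}" "{v \<in> U \<union> annulusN m. \<omega> v} \<inter> annulusN m = {v \<in> annulusN m. \<omega> v}"
        by auto
      then show ?thesis using U(4) that percolation_crosses[OF that m(2)] by simp
    qed
    ultimately show ?case
      using U(1,2) free finite_annulusN by (intro exI[of _ "U \<union> annulusN m"] exI[of _ ?P]) auto
  qed
  have "prob origin_to_infinity \<le> (1 - \<eta>) ^ k" for k
  proof -
    obtain U P where U: "finite U" "U \<inter> C \<times> R = {}" "pr p_crit U P \<le> (1 - \<eta>) ^ k"
      "\<forall>\<omega>\<in>origin_to_infinity. P {v \<in> U. \<omega> v}" using blocks[of k] by blast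
    have r: "(if v \<in> C \<times> R then p else p_crit) = p_crit" if "v \<in> U" for v using U(2) that by auto
    have "prob origin_to_infinity \<le> prob {\<omega>. P {v \<in> U. \<omega> v}}"
    proof (rule finite_measure_mono)
      show "{\<omega>. P {v \<in> U. \<omega> v}} \<in> events"
        unfolding env_measure_def by (rule site_measure_cylinder(1)[OF U(1) q r])
    qed (use U(4) in blast)
    also have "\<dots> = pr p_crit U P"
      unfolding env_measure_def by (rule site_measure_cylinder(2)[OF U(1) q r])
    finally show ?thesis using U(3) by simp
  qed
  moreover have "(\<lambda>k. (1 - \<eta>) ^ k) \<longlonglongrightarrow> 0" using \<eta> by (intro LIMSEQ_realpow_zero) auto
  ultimately have "prob origin_to_infinity \<le> 0" by (intro LIMSEQ_le_const) auto
  then show ?thesis by (simp add: measure_le_0_iff)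
qed

lemma gap_measurable [measurable]: "Measurable.pred nat_subsets (gap n)"
proof -
  have [measurable]: "Measurable.pred nat_subsets (\<lambda>C. k \<in> C)" for k
    unfolding pred_def nat_subsets_def by (auto simp: space_measure_of_conv sets_measure_of_conv)
  have "gap n = (\<lambda>C. \<forall>k\<in>{2 * (n div 40)<..n}. k \<notin> C)" by (intro ext) (auto simp: gap_def)
  then show ?thesis by simp
qed

lemma (in iid_spacings) selected_law_gaps:
  assumes c: "0 < c" and I: "I \<subseteq> heavy_scales c F" "infinite I"
  shows "AE C in selected_law M X. infinite {n \<in> I. gap n C}"
proof -
  have "(\<lambda>x. selected (\<lambda>k. X k x)) \<in> measurable M nat_subsets"
    by (rule measurable_selected) (rule X_measurable)
  moreover have "{C \<in> space nat_subsets. infinite {n \<in> I. gap n C}} \<in> sets nat_subsets"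
    unfolding infinite_nat_iff_unbounded_le by measurable
  ultimately show ?thesis
    unfolding selected_law_def using infinitely_many_gaps[OF assms] by (subst AE_distr_iff) auto
qed

text \<open>One tail function, that of \<open>Z\<close>, serves the columns and the rows.\<close>

lemma iid_spacingsI:
  assumes "prob_space M" "prob_space.indep_vars M (\<lambda>_. count_space UNIV) X {1..}"
    and "\<forall>k\<ge>1. distr M (count_space UNIV) (X k) = distr M (count_space UNIV) (X 1)"
    and "distr M (count_space UNIV) (X 1) = distr M (count_space UNIV) Z"
    and "Z \<in> measurable M (count_space UNIV)"
  shows "iid_spacings M X (\<lambda>n. measure M {x \<in> space M. n < Z x})"
proof -
  interpret prob_space M by fact
  have X: "X k \<in> measurable M (count_space UNIV)" if "1 \<le> k" for k
    using assms(2) that by (auto simp: indep_vars_def)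
  show ?thesis
  proof (unfold_locales; (fact assms(2))?)
    fix k n :: nat assume k: "1 \<le> k"
    have "measure (distr M (count_space UNIV) (X k)) {n<..} = measure (distr M (count_space UNIV) Z) {n<..}"
      using assms(3,4) k by metis
    then show "prob {x \<in> space M. n < X k x} = prob {x \<in> space M. n < Z x}"
      using X[OF k] assms(5) by (simp add: measure_distr vimage_def Int_def conj_commute)
  qed
qed

theorem theorem1:
  fixes M :: "'a measure" and X Y :: "nat \<Rightarrow> 'a \<Rightarrow> nat"
  assumes "prob_space M"
    and "prob_space.indep_vars M (\<lambda>_. count_space UNIV) X {1..}"
    and "\<forall>k\<ge>1. distr M (count_space UNIV) (X k) = distr M (count_space UNIV) (X 1)"
    and "prob_space.indep_vars M (\<lambda>_. count_space UNIV) Y {1..}"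
    and "\<forall>k\<ge>1. distr M (count_space UNIV) (Y k) = distr M (count_space UNIV) (Y 1)"
    and "prob_space.indep_var M
           (Pi\<^sub>M {1..} (\<lambda>_. count_space UNIV)) (\<lambda>x. \<lambda>k\<in>{1..}. X k x)
           (Pi\<^sub>M {1..} (\<lambda>_. count_space UNIV)) (\<lambda>x. \<lambda>k\<in>{1..}. Y k x)"
    and "distr M (count_space UNIV) (X 1) = distr M (count_space UNIV) (Y 1)"
    and "\<exists>\<alpha>::real. 0 < \<alpha> \<and> \<alpha> < 1 \<and>
           (\<integral>\<^sup>+ x. ennreal (real (X 1 x) powr \<alpha>) \<partial>M) = \<infinity>"
  shows "\<forall>\<epsilon>\<in>{0<..1 - p_crit}. AE (C, R) in env_law M X Y.
           measure (env_measure (C \<times> R) (p_crit + \<epsilon>) p_crit) origin_to_infinity = 0"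
proof
  fix \<epsilon> assume "\<epsilon> \<in> {0<..1 - p_crit}"
  interpret prob_space M by fact
  define F where "F n = prob {x \<in> space M. n < X 1 x}" for n
  have X1: "X 1 \<in> measurable M (count_space UNIV)" using assms(2) by (auto simp: indep_vars_def)
  obtain a where a: "0 < a" "a < 1" "(\<integral>\<^sup>+ x. ennreal (real (X 1 x) powr a) \<partial>M) = \<infinity>" using assms(8) by blast
  define c where "c = (1 - a) / 2"
  have c: "0 < c" using a by (simp add: c_def)
  define H where "H = heavy_scales c F"
  have H: "infinite H"
    using infinite_heavy_scales[OF X1 a] by (simp add: H_def c_def F_def[abs_def])
  interpret SX: iid_spacings M X F
    unfolding F_def[abs_def] by (rule iid_spacingsI[OF assms(1-3) refl X1])
  interpret SY: iid_spacings M Y F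
    unfolding F_def[abs_def] by (rule iid_spacingsI[OF assms(1,4,5) assms(7)[symmetric] X1])
  have mX: "(\<lambda>x. selected (\<lambda>k. X k x)) \<in> measurable M nat_subsets"
    by (rule measurable_selected) (rule SX.X_measurable)
  have mY: "(\<lambda>x. selected (\<lambda>k. Y k x)) \<in> measurable M nat_subsets"
    by (rule measurable_selected) (rule SY.X_measurable)
  interpret LX: prob_space "selected_law M X" unfolding selected_law_def by (rule prob_space_distr[OF mX])
  interpret LY: prob_space "selected_law M Y" unfolding selected_law_def by (rule prob_space_distr[OF mY])
  interpret pair_sigma_finite "selected_law M X" "selected_law M Y" ..
  have sets: "sets (selected_law M X) = sets nat_subsets" "sets (selected_law M Y) = sets nat_subsets"
    by (simp_all add: selected_law_def)
  have columns: "AE C in selected_law M X. infinite {n \<in> H. gap n C}"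
    by (rule SX.selected_law_gaps[OF c _ H]) (simp add: H_def)
  have "AE C in selected_law M X. AE R in selected_law M Y. infinite {n \<in> H. gap n C \<and> gap n R}"
  proof (rule AE_mp[OF columns], rule AE_I2, rule impI)
    fix C assume "infinite {n \<in> H. gap n C}"
    then have "AE R in selected_law M Y. infinite {n \<in> {n \<in> H. gap n C}. gap n R}"
      by (intro SY.selected_law_gaps[OF c]) (auto simp: H_def)
    then show "AE R in selected_law M Y. infinite {n \<in> H. gap n C \<and> gap n R}" by simp
  qed
  moreover have "{z \<in> space (selected_law M X \<Otimes>\<^sub>M selected_law M Y). infinite {n \<in> H. gap n (fst z) \<and> gap n (snd z)}}
      \<in> sets (selected_law M X \<Otimes>\<^sub>M selected_law M Y)"
  proof -
    have [measurable]: "Measurable.pred (selected_law M X) (gap n)" "Measurable.pred (selected_law M Y) (gap n)" for n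
      using gap_measurable sets by (metis measurable_cong_sets)+
    show ?thesis unfolding infinite_nat_iff_unbounded_le by measurable
  qed
  ultimately have "AE z in selected_law M X \<Otimes>\<^sub>M selected_law M Y. infinite {n \<in> H. gap n (fst z) \<and> gap n (snd z)}"
    by (intro AE_pair_measure) auto
  then show "AE (C, R) in env_law M X Y. measure (env_measure (C \<times> R) (p_crit + \<epsilon>) p_crit) origin_to_infinity = 0"
    unfolding env_law_def
  proof (rule AE_mp, intro AE_I2 impI)
    fix z assume "infinite {n \<in> H. gap n (fst z) \<and> gap n (snd z)}"
    then have "infinite {n. gap n (fst z) \<and> gap n (snd z)}"
      by (rule contrapos_nn) (auto elim: rev_finite_subset)
    then show "case z of (C, R) \<Rightarrow> measure (env_measure (C \<times> R) (p_crit + \<epsilon>) p_crit) origin_to_infinity = 0"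
      by (cases z) (simp add: no_percolation_with_gaps)
  qed
qed

end
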